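(* Let $V$ be a model of set theory, let $\mathscr{L}\in V$ be a relational language, and let $\mathbf{K}_0$ and $\mathbf{K}_1$ be (in $V$) non-trivial strong Fraïssé classes of finite $\mathscr{L}$-structures, each with only countably many isomorphism types. Suppose $G_0$ is generic for $\mathfrak{C}_\omega(\mathbf{K}_0)$ over $V$. Then there is a $G_1\in V[G_0]$ which is generic for $\mathfrak{C}_\omega(\mathbf{K}_1)$ over $V$.
   Context: A model of set theory is a transitive model of ZFC. Fraïssé classes: let $\mathbf{K}$ be a collection of finite $\mathscr{L}$-structures closed under isomorphism. $\mathbf{K}$ has HP if every substructure of a member is a member. It has JEP if any two members embed in a common member. It has the strong amalgamation property SAP if for all $\mathcal{M}_0,\mathcal{M}_1,\mathcal{M}_2\in\mathbf{K}$ and embeddings $i_1:\mathcal{M}_0\to\mathcal{M}_1$, $i_2:\mathcal{M}_0\to\mathcal{M}_2$ there are $\mathcal{M}_3\in\mathbf{K}$ and embeddings $j_1:\mathcal{M}_1\to\mathcal{M}_3$, $j_2:\mathcal{M}_2\to\mathcal{M}_3$ with $j_1\circ i_1=j_2\circ i_2$ and $j_1[M_1]\cap j_2[M_2]=(j_1\circ i_1)[M_0]$. A strong Fraïssé class is such a $\mathbf{K}$ with HP, JEP and SAP. An $\mathscr{L}$-literal is an atomic $\mathscr{L}$-formula or a (possibly iterated) negation of one; its arity is its number of free variables. A strong Fraïssé class $\mathbf{K}$ is trivial if for every literal $\psi$, say of arity $n$, either for all $\mathcal{A}\in\mathbf{K}$ the formula $\psi$ holds of every $n$-tuple of pairwise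 distinct elements of $\mathcal{A}$, or for all $\mathcal{A}\in\mathbf{K}$ the formula $\neg\psi$ holds of every $n$-tuple of pairwise distinct elements of $\mathcal{A}$. Non-trivial means not trivial. For a set $X$, $\mathfrak{C}_X(\mathbf{K})$ is the partial order of all elements of $\mathbf{K}$ whose underlying set is a (finite) subset of $X$, with $\mathcal{A}\le\mathcal{B}$ ($\mathcal{A}$ stronger) iff $\mathcal{B}$ is a substructure of $\mathcal{A}$. "Generic over $V$" means a generic filter over $V$ for the indicated partial order. *)

theory Defs
  imports Main
begin

section \<open>The ambient universe of sets\<close>

text \<open>
  Transitive models, generic filters and generic extensions live inside an ambient universe of
  well-founded sets, which is the type variable \<open>'u\<close> below. Only what is needed to form
  generic extensions is asked of it: extensionality, foundation, pairing, union and replacement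
  (with separation) for arbitrary HOL functions. Power set is deliberately not required, so that,
  besides full universes of sets, every collection \<open>H(\<kappa>\<^sup>+)\<close> of the sets of hereditary
  cardinality at most \<open>\<kappa>\<close>, with \<open>\<kappa>\<close> infinite, is an instance; each transitive set
  model, together with any filter over it, lies in one of these.
\<close>

class set_universe =
  fixes elts :: "'a \<Rightarrow> 'a set"
  assumes elts_ext: "elts x = elts y \<Longrightarrow> x = y"
    and elts_wf: "wf {(x, y). x \<in> elts y}"
    and elts_pairing: "\<exists>z. elts z = {x, y}"
    and elts_union: "\<exists>z. elts z = (\<Union>y\<in>elts x. elts y)"
    and elts_replacement: "A \<subseteq> f ` elts x \<Longrightarrow> \<exists>z. elts z = A"

definition vset :: "'u::set_universe set \<Rightarrow> 'u" where
  "vset A = (THE x. elts x = A)"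

lemma vset_elts [simp]: "vset (elts x) = x"
  unfolding vset_def by (rule the_equality) (auto intro: elts_ext)

definition kpair :: "'u::set_universe \<Rightarrow> 'u \<Rightarrow> 'u" where
  "kpair a b = vset {vset {a}, vset {a, b}}"

lemma elts_vset_pair [simp]: "elts (vset {a, b :: 'u::set_universe}) = {a, b}"
proof -
  obtain z where "elts z = {a, b}" using elts_pairing by blast
  then show ?thesis using vset_elts[of z] by simp
qed

lemma elts_vset_singleton [simp]: "elts (vset {a :: 'u::set_universe}) = {a}"
  using elts_vset_pair[of a a] by simp

lemma kpair_inject [simp]: "kpair a b = kpair c d \<longleftrightarrow> a = c \<and> b = (d :: 'u::set_universe)"
proof
  assume "kpair a b = kpair c d"
  then have "elts (kpair a b) = elts (kpair c d)"
    by (rule arg_cong)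
  then have "{vset {a}, vset {a, b}} = {vset {c}, vset {c, d}}"
    by (simp only: kpair_def elts_vset_pair)
  then have "elts ` {vset {a}, vset {a, b}} = elts ` {vset {c}, vset {c, d}}"
    by (rule arg_cong)
  then have "{{a}, {a, b}} = {{c}, {c, d}}"
    by (simp only: image_insert image_empty elts_vset_pair elts_vset_singleton)
  then show "a = c \<and> b = d"
    by (auto simp: doubleton_eq_iff)
qed simp

definition vfst :: "'u::set_universe \<Rightarrow> 'u" where
  "vfst p = (THE a. \<exists>b. p = kpair a b)"

definition vsnd :: "'u::set_universe \<Rightarrow> 'u" where
  "vsnd p = (THE b. \<exists>a. p = kpair a b)"

definition is_function :: "'u::set_universe \<Rightarrow> bool" where
  "is_function f \<longleftrightarrow>
     (\<forall>z\<in>elts f. \<exists>a b. z = kpair a b) \<and>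
     (\<forall>a b c. kpair a b \<in> elts f \<longrightarrow> kpair a c \<in> elts f \<longrightarrow> b = c)"

definition vdom :: "'u::set_universe \<Rightarrow> 'u set" where
  "vdom f = {a. \<exists>b. kpair a b \<in> elts f}"

definition vapp :: "'u::set_universe \<Rightarrow> 'u \<Rightarrow> 'u" where
  "vapp f a = (THE b. kpair a b \<in> elts f)"

text \<open>The von Neumann naturals; the set \<open>omega\<close> exists as soon as the universe contains a
  transitive model of Infinity.\<close>

primrec vnat :: "nat \<Rightarrow> 'u::set_universe" where
  "vnat 0 = vset {}"
| "vnat (Suc n) = vset (insert (vnat n) (elts (vnat n)))"

definition omega :: "'u::set_universe" where
  "omega = vset (range vnat)"

text \<open>The \<open>n\<close>-tuple with entries \<open>xs\<close>, as a set-theoretic function with domain \<open>n\<close>.\<close>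

definition vtuple :: "'u::set_universe list \<Rightarrow> 'u" where
  "vtuple xs = vset {kpair (vnat i) (xs ! i) | i. i < length xs}"


section \<open>Transitive models of ZFC\<close>

datatype fm = Mem nat nat | Eq nat nat | Neg fm | Conj fm fm | All nat fm

primrec sat :: "'u::set_universe set \<Rightarrow> (nat \<Rightarrow> 'u) \<Rightarrow> fm \<Rightarrow> bool" where
  "sat M e (Mem i j) \<longleftrightarrow> e i \<in> elts (e j)"
| "sat M e (Eq i j) \<longleftrightarrow> e i = e j"
| "sat M e (Neg \<phi>) \<longleftrightarrow> \<not> sat M e \<phi>"
| "sat M e (Conj \<phi> \<psi>) \<longleftrightarrow> sat M e \<phi> \<and> sat M e \<psi>"
| "sat M e (All i \<phi>) \<longleftrightarrow> (\<forall>x\<in>M. sat M (e(i := x)) \<phi>)"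

text \<open>The axioms of ZFC, interpreted in \<open>(M, \<in>)\<close>: each definition is the relativisation to
  \<open>M\<close> of the usual first-order sentence. In the two schemes the values \<open>e i\<close> at the
  variables other than the displayed ones are the parameters.\<close>

definition ax_extensionality :: "'u::set_universe set \<Rightarrow> bool" where
  "ax_extensionality M \<longleftrightarrow>
     (\<forall>x\<in>M. \<forall>y\<in>M. (\<forall>z\<in>M. z \<in> elts x \<longleftrightarrow> z \<in> elts y) \<longrightarrow> x = y)"

definition ax_foundation :: "'u::set_universe set \<Rightarrow> bool" where
  "ax_foundation M \<longleftrightarrow>
     (\<forall>x\<in>M. (\<exists>y\<in>M. y \<in> elts x) \<longrightarrow>
        (\<exists>y\<in>M. y \<in> elts x \<and> \<not> (\<exists>z\<in>M. z \<in> elts x \<and> z \<in> elts y)))"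

definition ax_pairing :: "'u::set_universe set \<Rightarrow> bool" where
  "ax_pairing M \<longleftrightarrow> (\<forall>x\<in>M. \<forall>y\<in>M. \<exists>z\<in>M. \<forall>w\<in>M. w \<in> elts z \<longleftrightarrow> w = x \<or> w = y)"

definition ax_union :: "'u::set_universe set \<Rightarrow> bool" where
  "ax_union M \<longleftrightarrow>
     (\<forall>x\<in>M. \<exists>z\<in>M. \<forall>w\<in>M. w \<in> elts z \<longleftrightarrow> (\<exists>y\<in>M. y \<in> elts x \<and> w \<in> elts y))"

definition ax_power_set :: "'u::set_universe set \<Rightarrow> bool" where
  "ax_power_set M \<longleftrightarrow>
     (\<forall>x\<in>M. \<exists>z\<in>M. \<forall>w\<in>M. w \<in> elts z \<longleftrightarrow> (\<forall>v\<in>M. v \<in> elts w \<longrightarrow> v \<in> elts x))"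

definition ax_infinity :: "'u::set_universe set \<Rightarrow> bool" where
  "ax_infinity M \<longleftrightarrow>
     (\<exists>x\<in>M. (\<exists>y\<in>M. y \<in> elts x \<and> (\<forall>z\<in>M. z \<notin> elts y)) \<and>
        (\<forall>y\<in>M. y \<in> elts x \<longrightarrow>
           (\<exists>s\<in>M. s \<in> elts x \<and> (\<forall>z\<in>M. z \<in> elts s \<longleftrightarrow> z \<in> elts y \<or> z = y))))"

definition ax_separation :: "'u::set_universe set \<Rightarrow> bool" where
  "ax_separation M \<longleftrightarrow>
     (\<forall>\<phi> e. (\<forall>i. e i \<in> M) \<longrightarrow>
        (\<forall>x\<in>M. \<exists>y\<in>M. \<forall>z\<in>M. z \<in> elts y \<longleftrightarrow> z \<in> elts x \<and> sat M (e(0 := z)) \<phi>))"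

definition ax_replacement :: "'u::set_universe set \<Rightarrow> bool" where
  "ax_replacement M \<longleftrightarrow>
     (\<forall>\<phi> e. (\<forall>i. e i \<in> M) \<longrightarrow>
        (\<forall>a\<in>M.
           (\<forall>x\<in>M. x \<in> elts a \<longrightarrow> (\<exists>!y. y \<in> M \<and> sat M (e(0 := x, 1 := y)) \<phi>)) \<longrightarrow>
           (\<exists>b\<in>M. \<forall>y\<in>M. y \<in> elts b \<longleftrightarrow>
              (\<exists>x\<in>M. x \<in> elts a \<and> sat M (e(0 := x, 1 := y)) \<phi>))))"

text \<open>Choice: every family of pairwise disjoint non-empty sets has a transversal.\<close>

definition ax_choice :: "'u::set_universe set \<Rightarrow> bool" where
  "ax_choice M \<longleftrightarrow>
     (\<forall>a\<in>M.
        (\<forall>x\<in>M. x \<in> elts a \<longrightarrow> (\<exists>z\<in>M. z \<in> elts x)) \<longrightarrow>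
        (\<forall>x\<in>M. \<forall>y\<in>M. x \<in> elts a \<longrightarrow> y \<in> elts a \<longrightarrow> x \<noteq> y \<longrightarrow>
           \<not> (\<exists>z\<in>M. z \<in> elts x \<and> z \<in> elts y)) \<longrightarrow>
        (\<exists>c\<in>M. \<forall>x\<in>M. x \<in> elts a \<longrightarrow> (\<exists>!z. z \<in> M \<and> z \<in> elts x \<and> z \<in> elts c)))"

definition models_ZFC :: "'u::set_universe set \<Rightarrow> bool" where
  "models_ZFC M \<longleftrightarrow>
     ax_extensionality M \<and> ax_foundation M \<and> ax_pairing M \<and> ax_union M \<and>
     ax_power_set M \<and> ax_infinity M \<and> ax_separation M \<and> ax_replacement M \<and> ax_choice M"

definition transitive_model_ZFC :: "'u::set_universe set \<Rightarrow> bool" where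
  "transitive_model_ZFC M \<longleftrightarrow> (\<forall>x\<in>M. elts x \<subseteq> M) \<and> models_ZFC M"

text \<open>The classes of a model are the parametrically definable ones.\<close>

definition definable_class :: "'u::set_universe set \<Rightarrow> 'u set \<Rightarrow> bool" where
  "definable_class M K \<longleftrightarrow>
     (\<exists>\<phi> e. (\<forall>i. e i \<in> M) \<and> K = {x \<in> M. sat M (e(0 := x)) \<phi>})"


section \<open>Relational languages and structures\<close>

text \<open>A relational language is a set-theoretic function \<open>L\<close> sending each relation symbol to its
  arity in \<open>omega\<close>. A structure is a pair of an underlying set (possibly empty) and a function
  sending each symbol \<open>R\<close> to a set of tuples of length the arity of \<open>R\<close>.\<close>

definition relational_language :: "'u::set_universe \<Rightarrow> bool" where
  "relational_language L \<longleftrightarrow> is_function L \<and> (\<forall>R\<in>vdom L. vapp L R \<in> range vnat)"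

definition arity :: "'u::set_universe \<Rightarrow> 'u \<Rightarrow> nat" where
  "arity L R = (THE n. vapp L R = vnat n)"

definition carrier :: "'u::set_universe \<Rightarrow> 'u set" where
  "carrier A = elts (vfst A)"

definition holds_rel :: "'u::set_universe \<Rightarrow> 'u \<Rightarrow> 'u list \<Rightarrow> bool" where
  "holds_rel A R xs \<longleftrightarrow> vtuple xs \<in> elts (vapp (vsnd A) R)"

definition is_structure :: "'u::set_universe \<Rightarrow> 'u \<Rightarrow> bool" where
  "is_structure L A \<longleftrightarrow>
     (\<exists>D I. A = kpair D I \<and> is_function I \<and> vdom I = vdom L \<and>
        (\<forall>R\<in>vdom L. elts (vapp I R) \<subseteq>
           {vtuple xs | xs. length xs = arity L R \<and> set xs \<subseteq> elts D}))"

definition finite_structure :: "'u::set_universe \<Rightarrow> 'u \<Rightarrow> bool" where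
  "finite_structure L A \<longleftrightarrow> is_structure L A \<and> finite (carrier A)"

definition substructure :: "'u::set_universe \<Rightarrow> 'u \<Rightarrow> 'u \<Rightarrow> bool" where
  "substructure L B A \<longleftrightarrow>
     is_structure L A \<and> is_structure L B \<and> carrier B \<subseteq> carrier A \<and>
     (\<forall>R\<in>vdom L. \<forall>xs. length xs = arity L R \<and> set xs \<subseteq> carrier B \<longrightarrow>
        (holds_rel B R xs \<longleftrightarrow> holds_rel A R xs))"

definition embedding :: "'u::set_universe \<Rightarrow> 'u \<Rightarrow> 'u \<Rightarrow> ('u \<Rightarrow> 'u) \<Rightarrow> bool" where
  "embedding L A B h \<longleftrightarrow>
     inj_on h (carrier A) \<and> h ` carrier A \<subseteq> carrier B \<and>
     (\<forall>R\<in>vdom L. \<forall>xs. length xs = arity L R \<and> set xs \<subseteq> carrier A \<longrightarrow>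
        (holds_rel A R xs \<longleftrightarrow> holds_rel B R (map h xs)))"

definition isomorphic :: "'u::set_universe \<Rightarrow> 'u \<Rightarrow> 'u \<Rightarrow> bool" where
  "isomorphic L A B \<longleftrightarrow> (\<exists>h. embedding L A B h \<and> h ` carrier A = carrier B)"


section \<open>Strong Fraisse classes in a model\<close>

text \<open>
  The notions below are relativised to the model \<open>V\<close>: the class \<open>K\<close> is a class of \<open>V\<close>, and
  structures range over \<open>V\<close>. Embeddings are HOL functions; as all the structures are finite,
  their restrictions to the underlying sets are finite sets of pairs from \<open>V\<close> and hence belong to
  \<open>V\<close>, and finiteness itself is absolute, so nothing changes by not relativising these.
\<close>

definition class_of_finite_structures ::
    "'u::set_universe set \<Rightarrow> 'u \<Rightarrow> 'u set \<Rightarrow> bool" where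
  "class_of_finite_structures V L K \<longleftrightarrow>
     definable_class V K \<and>
     (\<forall>A\<in>K. finite_structure L A) \<and>
     (\<forall>A\<in>K. \<forall>B\<in>V. is_structure L B \<and> isomorphic L A B \<longrightarrow> B \<in> K)"

definition HP :: "'u::set_universe set \<Rightarrow> 'u \<Rightarrow> 'u set \<Rightarrow> bool" where
  "HP V L K \<longleftrightarrow> (\<forall>A\<in>K. \<forall>B\<in>V. substructure L B A \<longrightarrow> B \<in> K)"

definition JEP :: "'u::set_universe \<Rightarrow> 'u set \<Rightarrow> bool" where
  "JEP L K \<longleftrightarrow>
     (\<forall>A\<in>K. \<forall>B\<in>K. \<exists>C\<in>K. (\<exists>f. embedding L A C f) \<and> (\<exists>g. embedding L B C g))"

definition SAP :: "'u::set_universe \<Rightarrow> 'u set \<Rightarrow> bool" where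
  "SAP L K \<longleftrightarrow>
     (\<forall>M0\<in>K. \<forall>M1\<in>K. \<forall>M2\<in>K. \<forall>i1 i2.
        embedding L M0 M1 i1 \<and> embedding L M0 M2 i2 \<longrightarrow>
        (\<exists>M3\<in>K. \<exists>j1 j2.
           embedding L M1 M3 j1 \<and> embedding L M2 M3 j2 \<and>
           (\<forall>x\<in>carrier M0. j1 (i1 x) = j2 (i2 x)) \<and>
           j1 ` carrier M1 \<inter> j2 ` carrier M2 = (j1 \<circ> i1) ` carrier M0))"

definition strong_fraisse_class :: "'u::set_universe set \<Rightarrow> 'u \<Rightarrow> 'u set \<Rightarrow> bool" where
  "strong_fraisse_class V L K \<longleftrightarrow>
     class_of_finite_structures V L K \<and> HP V L K \<and> JEP L K \<and> SAP L K"

text \<open>An enumeration, lying in \<open>V\<close> and indexed by natural numbers, of representatives of all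
  isomorphism types.\<close>

definition countably_many_iso_types :: "'u::set_universe set \<Rightarrow> 'u \<Rightarrow> 'u set \<Rightarrow> bool" where
  "countably_many_iso_types V L K \<longleftrightarrow>
     (\<exists>f\<in>V. is_function f \<and> vdom f \<subseteq> elts omega \<and> (\<forall>n\<in>vdom f. vapp f n \<in> K) \<and>
        (\<forall>A\<in>K. \<exists>n\<in>vdom f. isomorphic L A (vapp f n)))"

datatype 'r literal = RelAtom 'r "nat list" | EqAtom nat nat | NegLit "'r literal"

primrec literal_of :: "'u::set_universe \<Rightarrow> 'u literal \<Rightarrow> bool" where
  "literal_of L (RelAtom R vs) \<longleftrightarrow> R \<in> vdom L \<and> length vs = arity L R"
| "literal_of L (EqAtom v w) \<longleftrightarrow> True"
| "literal_of L (NegLit \<psi>) \<longleftrightarrow> literal_of L \<psi>"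

primrec free_vars :: "'r literal \<Rightarrow> nat set" where
  "free_vars (RelAtom R vs) = set vs"
| "free_vars (EqAtom v w) = {v, w}"
| "free_vars (NegLit \<psi>) = free_vars \<psi>"

definition literal_arity :: "'r literal \<Rightarrow> nat" where
  "literal_arity \<psi> = card (free_vars \<psi>)"

primrec literal_sat :: "'u::set_universe \<Rightarrow> (nat \<Rightarrow> 'u) \<Rightarrow> 'u literal \<Rightarrow> bool" where
  "literal_sat A s (RelAtom R vs) \<longleftrightarrow> holds_rel A R (map s vs)"
| "literal_sat A s (EqAtom v w) \<longleftrightarrow> s v = s w"
| "literal_sat A s (NegLit \<psi>) \<longleftrightarrow> \<not> literal_sat A s \<psi>"

text \<open>The \<open>k\<close>-th free variable of \<open>\<psi>\<close> in increasing order is assigned the \<open>k\<close>-th entry.\<close>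

definition literal_holds_of :: "'u::set_universe \<Rightarrow> 'u literal \<Rightarrow> 'u list \<Rightarrow> bool" where
  "literal_holds_of A \<psi> xs \<longleftrightarrow>
     literal_sat A (\<lambda>v. xs ! card {w \<in> free_vars \<psi>. w < v}) \<psi>"

definition holds_of_distinct_tuples :: "'u::set_universe set \<Rightarrow> 'u literal \<Rightarrow> bool" where
  "holds_of_distinct_tuples K \<psi> \<longleftrightarrow>
     (\<forall>A\<in>K. \<forall>xs. length xs = literal_arity \<psi> \<and> distinct xs \<and> set xs \<subseteq> carrier A \<longrightarrow>
        literal_holds_of A \<psi> xs)"

definition trivial_class :: "'u::set_universe \<Rightarrow> 'u set \<Rightarrow> bool" where
  "trivial_class L K \<longleftrightarrow>
     (\<forall>\<psi>. literal_of L \<psi> \<longrightarrow>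
        holds_of_distinct_tuples K \<psi> \<or> holds_of_distinct_tuples K (NegLit \<psi>))"


section \<open>The forcing notion of finite structures on a set\<close>

definition conditions :: "'u::set_universe \<Rightarrow> 'u set \<Rightarrow> 'u set" where
  "conditions X K = {A \<in> K. carrier A \<subseteq> elts X}"

text \<open>\<open>stronger L A B\<close> is \<open>A \<le> B\<close>.\<close>

definition stronger :: "'u::set_universe \<Rightarrow> 'u \<Rightarrow> 'u \<Rightarrow> bool" where
  "stronger L A B \<longleftrightarrow> substructure L B A"


section \<open>Generic filters and generic extensions\<close>

definition dense_in :: "'u set \<Rightarrow> ('u \<Rightarrow> 'u \<Rightarrow> bool) \<Rightarrow> 'u set \<Rightarrow> bool" where
  "dense_in P le D \<longleftrightarrow> D \<subseteq> P \<and> (\<forall>p\<in>P. \<exists>d\<in>D. le d p)"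

definition is_filter_on :: "'u set \<Rightarrow> ('u \<Rightarrow> 'u \<Rightarrow> bool) \<Rightarrow> 'u set \<Rightarrow> bool" where
  "is_filter_on P le G \<longleftrightarrow>
     G \<subseteq> P \<and> G \<noteq> {} \<and>
     (\<forall>p\<in>G. \<forall>q\<in>P. le p q \<longrightarrow> q \<in> G) \<and>
     (\<forall>p\<in>G. \<forall>q\<in>G. \<exists>r\<in>G. le r p \<and> le r q)"

definition generic_over ::
    "'u::set_universe set \<Rightarrow> 'u set \<Rightarrow> ('u \<Rightarrow> 'u \<Rightarrow> bool) \<Rightarrow> 'u \<Rightarrow> bool" where
  "generic_over V P le G \<longleftrightarrow>
     is_filter_on P le (elts G) \<and>
     (\<forall>D\<in>V. dense_in P le (elts D) \<longrightarrow> elts G \<inter> elts D \<noteq> {})"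

inductive is_name :: "'u::set_universe set \<Rightarrow> 'u \<Rightarrow> bool" for P where
  "(\<forall>z\<in>elts \<tau>. \<exists>\<sigma> p. z = kpair \<sigma> p \<and> is_name P \<sigma> \<and> p \<in> P) \<Longrightarrow> is_name P \<tau>"

function name_val :: "'u::set_universe \<Rightarrow> 'u \<Rightarrow> 'u" where
  "name_val G \<tau> = vset (name_val G ` {\<sigma>. \<exists>p\<in>elts G. kpair \<sigma> p \<in> elts \<tau>})"
  by pat_completeness auto
termination
proof (relation "inv_image ({(x, y). x \<in> elts y}\<^sup>+) snd")
  show "wf (inv_image ({(x, y :: 'u::set_universe). x \<in> elts y}\<^sup>+) snd)"
    by (intro wf_inv_image wf_trancl elts_wf)
next
  fix G \<tau> \<sigma> :: "'u::set_universe"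
  assume "\<sigma> \<in> {\<sigma>. \<exists>p\<in>elts G. kpair \<sigma> p \<in> elts \<tau>}"
  then obtain p where p: "kpair \<sigma> p \<in> elts \<tau>" by blast
  let ?r = "{(x, y :: 'u::set_universe). x \<in> elts y}"
  have "(\<sigma>, vset {\<sigma>}) \<in> ?r" and "(vset {\<sigma>}, kpair \<sigma> p) \<in> ?r" and "(kpair \<sigma> p, \<tau>) \<in> ?r"
    using p by (simp_all add: kpair_def)
  then have "(\<sigma>, \<tau>) \<in> ?r\<^sup>+" by (meson trancl.intros)
  then show "((G, \<sigma>), (G, \<tau>)) \<in> inv_image (?r\<^sup>+) snd" by simp
qed

declare name_val.simps [simp del]

definition generic_extension ::
    "'u::set_universe set \<Rightarrow> 'u set \<Rightarrow> 'u \<Rightarrow> 'u set" where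
  "generic_extension V P G = {name_val G \<tau> | \<tau>. \<tau> \<in> V \<and> is_name P \<tau>}"

end

theory Submission
  imports Defs
begin

text \<open>
  A non-trivial literal provides two different structures \<open>A\<close>, \<open>A'\<close> of \<open>K0\<close> on the same underlying
  set \<open>{..<n}\<close>. Cut \<open>omega\<close> into consecutive blocks of length \<open>n\<close>. By strong amalgamation over the
  empty structure, a condition with underlying set the first \<open>k\<close> blocks can be extended by the
  next block so that the restriction to this block is a copy of \<open>A\<close>, or of \<open>A'\<close>, as we like; so
  the bits telling on which blocks \<open>G0\<close> is a copy of \<open>A\<close> form a Cohen real.

  Let \<open>g\<close> be an enumeration in \<open>V\<close> of the conditions for \<open>K1\<close> in which each occurs infinitely often.
  A condition for \<open>K0\<close> containing the first \<open>m\<close> blocks is projected to the last member of the chain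
  that starts at \<open>g 0\<close> and at stage \<open>k < m\<close> moves to \<open>g k\<close> if the \<open>k\<close>-th block is a copy of \<open>A\<close> and
  \<open>g k\<close> is stronger than the present member. Below any condition for \<open>K1\<close> that is the present member,
  every stronger condition can be reached, by writing \<open>A'\<close> until \<open>g\<close> lists it and then \<open>A\<close>. Hence the
  filter generated by the projection of \<open>G0\<close> is generic.
\<close>

section \<open>Definability over a transitive model\<close>

text \<open>Two things must belong to \<open>V\<close>: the pull-back to \<open>K0\<close> of a
  dense set for \<open>K1\<close>, and a name for the new filter. Since \<open>V\<close> is merely a
  set of the ambient universe, an object built with HOL functions and HOL recursion is in
  \<open>V\<close> only if its construction is definable over \<open>V\<close>. This shapes the
  first half: \<open>dfn\<close> and \<open>tm\<close> record definability with parameters without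
  displaying formulas, and the later constructions are arranged as total operations of this kind,
  including recursion along \<open>omega\<close>, canonical names and the comparison of structures.
  Projecting directly avoids passing through the intermediate extension by a Cohen real. The
  projection depends on a number \<open>m\<close> of blocks contained in the condition; a larger
  \<open>m\<close> gives a stronger value, and the new filter consists of everything above one of
  these values. The chain only tests for copies of \<open>A\<close>; the role of \<open>A'\<close>
  is to make the test fail. Infinite repetition in \<open>g\<close> is needed because a condition
  can be entered only at a stage that lists it, and the blocks of a given condition have already
  used up an initial segment of the stages.\<close>

primrec fv :: "fm \<Rightarrow> nat set" where
  "fv (Mem i j) = {i, j}"
| "fv (Eq i j) = {i, j}"
| "fv (Neg \<phi>) = fv \<phi>"
| "fv (Conj \<phi> \<psi>) = fv \<phi> \<union> fv \<psi>"
| "fv (All i \<phi>) = fv \<phi>"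

lemma finite_fv: "finite (fv \<phi>)"
  by (induction \<phi>) auto

text \<open>\<open>fv\<close> does not remove bound variables, so it is only a finite upper bound
  for the free ones. Agreement on this larger set is preserved by updating both environments at the
  bound variable.\<close>

lemma sat_cong: "(\<And>i. i \<in> fv \<phi> \<Longrightarrow> e i = e' i) \<Longrightarrow> sat M e \<phi> \<longleftrightarrow> sat M e' \<phi>"
proof (induction \<phi> arbitrary: e e')
  case (All i \<phi>)
  have "sat M (e(i := x)) \<phi> \<longleftrightarrow> sat M (e'(i := x)) \<phi>" for x
    using All.prems by (intro All.IH) auto
  then show ?case by simp
next
  case (Neg \<phi>)
  have "sat M e \<phi> \<longleftrightarrow> sat M e' \<phi>" using Neg.prems by (intro Neg.IH) simp
  then show ?case by simp
next
  case (Conj \<phi> \<psi>)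
  have "sat M e \<phi> \<longleftrightarrow> sat M e' \<phi>" using Conj.prems by (intro Conj.IH) simp
  moreover have "sat M e \<psi> \<longleftrightarrow> sat M e' \<psi>" using Conj.prems by (intro Conj.IH) simp
  ultimately show ?case by simp
qed auto

text \<open>The renaming need not be injective, so syntactic substitution could capture variables;
  the quantifier case therefore moves to a fresh bound variable.\<close>

lemma sat_rename: "\<exists>\<phi>'. \<forall>e. sat M e \<phi>' \<longleftrightarrow> sat M (\<lambda>n. e (f n)) \<phi>"
proof (induction \<phi> arbitrary: f)
  case (Mem i j)
  show ?case by (rule exI[of _ "Mem (f i) (f j)"]) simp
next
  case (Eq i j)
  show ?case by (rule exI[of _ "Eq (f i) (f j)"]) simp
next
  case (Neg \<phi>)
  then obtain \<phi>' where "\<forall>e. sat M e \<phi>' \<longleftrightarrow> sat M (\<lambda>n. e (f n)) \<phi>" by blast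
  then show ?case by (intro exI[of _ "Neg \<phi>'"]) simp
next
  case (Conj \<phi> \<psi>)
  obtain \<phi>' where "\<forall>e. sat M e \<phi>' \<longleftrightarrow> sat M (\<lambda>n. e (f n)) \<phi>" using Conj.IH(1) by blast
  moreover obtain \<psi>' where "\<forall>e. sat M e \<psi>' \<longleftrightarrow> sat M (\<lambda>n. e (f n)) \<psi>"
    using Conj.IH(2) by blast
  ultimately show ?case by (intro exI[of _ "fm.Conj \<phi>' \<psi>'"]) simp
next
  case (All i \<phi>)
  \<comment> \<open>Freshness is needed only against the images of variables that occur in the body,
    and these are finitely many.\<close>
  obtain j where j: "j \<notin> f ` fv \<phi>"
    using ex_new_if_finite[OF infinite_UNIV_nat] finite_fv by blast
  obtain \<phi>' where "\<forall>e. sat M e \<phi>' \<longleftrightarrow> sat M (\<lambda>n. e ((f(i := j)) n)) \<phi>"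
    using All.IH by blast
  then have \<phi>': "sat M e \<phi>' \<longleftrightarrow> sat M (\<lambda>n. e ((f(i := j)) n)) \<phi>" for e by blast
  have "sat M e (All j \<phi>') \<longleftrightarrow> sat M (\<lambda>n. e (f n)) (All i \<phi>)" for e
  proof -
    have "sat M (e(j := x)) \<phi>' \<longleftrightarrow> sat M ((\<lambda>n. e (f n))(i := x)) \<phi>" for x
      unfolding \<phi>' using j by (intro sat_cong) auto
    then show ?thesis by simp
  qed
  then show ?case by blast
qed

definition mix :: "(nat \<Rightarrow> 'a) \<Rightarrow> (nat \<Rightarrow> 'a) \<Rightarrow> nat \<Rightarrow> 'a" where
  "mix e c n = (if even n then e (n div 2) else c (n div 2))"

section \<open>Sets formed in the ambient universe\<close>

lemma elts_vset_image [simp]: "elts (vset (f ` elts x)) = f ` elts x" for f :: "'u \<Rightarrow> 'u::set_universe"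
  using elts_replacement[of "f ` elts x" f x] by (metis order_refl vset_elts)

lemma elts_vset_subset: "A \<subseteq> elts x \<Longrightarrow> elts (vset A) = A" for x :: "'u::set_universe"
  using elts_replacement[of A "\<lambda>y. y" x] by (metis image_ident vset_elts)

lemma elts_vset_Collect [simp]: "elts (vset {y \<in> elts x. P y}) = {y \<in> elts x. P y}"
  for x :: "'u::set_universe"
  by (rule elts_vset_subset) auto

lemma elts_vset_Union [simp]: "elts (vset (\<Union>y\<in>elts x. elts y)) = (\<Union>y\<in>elts x. elts y)"
  for x :: "'u::set_universe"
  using elts_union[of x] vset_elts by metis

lemma elts_vset_insert:
  "elts (vset (insert a (elts x))) = insert a (elts x)" for a x :: "'u::set_universe"
proof -
  have "(\<Union>y\<in>elts (vset {vset {a}, x}). elts y) = insert a (elts x)" by simp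
  then show ?thesis using elts_vset_Union[of "vset {vset {a}, x}"] by simp
qed

lemma elts_vset_empty [simp]: "elts (vset {} :: 'u::set_universe) = {}"
  using elts_vset_subset[of "{}"] by blast

lemma elts_vset_finite: "finite A \<Longrightarrow> elts (vset A) = (A :: 'u::set_universe set)"
proof (induction rule: finite_induct)
  case (insert a A)
  then show ?case using elts_vset_insert[of a "vset A"] by simp
qed simp

section \<open>Predicates and operations definable over \<open>V\<close> with parameters\<close>

locale zfc_model =
  fixes V :: "'u::set_universe set"
  assumes model: "transitive_model_ZFC V"
begin

lemma V_trans: "x \<in> V \<Longrightarrow> y \<in> elts x \<Longrightarrow> y \<in> V"
  using model unfolding transitive_model_ZFC_def by blast

abbreviation env :: "(nat \<Rightarrow> 'u) \<Rightarrow> bool" where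
  "env e \<equiv> \<forall>i. e i \<in> V"

text \<open>Environments are stacks: in a subterm below a binder, \<open>e 0\<close> is the bound variable and
  \<open>\<lambda>n. e (Suc n)\<close> the environment outside. In the formulas, even variables carry the environment
  and odd variables the parameters.\<close>

definition dfn :: "((nat \<Rightarrow> 'u) \<Rightarrow> bool) \<Rightarrow> bool" where
  "dfn P \<longleftrightarrow> (\<exists>\<phi> c. env c \<and> (\<forall>e. env e \<longrightarrow> (P e \<longleftrightarrow> sat V (mix e c) \<phi>)))"

text \<open>A definable operation is one whose graph is definable. Totality with values in
  \<open>V\<close> is part of the notion, so that a term can be eliminated by a quantifier over
  \<open>V\<close>.\<close>

definition tm :: "((nat \<Rightarrow> 'u) \<Rightarrow> 'u) \<Rightarrow> bool" where
  "tm t \<longleftrightarrow> (\<forall>e. env e \<longrightarrow> t e \<in> V) \<and> dfn (\<lambda>e. e 0 = t (\<lambda>n. e (Suc n)))"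

lemma V_nonempty: "\<exists>x. x \<in> V"
  using model unfolding transitive_model_ZFC_def models_ZFC_def ax_infinity_def by blast

lemma dfn_cong: "dfn Q \<Longrightarrow> (\<And>e. env e \<Longrightarrow> P e \<longleftrightarrow> Q e) \<Longrightarrow> dfn P"
  unfolding dfn_def by simp

text \<open>The entry point from formulas to predicates: the first \<open>m\<close> variables are
  read from the environment along \<open>f\<close>, all others are parameters. Atomic predicates and
  membership in a definable class are instances.\<close>

lemma dfn_sat:
  assumes "env c"
  shows "dfn (\<lambda>e. sat V (\<lambda>n. if n < m then e (f n) else c n) \<phi>)"
proof -
  obtain \<phi>' where "\<forall>e. sat V e \<phi>' \<longleftrightarrow>
      sat V (\<lambda>n. e (if n < m then 2 * f n else 2 * n + 1)) \<phi>"
    using sat_rename[of V "\<lambda>n. if n < m then 2 * f n else 2 * n + 1" \<phi>] by (elim exE)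
  moreover have "(\<lambda>n. mix e c (if n < m then 2 * f n else 2 * n + 1)) =
     (\<lambda>n. if n < m then e (f n) else c n)" for e
    by (auto simp: mix_def)
  ultimately have "\<forall>e. env e \<longrightarrow>
      (sat V (\<lambda>n. if n < m then e (f n) else c n) \<phi> \<longleftrightarrow> sat V (mix e c) \<phi>')"
    by simp
  with assms show ?thesis unfolding dfn_def by blast
qed

lemma dfn_mem_var: "dfn (\<lambda>e. e i \<in> elts (e j))"
proof -
  obtain c where "c \<in> V" using V_nonempty by blast
  from dfn_sat[of "\<lambda>_. c" 2 "\<lambda>n. if n = 0 then i else j" "Mem 0 1"] \<open>c \<in> V\<close> show ?thesis by simp
qed

lemma dfn_eq_var: "dfn (\<lambda>e. e i = e j)"
proof -
  obtain c where "c \<in> V" using V_nonempty by blast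
  from dfn_sat[of "\<lambda>_. c" 2 "\<lambda>n. if n = 0 then i else j" "Eq 0 1"] \<open>c \<in> V\<close> show ?thesis by simp
qed

lemma dfn_eq_const: "c \<in> V \<Longrightarrow> dfn (\<lambda>e. e i = c)"
  using dfn_sat[of "\<lambda>_. c" 1 "\<lambda>_. i" "Eq 0 1"] by simp

lemma dfn_not: "dfn P \<Longrightarrow> dfn (\<lambda>e. \<not> P e)"
  unfolding dfn_def by (elim exE, rule_tac x = "Neg \<phi>" in exI) auto

lemma dfn_conj:
  assumes "dfn P" "dfn Q" shows "dfn (\<lambda>e. P e \<and> Q e)"
proof -
  obtain \<phi> c where c: "env c" "\<And>e. env e \<Longrightarrow> P e \<longleftrightarrow> sat V (mix e c) \<phi>"
    using assms unfolding dfn_def by blast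
  obtain \<psi> d where d: "env d" "\<And>e. env e \<Longrightarrow> Q e \<longleftrightarrow> sat V (mix e d) \<psi>"
    using assms unfolding dfn_def by blast
  \<comment> \<open>The parameters of both conjuncts are merged into one sequence
    \<open>mix c d\<close>. Entry \<open>k\<close> of \<open>c\<close> then sits at variable
    \<open>4 * k + 1\<close> and entry \<open>k\<close> of \<open>d\<close> at
    \<open>4 * k + 3\<close>.\<close>
  define f where "f n = (if even n then n else 4 * (n div 2) + 1)" for n :: nat
  define g where "g n = (if even n then n else 4 * (n div 2) + 3)" for n :: nat
  obtain \<phi>' where \<phi>': "\<And>e. sat V e \<phi>' \<longleftrightarrow> sat V (\<lambda>n. e (f n)) \<phi>" using sat_rename by blast
  obtain \<psi>' where \<psi>': "\<And>e. sat V e \<psi>' \<longleftrightarrow> sat V (\<lambda>n. e (g n)) \<psi>" using sat_rename by blast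
  have "env (mix c d)" using c(1) d(1) by (simp add: mix_def)
  have f: "(\<lambda>n. mix e (mix c d) (f n)) = mix e c" for e
  proof
    fix n show "mix e (mix c d) (f n) = mix e c n"
    proof (cases "even n")
      case False
      have "(4 * (n div 2) + 1) div 2 = 2 * (n div 2)" "(n - Suc 0) div 2 = n div 2"
        using False by presburger+
      with False show ?thesis by (simp add: mix_def f_def)
    qed (simp add: mix_def f_def)
  qed
  have g: "(\<lambda>n. mix e (mix c d) (g n)) = mix e d" for e
  proof
    fix n show "mix e (mix c d) (g n) = mix e d n"
    proof (cases "even n")
      case False
      have "(4 * (n div 2) + 3) div 2 = 2 * (n div 2) + 1" by presburger
      with False show ?thesis by (simp add: mix_def g_def)
    qed (simp add: mix_def g_def)
  qed
  have "P e \<and> Q e \<longleftrightarrow> sat V (mix e (mix c d)) (Conj \<phi>' \<psi>')" if "env e" for e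
    unfolding sat.simps \<phi>' \<psi>' f g c(2)[OF that] d(2)[OF that] ..
  with \<open>env (mix c d)\<close> show ?thesis unfolding dfn_def by blast
qed

lemma dfn_all:
  assumes "dfn (\<lambda>e. P (\<lambda>n. e (Suc n)) (e 0))"
  shows "dfn (\<lambda>e. \<forall>x\<in>V. P e x)"
proof -
  obtain \<phi> c where c: "env c"
      "\<And>e. env e \<Longrightarrow> P (\<lambda>n. e (Suc n)) (e 0) \<longleftrightarrow> sat V (mix e c) \<phi>"
    using assms unfolding dfn_def by blast
  obtain b where b: "\<And>i. i \<in> fv \<phi> \<Longrightarrow> i < b"
    using finite_fv[of \<phi>] by (metis finite_nat_set_iff_bounded)
  \<comment> \<open>The quantified variable is a parameter slot beyond every variable of
    \<open>\<phi>\<close>: overwriting it disturbs neither the environment nor a parameter that is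
    read. The renaming sends variable 0, the top of the stack, to \<open>j\<close> and moves the
    other even variables down by one place of the stack.\<close>
  define j where "j = 2 * b + 1"
  have j: "j \<notin> fv \<phi>" "odd j" using b[of j] by (auto simp: j_def)
  define f where "f n = (if n = 0 then j else if even n then n - 2 else n)" for n :: nat
  obtain \<phi>' where \<phi>': "\<And>e. sat V e \<phi>' \<longleftrightarrow> sat V (\<lambda>n. e (f n)) \<phi>" using sat_rename by blast
  have "P e x \<longleftrightarrow> sat V ((mix e c)(j := x)) \<phi>'" if "env e" "x \<in> V" for e x
  proof -
    define e' where "e' n = (if n = 0 then x else e (n - 1))" for n :: nat
    have "P (\<lambda>n. e' (Suc n)) (e' 0) \<longleftrightarrow> sat V (mix e' c) \<phi>"
      using that by (intro c) (auto simp: e'_def)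
    also have "\<dots> \<longleftrightarrow> sat V ((mix e c)(j := x)) \<phi>'"
      unfolding \<phi>'
    proof (rule sat_cong)
      fix i assume "i \<in> fv \<phi>"
      show "mix e' c i = ((mix e c)(j := x)) (f i)"
      proof (cases "even i \<and> i \<noteq> 0")
        case True
        then obtain k where "i = 2 * Suc k" by (metis dvd_def mult_0_right old.nat.exhaust)
        with j show ?thesis by (auto simp: mix_def f_def e'_def)
      next
        case False
        with j \<open>i \<in> fv \<phi>\<close> show ?thesis by (auto simp: mix_def f_def e'_def)
      qed
    qed
    finally show ?thesis by (simp add: e'_def)
  qed
  then have "\<forall>e. env e \<longrightarrow> ((\<forall>x\<in>V. P e x) \<longleftrightarrow> sat V (mix e c) (All j \<phi>'))"
    by (metis sat.simps(5))
  with c(1) show ?thesis unfolding dfn_def by blast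
qed

lemma dfn_ren:
  assumes "dfn P" shows "dfn (\<lambda>e. P (\<lambda>n. e (f n)))"
proof -
  obtain \<phi> c where c: "env c" "\<And>e. env e \<Longrightarrow> P e \<longleftrightarrow> sat V (mix e c) \<phi>"
    using assms unfolding dfn_def by blast
  define g where "g n = (if even n then 2 * f (n div 2) else n)" for n :: nat
  obtain \<phi>' where \<phi>': "\<And>e. sat V e \<phi>' \<longleftrightarrow> sat V (\<lambda>n. e (g n)) \<phi>" using sat_rename by blast
  have "(\<lambda>n. mix e c (g n)) = mix (\<lambda>n. e (f n)) c" for e
    by (auto simp: mix_def g_def)
  then have "\<forall>e. env e \<longrightarrow> (P (\<lambda>n. e (f n)) \<longleftrightarrow> sat V (mix e c) \<phi>')"
    using c by (simp add: \<phi>')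
  with c show ?thesis unfolding dfn_def by blast
qed

lemma dfn_disj:
  assumes "dfn P" "dfn Q" shows "dfn (\<lambda>e. P e \<or> Q e)"
proof (rule dfn_cong)
  show "dfn (\<lambda>e. \<not> (\<not> P e \<and> \<not> Q e))"
    by (intro dfn_not dfn_conj assms)
qed simp

lemma dfn_imp:
  assumes "dfn P" "dfn Q" shows "dfn (\<lambda>e. P e \<longrightarrow> Q e)"
proof (rule dfn_cong)
  show "dfn (\<lambda>e. \<not> P e \<or> Q e)"
    by (intro dfn_not dfn_disj assms)
qed simp

lemma dfn_iff:
  assumes "dfn P" "dfn Q" shows "dfn (\<lambda>e. P e \<longleftrightarrow> Q e)"
proof (rule dfn_cong)
  show "dfn (\<lambda>e. (P e \<longrightarrow> Q e) \<and> (Q e \<longrightarrow> P e))"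
    by (intro dfn_conj dfn_imp assms)
qed blast

lemma dfn_ex:
  assumes "dfn (\<lambda>e. P (\<lambda>n. e (Suc n)) (e 0))" shows "dfn (\<lambda>e. \<exists>x\<in>V. P e x)"
proof (rule dfn_cong)
  show "dfn (\<lambda>e. \<not> (\<forall>x\<in>V. \<not> P e x))"
    by (intro dfn_not dfn_all assms)
qed simp

lemma tm_mem: "tm t \<Longrightarrow> env e \<Longrightarrow> t e \<in> V"
  unfolding tm_def by blast

lemma tm_closed: "tm (\<lambda>e. c) \<Longrightarrow> c \<in> V"
proof -
  assume c: "tm (\<lambda>e. c)"
  obtain x where "x \<in> V" using V_nonempty by blast
  with tm_mem[OF c, of "\<lambda>_. x"] show ?thesis by simp
qed

lemma tm_dfn: "tm t \<Longrightarrow> dfn (\<lambda>e. e 0 = t (\<lambda>n. e (Suc n)))"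
  unfolding tm_def by blast

text \<open>The value is named by an existential quantifier over \<open>V\<close>, which loses
  nothing because values of terms lie in \<open>V\<close>.\<close>

lemma dfn_subst:
  assumes "tm t" "dfn (\<lambda>e. P (\<lambda>n. e (Suc n)) (e 0))"
  shows "dfn (\<lambda>e. P e (t e))"
proof (rule dfn_cong)
  show "dfn (\<lambda>e. \<exists>x\<in>V. x = t e \<and> P e x)"
    using assms by (intro dfn_ex dfn_conj tm_dfn)
qed (use tm_mem[OF assms(1)] in auto)

lemma tm_ren:
  assumes "tm t" shows "tm (\<lambda>e. t (\<lambda>n. e (f n)))"
  unfolding tm_def
proof (intro conjI allI impI)
  show "dfn (\<lambda>e. e 0 = t (\<lambda>n. e (Suc (f n))))"
    using dfn_ren[OF tm_dfn[OF assms], of "\<lambda>n. if n = 0 then 0 else Suc (f (n - 1))"] by simp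
qed (use tm_mem[OF assms] in auto)

lemma tm_subst:
  assumes "tm t" "tm (\<lambda>e. F (\<lambda>n. e (Suc n)) (e 0))"
  shows "tm (\<lambda>e. F e (t e))"
  unfolding tm_def
proof (intro conjI allI impI)
  fix e assume e: "env e"
  define e' where "e' n = (if n = 0 then t e else e (n - 1))" for n :: nat
  have "env e'" using e tm_mem[OF assms(1)] by (auto simp: e'_def)
  from tm_mem[OF assms(2) this] show "F e (t e) \<in> V" by (simp add: e'_def)
next
  have "tm (\<lambda>e. t (\<lambda>n. e (Suc n)))" using assms(1) by (rule tm_ren)
  moreover have "dfn (\<lambda>e. e (Suc 0) = F (\<lambda>n. e (Suc (Suc n))) (e 0))"
    using dfn_ren[OF tm_dfn[OF assms(2)], of "\<lambda>n. if n = 0 then Suc 0 else if n = Suc 0 then 0 else n"]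
    by simp
  ultimately show "dfn (\<lambda>e. e 0 = F (\<lambda>n. e (Suc n)) (t (\<lambda>n. e (Suc n))))"
    by (rule dfn_subst[of "\<lambda>e. t (\<lambda>n. e (Suc n))" "\<lambda>e x. e 0 = F (\<lambda>n. e (Suc n)) x"])
qed

lemma tm_var: "tm (\<lambda>e. e i)"
  unfolding tm_def by (simp add: dfn_eq_var)

lemma tm_const: "c \<in> V \<Longrightarrow> tm (\<lambda>e. c)"
  unfolding tm_def by (simp add: dfn_eq_const)

lemma dfn_mem:
  assumes "tm s" "tm t" shows "dfn (\<lambda>e. s e \<in> elts (t e))"
  by (rule dfn_subst[where P = "\<lambda>e x. x \<in> elts (t e)", OF assms(1)],
      rule dfn_subst[where P = "\<lambda>e x. e 0 \<in> elts x", OF tm_ren[OF assms(2)]], rule dfn_mem_var)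

lemma dfn_eq:
  assumes "tm s" "tm t" shows "dfn (\<lambda>e. s e = t e)"
  by (rule dfn_subst[where P = "\<lambda>e x. x = t e", OF assms(1)],
      rule dfn_subst[where P = "\<lambda>e x. e 0 = x", OF tm_ren[OF assms(2)]], rule dfn_eq_var)

lemma dfn_ball:
  assumes "tm t" "dfn (\<lambda>e. P (\<lambda>n. e (Suc n)) (e 0))"
  shows "dfn (\<lambda>e. \<forall>x\<in>elts (t e). P e x)"
proof (rule dfn_cong)
  show "dfn (\<lambda>e. \<forall>x\<in>V. x \<in> elts (t e) \<longrightarrow> P e x)"
    by (intro dfn_all dfn_imp dfn_mem tm_var tm_ren[OF assms(1)] assms(2))
  show "(\<forall>x\<in>elts (t e). P e x) \<longleftrightarrow> (\<forall>x\<in>V. x \<in> elts (t e) \<longrightarrow> P e x)" if "env e" for e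
    using V_trans[OF tm_mem[OF assms(1) that]] by blast
qed

lemma dfn_bex:
  assumes "tm t" "dfn (\<lambda>e. P (\<lambda>n. e (Suc n)) (e 0))"
  shows "dfn (\<lambda>e. \<exists>x\<in>elts (t e). P e x)"
proof (rule dfn_cong)
  show "dfn (\<lambda>e. \<not> (\<forall>x\<in>elts (t e). \<not> P e x))"
    by (intro dfn_not dfn_ball assms)
qed simp

lemma dfn_subset:
  assumes "tm s" "tm t" shows "dfn (\<lambda>e. elts (s e) \<subseteq> elts (t e))"
  unfolding subset_iff Ball_def[symmetric]
  by (intro dfn_ball dfn_mem tm_var tm_ren[OF assms(2)] assms(1))

lemma dfn_if: "dfn P \<Longrightarrow> dfn Q \<Longrightarrow> dfn R \<Longrightarrow> dfn (\<lambda>e. if P e then Q e else R e)"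
proof (rule dfn_cong)
  assume "dfn P" "dfn Q" "dfn R"
  then show "dfn (\<lambda>e. (P e \<longrightarrow> Q e) \<and> (\<not> P e \<longrightarrow> R e))"
    by (intro dfn_conj dfn_imp dfn_not)
qed simp

lemma tm_if:
  assumes "dfn P" "tm s" "tm t" shows "tm (\<lambda>e. if P e then s e else t e)"
  unfolding tm_def
proof (intro conjI allI impI)
  have "dfn (\<lambda>e. if P (\<lambda>n. e (Suc n)) then e 0 = s (\<lambda>n. e (Suc n)) else e 0 = t (\<lambda>n. e (Suc n)))"
    by (intro dfn_if dfn_ren[OF assms(1)] tm_dfn assms)
  then show "dfn (\<lambda>e. e 0 = (if P (\<lambda>n. e (Suc n)) then s (\<lambda>n. e (Suc n)) else t (\<lambda>n. e (Suc n))))"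
    by (rule dfn_cong) simp
qed (use tm_mem[OF assms(2)] tm_mem[OF assms(3)] in auto)

text \<open>By extensionality and transitivity, an element of \<open>V\<close> is determined by its
  elements in \<open>V\<close>. A set operation is thus definable once its membership relation is,
  and the axioms only have to supply that its values lie in \<open>V\<close>.\<close>

lemma tm_setI:
  assumes "\<And>e. env e \<Longrightarrow> t e \<in> V"
    and "dfn (\<lambda>e. P (\<lambda>n. e (Suc n)) (e 0))"
    and "\<And>e z. env e \<Longrightarrow> z \<in> V \<Longrightarrow> z \<in> elts (t e) \<longleftrightarrow> P e z"
  shows "tm t"
  unfolding tm_def
proof (intro conjI allI impI)
  have "dfn (\<lambda>e. P (\<lambda>n. e (Suc (Suc n))) (e 0))"
    using dfn_ren[OF assms(2), of "\<lambda>n. if n = 0 then 0 else Suc n"] by simp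
  then have "dfn (\<lambda>e. \<forall>z\<in>V. z \<in> elts (e 0) \<longleftrightarrow> P (\<lambda>n. e (Suc n)) z)"
    by (intro dfn_all dfn_iff dfn_mem tm_var)
  then show "dfn (\<lambda>e. e 0 = t (\<lambda>n. e (Suc n)))"
  proof (rule dfn_cong)
    fix e assume e: "env e"
    show "e 0 = t (\<lambda>n. e (Suc n)) \<longleftrightarrow> (\<forall>z\<in>V. z \<in> elts (e 0) \<longleftrightarrow> P (\<lambda>n. e (Suc n)) z)"
    proof
      assume r: "\<forall>z\<in>V. z \<in> elts (e 0) \<longleftrightarrow> P (\<lambda>n. e (Suc n)) z"
      have "z \<in> elts (e 0) \<longleftrightarrow> z \<in> elts (t (\<lambda>n. e (Suc n)))" for z
        using r V_trans assms(1,3) e by metis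
      then show "e 0 = t (\<lambda>n. e (Suc n))" by (intro elts_ext set_eqI)
    qed (use assms(3) e in simp)
  qed
qed (rule assms)

section \<open>Closure of \<open>V\<close> under the operations given by the axioms\<close>

lemma pair_in_V: "x \<in> V \<Longrightarrow> y \<in> V \<Longrightarrow> vset {x, y} \<in> V"
proof -
  assume xy: "x \<in> V" "y \<in> V"
  then obtain z where z: "z \<in> V" "\<forall>w\<in>V. w \<in> elts z \<longleftrightarrow> w = x \<or> w = y"
    using model unfolding transitive_model_ZFC_def models_ZFC_def ax_pairing_def by blast
  then have "elts z = {x, y}" using V_trans xy by blast
  then show ?thesis using z by (metis vset_elts)
qed

lemma tm_pair:
  assumes "tm s" "tm t" shows "tm (\<lambda>e. vset {s e, t e})"
proof (rule tm_setI)
  show "dfn (\<lambda>e. e 0 = s (\<lambda>n. e (Suc n)) \<or> e 0 = t (\<lambda>n. e (Suc n)))"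
    by (intro dfn_disj dfn_eq tm_var tm_ren[OF assms(1)] tm_ren[OF assms(2)])
qed (auto intro: pair_in_V tm_mem[OF assms(1)] tm_mem[OF assms(2)])

lemma tm_singleton: "tm s \<Longrightarrow> tm (\<lambda>e. vset {s e})"
  using tm_pair[of s s] by simp

lemma tm_kpair: "tm s \<Longrightarrow> tm t \<Longrightarrow> tm (\<lambda>e. kpair (s e) (t e))"
  unfolding kpair_def by (intro tm_pair tm_singleton)

lemma Union_in_V: "x \<in> V \<Longrightarrow> vset (\<Union>y\<in>elts x. elts y) \<in> V"
proof -
  assume x: "x \<in> V"
  then obtain z where z: "z \<in> V" "\<forall>w\<in>V. w \<in> elts z \<longleftrightarrow> (\<exists>y\<in>V. y \<in> elts x \<and> w \<in> elts y)"
    using model unfolding transitive_model_ZFC_def models_ZFC_def ax_union_def by blast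
  then have "elts z = (\<Union>y\<in>elts x. elts y)" using V_trans x by blast
  then show ?thesis using z by (metis vset_elts)
qed

lemma tm_Union:
  assumes "tm s" shows "tm (\<lambda>e. vset (\<Union>y\<in>elts (s e). elts y))"
proof (rule tm_setI)
  show "dfn (\<lambda>e. \<exists>y\<in>elts (s (\<lambda>n. e (Suc n))). e 0 \<in> elts y)"
    by (intro dfn_bex dfn_mem tm_var tm_ren[OF assms])
qed (auto intro: Union_in_V tm_mem[OF assms])

lemma sep_in_V:
  assumes "a \<in> V" "dfn (\<lambda>e. P (\<lambda>n. e (Suc n)) (e 0))" "env e"
  shows "vset {z \<in> elts a. P e z} \<in> V"
proof -
  obtain \<phi> c where c: "env c"
      "\<And>e. env e \<Longrightarrow> P (\<lambda>n. e (Suc n)) (e 0) \<longleftrightarrow> sat V (mix e c) \<phi>"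
    using assms(2) unfolding dfn_def by blast
  \<comment> \<open>The separated variable is the top of the stack, which \<open>mix\<close> keeps
    at variable 0 as the axiom requires. The entry \<open>a\<close> is a placeholder that the axiom
    overwrites.\<close>
  define e' where "e' n = (if n = 0 then a else e (n - 1))" for n :: nat
  have "env (mix e' c)" using c assms by (simp add: mix_def e'_def)
  then obtain y where y: "y \<in> V"
    "\<forall>z\<in>V. z \<in> elts y \<longleftrightarrow> z \<in> elts a \<and> sat V ((mix e' c)(0 := z)) \<phi>"
    using model assms(1) unfolding transitive_model_ZFC_def models_ZFC_def ax_separation_def by blast
  have "sat V ((mix e' c)(0 := z)) \<phi> \<longleftrightarrow> P e z" if z: "z \<in> V" for z
  proof -
    have "(mix e' c)(0 := z) = mix (e'(0 := z)) c"
      by (rule ext) (auto simp: mix_def elim!: evenE)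
    moreover have "env (e'(0 := z))" using z assms by (simp add: e'_def)
    ultimately show ?thesis using c(2)[of "e'(0 := z)"] by (simp add: e'_def)
  qed
  then have "elts y = {z \<in> elts a. P e z}" using y V_trans assms(1) by blast
  then show ?thesis using y by (metis vset_elts)
qed

lemma tm_sep:
  assumes "tm s" "dfn (\<lambda>e. P (\<lambda>n. e (Suc n)) (e 0))"
  shows "tm (\<lambda>e. vset {z \<in> elts (s e). P e z})"
proof (rule tm_setI)
  show "dfn (\<lambda>e. e 0 \<in> elts (s (\<lambda>n. e (Suc n))) \<and> P (\<lambda>n. e (Suc n)) (e 0))"
    by (intro dfn_conj dfn_mem tm_var tm_ren[OF assms(1)] assms(2))
qed (auto intro: sep_in_V tm_mem[OF assms(1)] assms(2))

lemma repl_in_V: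
  assumes "a \<in> V" "dfn (\<lambda>e. R (\<lambda>n. e (Suc (Suc n))) (e 0) (e (Suc 0)))" "env e"
    and "\<And>x. x \<in> elts a \<Longrightarrow> F x \<in> V"
    and "\<And>x y. x \<in> elts a \<Longrightarrow> y \<in> V \<Longrightarrow> R e x y \<longleftrightarrow> y = F x"
  shows "vset (F ` elts a) \<in> V"
proof -
  obtain \<phi> c where c: "env c"
      "\<And>e. env e \<Longrightarrow> R (\<lambda>n. e (Suc (Suc n))) (e 0) (e (Suc 0)) \<longleftrightarrow> sat V (mix e c) \<phi>"
    using assms(2) unfolding dfn_def by blast
  define e' where "e' n = (if n < 2 then a else e (n - 2))" for n :: nat
  \<comment> \<open>The two top entries of the stack sit at variables 0 and 2 of \<open>mix\<close>,
    but the axiom updates variables 0 and 1. Hence 2 goes to 1, and the remaining variables move up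
    by one to make room.\<close>
  define f :: "nat \<Rightarrow> nat" where
    "f n = (if n = 2 then 1 else if n = 0 then 0 else n + 1)" for n
  obtain \<phi>' where \<phi>': "\<And>e. sat V e \<phi>' \<longleftrightarrow> sat V (\<lambda>n. e (f n)) \<phi>" using sat_rename by blast
  define d where "d n = (if n = 0 then a else mix e' c (n - 1))" for n :: nat
  have "env d" using c assms by (simp add: mix_def e'_def d_def)
  have sat: "sat V (d(0 := x, 1 := y)) \<phi>' \<longleftrightarrow> y = F x" if x: "x \<in> elts a" and y: "y \<in> V" for x y
  proof -
    have "(\<lambda>n. (d(0 := x, 1 := y)) (f n)) = mix (e'(0 := x, 1 := y)) c"
      by (rule ext) (auto simp: mix_def f_def d_def elim!: evenE)
    moreover have "env (e'(0 := x, 1 := y))" using x y assms V_trans by (simp add: e'_def)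
    ultimately show ?thesis using assms(5)[OF x y] c(2)[of "e'(0 := x, 1 := y)"]
      by (simp add: e'_def \<phi>')
  qed
  have "\<forall>x\<in>V. x \<in> elts a \<longrightarrow> (\<exists>!y. y \<in> V \<and> sat V (d(0 := x, 1 := y)) \<phi>')"
    using sat assms(4) by metis
  then obtain b where b: "b \<in> V"
    "\<forall>y\<in>V. y \<in> elts b \<longleftrightarrow> (\<exists>x\<in>V. x \<in> elts a \<and> sat V (d(0 := x, 1 := y)) \<phi>')"
    using model \<open>env d\<close> assms(1)
    unfolding transitive_model_ZFC_def models_ZFC_def ax_replacement_def by blast
  have "elts b = F ` elts a"
  proof (intro set_eqI iffI)
    fix y assume y: "y \<in> elts b"
    then have "y \<in> V" using b V_trans by blast
    then show "y \<in> F ` elts a" using b(2) sat y by blast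
  next
    fix y assume "y \<in> F ` elts a"
    then show "y \<in> elts b" using b(2) sat assms V_trans by blast
  qed
  then show ?thesis using b by (metis vset_elts)
qed

lemma tm_repl:
  assumes s: "tm s" and F: "tm (\<lambda>e. F (\<lambda>n. e (Suc n)) (e 0))"
  shows "tm (\<lambda>e. vset (F e ` elts (s e)))"
proof (rule tm_setI[where P = "\<lambda>e z. \<exists>x\<in>elts (s e). z = F e x"])
  fix e assume e: "env e"
  show "vset (F e ` elts (s e)) \<in> V"
  proof (rule repl_in_V[where R = "\<lambda>e x y. y = F e x", OF _ _ e])
    show "s e \<in> V" using s e by (rule tm_mem)
    show "dfn (\<lambda>e. e (Suc 0) = F (\<lambda>n. e (Suc (Suc n))) (e 0))"
      using tm_ren[OF F, of "\<lambda>n. if n = 0 then 0 else Suc n"] by (intro dfn_eq tm_var) simp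
    fix x assume x: "x \<in> elts (s e)"
    have "env (\<lambda>n. if n = 0 then x else e (n - 1))"
      using x e V_trans tm_mem[OF s e] by auto
    from tm_mem[OF F this] show "F e x \<in> V" by simp
  qed simp
next
  have "tm (\<lambda>e. F (\<lambda>n. e (Suc (Suc n))) (e 0))"
    using tm_ren[OF F, of "\<lambda>n. if n = 0 then 0 else Suc n"] by simp
  then show "dfn (\<lambda>e. \<exists>x\<in>elts (s (\<lambda>n. e (Suc n))). e 0 = F (\<lambda>n. e (Suc n)) x)"
    by (intro dfn_bex dfn_eq tm_var tm_ren[OF s])
qed auto

text \<open>Only subsets that belong to \<open>V\<close> are collected: the ambient universe is not
  assumed to satisfy power set, so the set exists by the axiom in \<open>V\<close>.\<close>

definition Pow_V :: "'u \<Rightarrow> 'u" where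
  "Pow_V x = vset {w \<in> V. elts w \<subseteq> elts x}"

lemma Pow_V: "x \<in> V \<Longrightarrow> Pow_V x \<in> V \<and> elts (Pow_V x) = {w \<in> V. elts w \<subseteq> elts x}"
proof -
  assume x: "x \<in> V"
  then obtain z where z: "z \<in> V" "\<forall>w\<in>V. w \<in> elts z \<longleftrightarrow> (\<forall>v\<in>V. v \<in> elts w \<longrightarrow> v \<in> elts x)"
    using model unfolding transitive_model_ZFC_def models_ZFC_def ax_power_set_def by blast
  then have "elts z = {w \<in> V. elts w \<subseteq> elts x}" using V_trans by blast
  then show ?thesis using z unfolding Pow_V_def by (metis vset_elts)
qed

lemma tm_Pow:
  assumes "tm s" shows "tm (\<lambda>e. Pow_V (s e))"
proof (rule tm_setI)
  show "dfn (\<lambda>e. elts (e 0) \<subseteq> elts (s (\<lambda>n. e (Suc n))))"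
    by (intro dfn_subset tm_var tm_ren[OF assms])
qed (auto simp: Pow_V tm_mem[OF assms])

lemma dfn_class:
  assumes "definable_class V K" "tm t" shows "dfn (\<lambda>e. t e \<in> K)"
proof -
  obtain \<phi> c where c: "env c" "K = {x \<in> V. sat V (c(0 := x)) \<phi>}"
    using assms(1) unfolding definable_class_def by blast
  have "dfn (\<lambda>e. e 0 \<in> K)"
  proof (rule dfn_cong[OF dfn_sat[OF c(1), of 1 "\<lambda>n. n" \<phi>]])
    fix e assume "env e"
    have "(\<lambda>n. if n < 1 then e n else c n) = c(0 := e 0)" by auto
    then show "e 0 \<in> K \<longleftrightarrow> sat V (\<lambda>n. if n < 1 then e n else c n) \<phi>"
      using \<open>env e\<close> c(2) by simp
  qed
  then show ?thesis using dfn_subst[where P = "\<lambda>e x. x \<in> K", OF assms(2)] by simp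
qed

text \<open>The projections, with values in the model also at arguments that are not pairs.\<close>

definition pfst :: "'u \<Rightarrow> 'u" where
  "pfst p = (if \<exists>a b. p = kpair a b then vfst p else p)"

definition psnd :: "'u \<Rightarrow> 'u" where
  "psnd p = (if \<exists>a b. p = kpair a b then vsnd p else p)"

text \<open>Application as a total operation: the union of all second components at
  \<open>a\<close>, which is the value when there is just one. The description in
  \<open>vapp\<close> is unspecified outside the domain and so gives no control over membership in
  \<open>V\<close>.\<close>

definition app :: "'u \<Rightarrow> 'u \<Rightarrow> 'u" where
  "app f a = vset (\<Union>b\<in>elts (vset (psnd ` elts (vset {z \<in> elts f. \<exists>b. z = kpair a b}))). elts b)"

end

lemma vfst_kpair [simp]: "vfst (kpair a b) = (a :: 'u::set_universe)"
  unfolding vfst_def by auto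

lemma vsnd_kpair [simp]: "vsnd (kpair a b) = (b :: 'u::set_universe)"
  unfolding vsnd_def by auto

context zfc_model begin

lemma pfst_kpair [simp]: "pfst (kpair a b) = a" unfolding pfst_def by auto
lemma psnd_kpair [simp]: "psnd (kpair a b) = b" unfolding psnd_def by auto

lemma kpair_in_V: "kpair a b \<in> V \<longleftrightarrow> a \<in> V \<and> b \<in> V"
proof
  assume "kpair a b \<in> V"
  then have "vset {a, b} \<in> V" using V_trans[of "kpair a b" "vset {a, b}"] by (simp add: kpair_def)
  then show "a \<in> V \<and> b \<in> V" using V_trans[of "vset {a, b}"] by simp
next
  assume "a \<in> V \<and> b \<in> V"
  then show "kpair a b \<in> V" using pair_in_V[of a a] pair_in_V[of a b]
    by (simp add: kpair_def pair_in_V)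
qed

lemma tm_pfst:
  assumes "tm t" shows "tm (\<lambda>e. pfst (t e))"
  unfolding tm_def
proof (intro conjI allI impI)
  fix e assume "env e"
  then have "t e \<in> V" by (rule tm_mem[OF assms])
  then show "pfst (t e) \<in> V"
    by (cases "\<exists>a b. t e = kpair a b") (auto simp: kpair_in_V pfst_def)
next
  let ?t = "\<lambda>e. t (\<lambda>n. e (Suc n))"
  have "dfn (\<lambda>e. (\<exists>b\<in>V. ?t e = kpair (e 0) b) \<or> (\<not> (\<exists>a\<in>V. \<exists>b\<in>V. ?t e = kpair a b)) \<and> e 0 = ?t e)"
    by (intro dfn_disj dfn_conj dfn_ex dfn_not dfn_eq tm_kpair tm_var tm_ren[OF assms])
  then show "dfn (\<lambda>e. e 0 = pfst (?t e))"
  proof (rule dfn_cong)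
    fix e assume e: "env e"
    then have "?t e \<in> V" by (intro tm_mem[OF assms]) simp
    then show "e 0 = pfst (?t e) \<longleftrightarrow>
      (\<exists>b\<in>V. ?t e = kpair (e 0) b) \<or> (\<not> (\<exists>a\<in>V. \<exists>b\<in>V. ?t e = kpair a b)) \<and> e 0 = ?t e"
      by (cases "\<exists>a b. ?t e = kpair a b") (auto simp: kpair_in_V pfst_def)
  qed
qed

lemma tm_psnd:
  assumes "tm t" shows "tm (\<lambda>e. psnd (t e))"
  unfolding tm_def
proof (intro conjI allI impI)
  fix e assume "env e"
  then have "t e \<in> V" by (rule tm_mem[OF assms])
  then show "psnd (t e) \<in> V"
    by (cases "\<exists>a b. t e = kpair a b") (auto simp: kpair_in_V psnd_def)
next
  let ?t = "\<lambda>e. t (\<lambda>n. e (Suc n))"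
  have "dfn (\<lambda>e. (\<exists>b\<in>V. ?t e = kpair b (e 0)) \<or> (\<not> (\<exists>a\<in>V. \<exists>b\<in>V. ?t e = kpair a b)) \<and> e 0 = ?t e)"
    by (intro dfn_disj dfn_conj dfn_ex dfn_not dfn_eq tm_kpair tm_var tm_ren[OF assms])
  then show "dfn (\<lambda>e. e 0 = psnd (?t e))"
  proof (rule dfn_cong)
    fix e assume e: "env e"
    then have "?t e \<in> V" by (intro tm_mem[OF assms]) simp
    then show "e 0 = psnd (?t e) \<longleftrightarrow>
      (\<exists>b\<in>V. ?t e = kpair b (e 0)) \<or> (\<not> (\<exists>a\<in>V. \<exists>b\<in>V. ?t e = kpair a b)) \<and> e 0 = ?t e"
      by (cases "\<exists>a b. ?t e = kpair a b") (auto simp: kpair_in_V psnd_def)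
  qed
qed

lemma dfn_kpair:
  assumes "tm s" "tm t" shows "dfn (\<lambda>e. \<exists>b. s e = kpair (t e) b)"
proof (rule dfn_cong)
  show "dfn (\<lambda>e. \<exists>b\<in>V. s e = kpair (t e) b)"
    by (intro dfn_ex dfn_eq tm_kpair tm_var tm_ren[OF assms(1)] tm_ren[OF assms(2)])
  show "(\<exists>b. s e = kpair (t e) b) \<longleftrightarrow> (\<exists>b\<in>V. s e = kpair (t e) b)" if "env e" for e
    using tm_mem[OF assms(1) that] kpair_in_V by auto
qed

lemma tm_app:
  assumes "tm s" "tm t" shows "tm (\<lambda>e. app (s e) (t e))"
  unfolding app_def
  by (intro tm_Union tm_repl tm_psnd tm_var tm_sep dfn_kpair tm_ren[OF assms(2)] assms(1))

lemma app_eq: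
  assumes "kpair a b \<in> elts f" "\<And>c. kpair a c \<in> elts f \<Longrightarrow> c = b"
  shows "app f a = b"
proof -
  have e: "{z \<in> elts f. \<exists>b. z = kpair a b} = {kpair a b}" using assms by blast
  have "elts (vset (psnd ` elts (vset {kpair a b}))) = {b}"
    unfolding elts_vset_image elts_vset_singleton by simp
  then show ?thesis unfolding app_def e by simp
qed

end

section \<open>Natural numbers, names, recursion and choice\<close>

lemma elts_induct [case_names step]:
  assumes "\<And>x :: 'u::set_universe. (\<And>y. y \<in> elts x \<Longrightarrow> P y) \<Longrightarrow> P x"
  shows "P x"
  using elts_wf by (rule wf_induct_rule) (use assms in auto)

lemma elts_irrefl: "x \<notin> elts (x :: 'u::set_universe)"
  using wf_not_refl[OF elts_wf, of x] by simp

lemma elts_vnat: "elts (vnat n :: 'u::set_universe) = vnat ` {..<n}"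
proof (induction n)
  case (Suc n)
  have "elts (vnat (Suc n) :: 'u) = insert (vnat n) (elts (vnat n))"
    unfolding vnat.simps by (rule elts_vset_insert)
  with Suc show ?case by (simp add: lessThan_Suc)
qed simp

lemma inj_vnat: "inj (vnat :: nat \<Rightarrow> 'u::set_universe)"
proof (rule linorder_injI)
  fix m n :: nat assume "m < n"
  then have "(vnat m :: 'u) \<in> elts (vnat n)" by (auto simp: elts_vnat)
  then show "(vnat m :: 'u) \<noteq> vnat n" using elts_irrefl by metis
qed

lemma vnat_eq_iff [simp]: "(vnat m :: 'u::set_universe) = vnat n \<longleftrightarrow> m = n"
  using inj_vnat by (auto dest: injD)

lemma vnat_mem_iff [simp]: "(vnat m :: 'u::set_universe) \<in> elts (vnat n) \<longleftrightarrow> m < n"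
  by (auto simp: elts_vnat)

definition vsuc :: "'u::set_universe \<Rightarrow> 'u" where
  "vsuc x = vset (\<Union>y\<in>elts (vset {vset {x}, x}). elts y)"

lemma elts_vsuc [simp]: "elts (vsuc x) = insert x (elts x)"
  unfolding vsuc_def elts_vset_Union by simp

lemma vsuc_vnat [simp]: "vsuc (vnat n) = vnat (Suc n)"
  by (rule elts_ext, unfold vnat.simps elts_vset_insert elts_vsuc) (rule refl)

declare vnat.simps(2) [simp del]

text \<open>The canonical name of \<open>x\<close>, with a condition \<open>p\<close> in place of a
  largest one. It evaluates to \<open>x\<close> under every filter that contains
  \<open>p\<close>.\<close>

function check_name :: "'u::set_universe \<Rightarrow> 'u \<Rightarrow> 'u" where
  "check_name p x = vset ((\<lambda>y. kpair (check_name p y) p) ` elts x)"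
  by pat_completeness auto
termination
proof (relation "inv_image {(x, y). x \<in> elts y} snd")
  show "wf (inv_image {(x, y :: 'u::set_universe). x \<in> elts y} snd)"
    by (intro wf_inv_image elts_wf)
qed simp

declare check_name.simps [simp del]

lemma elts_check_name: "elts (check_name p x) = (\<lambda>y. kpair (check_name p y) p) ` elts x"
  by (subst check_name.simps) simp

lemma name_val_check_name:
  assumes "p \<in> elts G" shows "name_val G (check_name p x) = x"
proof (induction x rule: elts_induct)
  case (step x)
  have "{\<sigma>. \<exists>q\<in>elts G. kpair \<sigma> q \<in> elts (check_name p x)} = check_name p ` elts x"
    using assms by (auto simp: elts_check_name)
  then have "name_val G (check_name p x) = vset ((\<lambda>y. y) ` elts x)"
    using step by (subst name_val.simps) (simp add: image_image)
  then show ?case by simp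
qed

lemma is_name_check_name:
  assumes "p \<in> P" shows "is_name P (check_name p x)"
proof (induction x rule: elts_induct)
  case (step x)
  then show ?case
    using assms by (intro is_name.intros) (auto simp: elts_check_name)
qed

text \<open>Off the naturals the index itself is returned, a default that stays in \<open>V\<close>
  and keeps the operation total.\<close>

definition iter :: "('u::set_universe \<Rightarrow> 'u) \<Rightarrow> 'u \<Rightarrow> 'u \<Rightarrow> 'u" where
  "iter F a x = (if x \<in> range vnat then (F ^^ (inv vnat x)) a else x)"

lemma iter_vnat [simp]: "iter F a (vnat n) = (F ^^ n) a"
  unfolding iter_def by (simp add: inv_f_f[OF inj_vnat])

context zfc_model begin

section \<open>The naturals, iteration, choice and canonical names inside \<open>V\<close>\<close>

lemma tm_vsuc: "tm t \<Longrightarrow> tm (\<lambda>e. vsuc (t e))"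
  unfolding vsuc_def by (intro tm_Union tm_pair tm_singleton)

lemma empty_in_V: "vset {} \<in> V"
proof -
  obtain x where "x \<in> V" using V_nonempty by blast
  then have "tm (\<lambda>e. vset {z \<in> elts x. \<not> z = z})"
    by (intro tm_sep tm_const dfn_not dfn_eq tm_var)
  from tm_closed[OF this] show ?thesis by simp
qed

lemma insert_in_V:
  assumes "x \<in> V" "y \<in> V" shows "vset (insert x (elts y)) \<in> V"
proof -
  have "tm (\<lambda>e. vset (\<Union>w\<in>elts (vset {vset {x}, y}). elts w))"
    using assms by (intro tm_Union tm_pair tm_singleton tm_const)
  from tm_closed[OF this] show ?thesis by simp
qed

lemma finite_in_V: "finite A \<Longrightarrow> A \<subseteq> V \<Longrightarrow> vset A \<in> V"
proof (induction rule: finite_induct)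
  case (insert a A)
  then show ?case using insert_in_V[of a "vset A"] by (simp add: elts_vset_finite)
qed (simp add: empty_in_V)

lemma vnat_in_V: "vnat n \<in> V"
proof (induction n)
  case (Suc n)
  then show ?case using insert_in_V[of "vnat n" "vnat n"] by (simp add: vnat.simps(2))
qed (simp add: empty_in_V)

text \<open>Infinity yields an inductive set in \<open>V\<close>, and separation cuts out the
  intersection of all inductive sets of \<open>V\<close>. This contains every natural. It contains
  nothing else, since a membership-minimal other element could be removed without destroying
  inductiveness, contradicting minimality of the intersection.\<close>

lemma omega_in_V: "omega \<in> V" and elts_omega: "elts omega = range (vnat :: nat \<Rightarrow> 'u)"
proof -
  define ind where "ind w \<longleftrightarrow> vset {} \<in> elts w \<and> (\<forall>y\<in>elts w. vsuc y \<in> elts w)" for w :: 'u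
  have vsuc: "vsuc y \<in> V" if "y \<in> V" for y using tm_closed[OF tm_vsuc[OF tm_const[OF that]]] .
  obtain x where x: "x \<in> V" "\<exists>y\<in>V. y \<in> elts x \<and> (\<forall>z\<in>V. z \<notin> elts y)"
    "\<forall>y\<in>V. y \<in> elts x \<longrightarrow> (\<exists>s\<in>V. s \<in> elts x \<and> (\<forall>z\<in>V. z \<in> elts s \<longleftrightarrow> z \<in> elts y \<or> z = y))"
    using model unfolding transitive_model_ZFC_def models_ZFC_def ax_infinity_def by auto
  have ind_x: "ind x"
    unfolding ind_def
  proof (intro conjI ballI)
    obtain y where "y \<in> elts x" "y \<in> V" "\<forall>z\<in>V. z \<notin> elts y" using x(2) by blast
    then have "y \<in> elts x \<and> elts y = elts (vset {})" using V_trans[of y] by auto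
    then show "vset {} \<in> elts x" using elts_ext by blast
  next
    fix y assume y: "y \<in> elts x"
    then have "y \<in> V" using V_trans x(1) by blast
    then obtain s where s: "s \<in> V" "s \<in> elts x" "\<forall>z\<in>V. z \<in> elts s \<longleftrightarrow> z \<in> elts y \<or> z = y"
      using x(3) y by blast
    then have "elts s = elts (vsuc y)" using V_trans[OF s(1)] V_trans[OF \<open>y \<in> V\<close>] \<open>y \<in> V\<close> by auto
    then show "vsuc y \<in> elts x" using s elts_ext by blast
  qed
  define N where "N = vset {z \<in> elts x. \<forall>w\<in>V. ind w \<longrightarrow> z \<in> elts w}"
  have "tm (\<lambda>e. N)"
    unfolding N_def ind_def
    by (intro tm_sep dfn_all dfn_imp dfn_conj dfn_ball dfn_mem tm_var tm_vsuc)
       (intro tm_const x empty_in_V)+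
  then have N: "N \<in> V" by (rule tm_closed)
  have eltsN: "elts N = {z \<in> elts x. \<forall>w\<in>V. ind w \<longrightarrow> z \<in> elts w}" by (simp add: N_def)
  have vnat_ind: "vnat n \<in> elts w" if "ind w" for n w
    by (induction n) (use that in \<open>auto simp: ind_def simp flip: vsuc_vnat\<close>)
  have "z \<in> range vnat" if "z \<in> elts N" for z
    using that
  proof (induction z rule: elts_induct)
    case (step z)
    show ?case
    proof (rule ccontr)
      assume z: "z \<notin> range vnat"
      define w where "w = vset {y \<in> elts N. \<not> y = z}"
      have "z \<in> V" using V_trans N step by blast
      then have "tm (\<lambda>e. w)"
        unfolding w_def by (intro tm_sep dfn_not dfn_eq tm_var) (intro tm_const N)+
      then have "w \<in> V" by (rule tm_closed)
      moreover have "ind w"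
        unfolding ind_def
      proof (intro conjI ballI)
        have "vset {} \<noteq> z" using z by (metis rangeI vnat.simps(1))
        then show "vset {} \<in> elts w"
          using ind_x by (auto simp: w_def eltsN ind_def)
      next
        fix y assume "y \<in> elts w"
        then have y: "y \<in> elts N" by (simp add: w_def)
        \<comment> \<open>If the removed \<open>z\<close> were the successor of \<open>y\<close>,
          then \<open>y\<close> would be an element of \<open>z\<close>, hence a natural by the
          induction hypothesis, and so would \<open>z\<close>.\<close>
        moreover have "vsuc y \<noteq> z"
        proof
          assume "vsuc y = z"
          then have "y \<in> range vnat" using step.IH[of y] y by auto
          then have "z \<in> range vnat" using \<open>vsuc y = z\<close> by auto
          with z show False ..
        qed
        moreover have "vsuc y \<in> elts N" using y ind_x by (auto simp: eltsN ind_def)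
        ultimately show "vsuc y \<in> elts w" by (simp add: w_def)
      qed
      ultimately show False using step.prems by (auto simp: eltsN w_def)
    qed
  qed
  moreover have "vnat n \<in> elts N" for n using vnat_ind ind_x by (simp add: eltsN)
  ultimately have "elts N = range vnat" by blast
  then have "omega = N" unfolding omega_def by (metis vset_elts)
  then show "omega \<in> V" "elts omega = range (vnat :: nat \<Rightarrow> 'u)"
    using N \<open>elts N = range vnat\<close> by auto
qed

lemma tm_fun:
  assumes "tm (\<lambda>e. F (\<lambda>n. e (Suc n)) (e 0))" "tm t"
  shows "tm (\<lambda>e. F (\<lambda>n. e (f n)) (t e))"
  by (rule tm_subst[where F = "\<lambda>e. F (\<lambda>n. e (f n))", OF assms(2)])
     (use tm_ren[OF assms(1), of "\<lambda>n. if n = 0 then 0 else Suc (f (n - 1))"] in simp)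

text \<open>Recursion along \<open>omega\<close> is definable because a value is certified by a set
  of pairs in which each pair is justified by the starting value or by a pair one stage earlier.
  Such a set can contain only correct pairs, and finite approximations show that certificates
  exist.\<close>

lemma tm_iter:
  assumes a: "tm a" and x: "tm x" and F: "tm (\<lambda>e. F (\<lambda>n. e (Suc n)) (e 0))"
  shows "tm (\<lambda>e. iter (F e) (a e) (x e))"
  unfolding tm_def
proof (intro conjI allI impI)
  fix e assume e: "env e"
  have F_V: "F e y \<in> V" if "y \<in> V" for y
    using tm_mem[OF F, of "\<lambda>n. if n = 0 then y else e (n - 1)"] that e by simp
  have "(F e ^^ n) (a e) \<in> V" for n
    by (induction n) (use F_V tm_mem[OF a e] in auto)
  then show "iter (F e) (a e) (x e) \<in> V"
    using tm_mem[OF x e] by (simp add: iter_def)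
next
  let ?a = "\<lambda>e. a (\<lambda>n. e (Suc n))" and ?x = "\<lambda>e. x (\<lambda>n. e (Suc n))" and ?F = "\<lambda>e. F (\<lambda>n. e (Suc n))"
  \<comment> \<open>The set \<open>s\<close> need not be a function or have an initial segment as
    its domain. Justification descends along membership of first components, so induction already
    forces the values.\<close>
  let ?ok = "\<lambda>e s. \<forall>z\<in>elts s. z = kpair (vnat 0) (?a e) \<or>
        (\<exists>z'\<in>elts s. z = kpair (vsuc (pfst z')) (?F e (psnd z')))"
  have "dfn (\<lambda>e. if ?x e \<in> elts omega then \<exists>s\<in>V. kpair (?x e) (e 0) \<in> elts s \<and> ?ok e s
                 else e 0 = ?x e)"
    by (intro dfn_if dfn_ex dfn_conj dfn_disj dfn_mem dfn_eq dfn_ball dfn_bex tm_kpair tm_vsuc tm_pfst tm_psnd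
          tm_fun[OF F] tm_var tm_ren[OF a] tm_ren[OF x] tm_const[OF omega_in_V] tm_const[OF vnat_in_V])
  then show "dfn (\<lambda>e. e 0 = iter (?F e) (?a e) (?x e))"
  proof (rule dfn_cong)
    fix e assume e: "env e"
    define r where "r i = (?F e ^^ i) (?a e)" for i
    have F_V: "?F e y \<in> V" if "y \<in> V" for y
      using tm_mem[OF F, of "\<lambda>n. if n = 0 then y else e n"] that e by simp
    have r_V: "r n \<in> V" for n
      unfolding r_def by (induction n) (use F_V tm_mem[OF a] e in auto)
    have unique: "\<exists>i. z = kpair (vnat i) (r i)" if s: "?ok e s" and "z \<in> elts s" for s z
    proof -
      have "z \<in> elts s \<longrightarrow> y = pfst z \<longrightarrow> (\<exists>i. z = kpair (vnat i) (r i))" for y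
      proof (induction y arbitrary: z rule: elts_induct)
        case (step y)
        show ?case
        proof (intro impI)
          assume z: "z \<in> elts s" "y = pfst z"
          with s consider "z = kpair (vnat 0) (?a e)"
            | z' where "z' \<in> elts s" "z = kpair (vsuc (pfst z')) (?F e (psnd z'))" by blast
          then show "\<exists>i. z = kpair (vnat i) (r i)"
          proof cases
            case 1
            then show ?thesis by (intro exI[of _ 0]) (simp add: r_def)
          next
            case 2
            then have "pfst z' \<in> elts y" using z by simp
            then obtain i where "z' = kpair (vnat i) (r i)" using step 2 by blast
            then show ?thesis using 2 by (intro exI[of _ "Suc i"]) (simp add: r_def)
          qed
        qed
      qed
      then show ?thesis using that by blast
    qed
    show "e 0 = iter (?F e) (?a e) (?x e) \<longleftrightarrow>
      (if ?x e \<in> elts omega then \<exists>s\<in>V. kpair (?x e) (e 0) \<in> elts s \<and> ?ok e s else e 0 = ?x e)"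
    proof (cases "?x e \<in> elts omega")
      case False
      then show ?thesis by (auto simp: iter_def elts_omega)
    next
      case True
      then obtain n where n: "?x e = vnat n" by (auto simp: elts_omega)
      have "(\<exists>s\<in>V. kpair (vnat n) y \<in> elts s \<and> ?ok e s) \<longleftrightarrow> y = r n" for y
      proof
        assume "\<exists>s\<in>V. kpair (vnat n) y \<in> elts s \<and> ?ok e s"
        then obtain s where "kpair (vnat n) y \<in> elts s" "?ok e s" by blast
        from unique[OF this(2,1)] show "y = r n" by auto
      next
        assume y: "y = r n"
        \<comment> \<open>The finite history up to stage \<open>n\<close> is the certificate; it
          lies in \<open>V\<close> as a finite subset of \<open>V\<close>.\<close>
        define s where "s = vset ((\<lambda>i. kpair (vnat i) (r i)) ` {..n})"
        have s: "elts s = (\<lambda>i. kpair (vnat i) (r i)) ` {..n}"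
          unfolding s_def by (intro elts_vset_finite) simp
        have "s \<in> V"
          unfolding s_def by (intro finite_in_V) (auto simp: kpair_in_V r_V vnat_in_V)
        moreover have "?ok e s"
          unfolding s
        proof (intro ballI)
          fix z assume "z \<in> (\<lambda>i. kpair (vnat i) (r i)) ` {..n}"
          then obtain i where i: "i \<le> n" "z = kpair (vnat i) (r i)" by auto
          show "z = kpair (vnat 0) (?a e) \<or>
            (\<exists>z'\<in>(\<lambda>i. kpair (vnat i) (r i)) ` {..n}. z = kpair (vsuc (pfst z')) (?F e (psnd z')))"
          proof (cases i)
            case 0
            with i show ?thesis by (simp add: r_def)
          next
            case (Suc j)
            with i show ?thesis
              by (intro disjI2 bexI[of _ "kpair (vnat j) (r j)"]) (auto simp: r_def)
          qed
        qed
        moreover have "kpair (vnat n) y \<in> elts s" by (simp add: s y)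
        ultimately show "\<exists>s\<in>V. kpair (vnat n) y \<in> elts s \<and> ?ok e s" by blast
      qed
      with True n show ?thesis by (simp add: r_def)
    qed
  qed
qed

text \<open>The choice axiom speaks of disjoint families, so the set of candidates for
  \<open>x\<close> is tagged with \<open>x\<close>. A transversal of the tagged sets is then the
  graph of a choice function.\<close>

lemma choice_in_V:
  assumes a: "a \<in> V" and b: "b \<in> V" and R: "dfn (\<lambda>e. R (e (Suc 0)) (e 0))"
    and ex: "\<And>x. x \<in> elts a \<Longrightarrow> \<exists>y\<in>elts b. R x y"
  shows "\<exists>h\<in>V. \<forall>x\<in>elts a. app h x \<in> elts b \<and> R x (app h x)"
proof -
  define S where "S x = vset (kpair x ` elts (vset {y \<in> elts b. R x y}))" for x
  have S: "elts (S x) = {kpair x y | y. y \<in> elts b \<and> R x y}" for x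
    unfolding S_def elts_vset_image by auto
  define A where "A = vset (S ` elts a)"
  have "tm (\<lambda>e. A)"
    unfolding A_def S_def
    by (intro tm_repl[where F = "\<lambda>e x. vset (kpair x ` elts (vset {y \<in> elts b. R x y}))"] tm_const a
        tm_repl[where F = "\<lambda>e. kpair (e 0)"] tm_kpair tm_var tm_sep b dfn_ren[OF R])
  then have A: "A \<in> V" by (rule tm_closed)
  have eA: "elts A = S ` elts a" unfolding A_def by simp
  have S_in: "S x \<in> V" if "x \<in> elts a" for x using V_trans[OF A] that eA by blast
  have "\<exists>c\<in>V. \<forall>x\<in>V. x \<in> elts A \<longrightarrow> (\<exists>!z. z \<in> V \<and> z \<in> elts x \<and> z \<in> elts c)"
  proof -
    have 1: "\<forall>x\<in>V. x \<in> elts A \<longrightarrow> (\<exists>z\<in>V. z \<in> elts x)"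
    proof (intro ballI impI)
      fix s assume "s \<in> V" "s \<in> elts A"
      then obtain x where x: "x \<in> elts a" "s = S x" by (auto simp: eA)
      then obtain y where "kpair x y \<in> elts s" using ex S by blast
      then show "\<exists>z\<in>V. z \<in> elts s" using V_trans[OF \<open>s \<in> V\<close>] by blast
    qed
    have 2: "\<forall>x\<in>V. \<forall>y\<in>V. x \<in> elts A \<longrightarrow> y \<in> elts A \<longrightarrow> x \<noteq> y \<longrightarrow>
           \<not> (\<exists>z\<in>V. z \<in> elts x \<and> z \<in> elts y)"
      by (auto simp: eA S)
    show ?thesis
      using model A 1 2 unfolding transitive_model_ZFC_def models_ZFC_def ax_choice_def by blast
  qed
  then obtain c where c: "c \<in> V"
    "\<And>x. x \<in> V \<Longrightarrow> x \<in> elts A \<Longrightarrow> \<exists>!z. z \<in> V \<and> z \<in> elts x \<and> z \<in> elts c" by blast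
  \<comment> \<open>The transversal \<open>c\<close> may contain pairs outside the family;
    discarding them makes the value at each \<open>x\<close> unique.\<close>
  define h where "h = vset {z \<in> elts c. \<exists>s\<in>elts A. z \<in> elts s}"
  have "tm (\<lambda>e. h)"
    unfolding h_def by (intro tm_sep dfn_bex dfn_mem tm_var) (intro tm_const A c)+
  then have "h \<in> V" by (rule tm_closed)
  moreover have "app h x \<in> elts b \<and> R x (app h x)" if x: "x \<in> elts a" for x
  proof -
    have Sx: "S x \<in> elts A" using x by (simp add: eA)
    from c(2)[OF S_in[OF x] Sx] obtain z where z: "z \<in> elts (S x)" "z \<in> elts c"
      "\<And>z'. z' \<in> V \<Longrightarrow> z' \<in> elts (S x) \<Longrightarrow> z' \<in> elts c \<Longrightarrow> z' = z" by metis
    then obtain y where y: "z = kpair x y" "y \<in> elts b" "R x y" by (auto simp: S)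
    have "app h x = y"
    proof (rule app_eq)
      show "kpair x y \<in> elts h" using z y Sx by (auto simp: h_def)
      fix y' assume "kpair x y' \<in> elts h"
      then have "kpair x y' \<in> elts c" "kpair x y' \<in> elts (S x)" by (auto simp: h_def eA S)
      moreover have "kpair x y' \<in> V" using V_trans[OF c(1)] calculation by blast
      ultimately show "y' = y" using z(3)[of "kpair x y'"] y by simp
    qed
    with y show ?thesis by simp
  qed
  ultimately show ?thesis by blast
qed

text \<open>Recursion on membership is definable because its values are witnessed by sets of pairs that
  are closed under passing to elements of the first component.\<close>

definition check_graph :: "'u \<Rightarrow> 'u \<Rightarrow> bool" where
  "check_graph p s \<longleftrightarrow> (\<forall>z\<in>elts s. \<exists>x. z = kpair x (check_name p x) \<and>
     (\<forall>y\<in>elts x. kpair y (check_name p y) \<in> elts s))"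

text \<open>The right-hand side does not mention \<open>check_name\<close> and is built from
  definable operations only. It says that each second component is computed from the pairs at the
  elements of the first, which determines it by membership induction.\<close>

lemma check_graph_iff: "check_graph p s \<longleftrightarrow> (\<forall>z\<in>elts s. z = kpair (pfst z) (psnd z) \<and>
    psnd z = vset ((\<lambda>z'. kpair (psnd z') p) ` elts (vset {z' \<in> elts s. pfst z' \<in> elts (pfst z)})) \<and>
    (\<forall>y\<in>elts (pfst z). \<exists>z'\<in>elts s. pfst z' = y))" (is "_ \<longleftrightarrow> ?closed")
proof
  assume g: "check_graph p s"
  show ?closed
  proof
    fix z assume "z \<in> elts s"
    then obtain x where x: "z = kpair x (check_name p x)"
      "\<forall>y\<in>elts x. kpair y (check_name p y) \<in> elts s" using g unfolding check_graph_def by blast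
    have "elts (check_name p x) = (\<lambda>z'. kpair (psnd z') p) ` {z' \<in> elts s. pfst z' \<in> elts x}"
    proof (intro set_eqI iffI)
      fix u assume "u \<in> elts (check_name p x)"
      then obtain y where y: "y \<in> elts x" "u = kpair (check_name p y) p"
        unfolding elts_check_name by (elim imageE)
      then show "u \<in> (\<lambda>z'. kpair (psnd z') p) ` {z' \<in> elts s. pfst z' \<in> elts x}"
        using x(2) by (intro image_eqI[of _ _ "kpair y (check_name p y)"]) auto
    next
      fix u assume "u \<in> (\<lambda>z'. kpair (psnd z') p) ` {z' \<in> elts s. pfst z' \<in> elts x}"
      then obtain z' where z': "z' \<in> elts s" "pfst z' \<in> elts x" "u = kpair (psnd z') p" by auto
      then obtain y where "z' = kpair y (check_name p y)" using g unfolding check_graph_def by blast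
      then show "u \<in> elts (check_name p x)" using z' unfolding elts_check_name by force
    qed
    then have "check_name p x =
        vset ((\<lambda>z'. kpair (psnd z') p) ` elts (vset {z' \<in> elts s. pfst z' \<in> elts x}))"
      by (intro elts_ext, unfold elts_vset_image) simp
    moreover have "\<forall>y\<in>elts x. \<exists>z'\<in>elts s. pfst z' = y" using x(2) pfst_kpair by blast
    ultimately show "z = kpair (pfst z) (psnd z) \<and>
      psnd z = vset ((\<lambda>z'. kpair (psnd z') p) ` elts (vset {z' \<in> elts s. pfst z' \<in> elts (pfst z)})) \<and>
      (\<forall>y\<in>elts (pfst z). \<exists>z'\<in>elts s. pfst z' = y)"
      unfolding x pfst_kpair psnd_kpair by blast
  qed
next
  assume c: ?closed
  have val: "z \<in> elts s \<longrightarrow> x = pfst z \<longrightarrow> z = kpair x (check_name p x)" for z x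
  proof (induction x arbitrary: z rule: elts_induct)
    case (step x)
    show ?case
    proof (intro impI)
      assume z: "z \<in> elts s" "x = pfst z"
      have IH: "psnd z' = check_name p (pfst z')" if "z' \<in> elts s" "pfst z' \<in> elts x" for z'
        using step[OF that(2), of z'] that(1) by (metis psnd_kpair)
      have pz: "psnd z = vset ((\<lambda>z'. kpair (psnd z') p) ` elts (vset {z' \<in> elts s. pfst z' \<in> elts x}))"
        using c z by blast
      have "elts (psnd z) = (\<lambda>z'. kpair (psnd z') p) ` {z' \<in> elts s. pfst z' \<in> elts x}"
        unfolding pz elts_vset_image by simp
      also have "\<dots> = (\<lambda>z'. kpair (check_name p (pfst z')) p) ` {z' \<in> elts s. pfst z' \<in> elts x}"
        using IH by (intro image_cong) auto
      also have "\<dots> = (\<lambda>y. kpair (check_name p y) p) ` pfst ` {z' \<in> elts s. pfst z' \<in> elts x}"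
        by (simp add: image_image)
      also have "pfst ` {z' \<in> elts s. pfst z' \<in> elts x} = elts x"
      proof (intro set_eqI iffI)
        fix y assume y: "y \<in> elts x"
        then obtain z' where "z' \<in> elts s" "pfst z' = y" using c z by blast
        with y show "y \<in> pfst ` {z' \<in> elts s. pfst z' \<in> elts x}" by blast
      qed blast
      finally have "psnd z = check_name p x"
        by (intro elts_ext) (simp add: elts_check_name)
      moreover have "z = kpair (pfst z) (psnd z)" using c z by blast
      ultimately show "z = kpair x (check_name p x)" using z by metis
    qed
  qed
  show "check_graph p s"
    unfolding check_graph_def
  proof
    fix z assume z: "z \<in> elts s"
    have "kpair y (check_name p y) \<in> elts s" if y: "y \<in> elts (pfst z)" for y
    proof -
      obtain z' where "z' \<in> elts s" "pfst z' = y" using c z y by blast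
      then show ?thesis using val[of z' y] by simp
    qed
    then show "\<exists>x. z = kpair x (check_name p x) \<and> (\<forall>y\<in>elts x. kpair y (check_name p y) \<in> elts s)"
      using val[of z "pfst z"] z by blast
  qed
qed
lemma dfn_check_graph:
  assumes p: "p \<in> V" and r: "tm r" shows "dfn (\<lambda>e. check_graph p (r e))"
  unfolding check_graph_iff
  by (intro dfn_ball dfn_conj dfn_eq dfn_bex tm_kpair tm_pfst tm_psnd tm_repl tm_sep dfn_mem tm_var
      tm_ren[OF r] r tm_const[OF p])

lemma check_graph_value: "check_graph p s \<Longrightarrow> kpair x v \<in> elts s \<Longrightarrow> v = check_name p x"
  unfolding check_graph_def by fastforce

lemma check_graph_closed:
  "check_graph p s \<Longrightarrow> kpair x v \<in> elts s \<Longrightarrow> y \<in> elts x \<Longrightarrow> kpair y (check_name p y) \<in> elts s"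
  unfolding check_graph_def by fastforce

text \<open>By membership induction each element of \<open>x\<close> has a graph in
  \<open>V\<close>. To collect one for each element by replacement, the graph must be determined by
  the element; taking the least one achieves this without choosing.\<close>

lemma ex_check_graph:
  assumes p: "p \<in> V" and "x \<in> V"
  shows "\<exists>s\<in>V. check_graph p s \<and> kpair x (check_name p x) \<in> elts s"
  using assms(2)
proof (induction x rule: elts_induct)
  case (step x)
  have W: "\<exists>s\<in>V. check_graph p s \<and> kpair y (check_name p y) \<in> elts s" if "y \<in> elts x" for y
    using step.IH[OF that] V_trans[OF step.prems that] by blast
  have has_iff: "(\<exists>z\<in>elts s. pfst z = y) \<longleftrightarrow> kpair y (check_name p y) \<in> elts s"
    if g: "check_graph p s" for s y
  proof
    assume "\<exists>z\<in>elts s. pfst z = y"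
    then obtain z where z: "z \<in> elts s" "pfst z = y" by blast
    then obtain w where "z = kpair w (check_name p w)" using g unfolding check_graph_def by blast
    with z show "kpair y (check_name p y) \<in> elts s" by simp
  next
    assume "kpair y (check_name p y) \<in> elts s"
    then show "\<exists>z\<in>elts s. pfst z = y" by (rule bexI[rotated]) simp
  qed
  \<comment> \<open>Graphs are closed under intersection, because every graph assigns the same value
    to a given set. The intersection of all graphs in \<open>V\<close> that contain \<open>y\<close>
    is thus the least one, and separation places it in \<open>V\<close>.\<close>
  define M where "M y = vset (\<Inter>(elts ` {s \<in> V. check_graph p s \<and> kpair y (check_name p y) \<in> elts s}))" for y
  have M: "M y \<in> V \<and> check_graph p (M y) \<and> kpair y (check_name p y) \<in> elts (M y) \<and>
      (\<forall>s\<in>V. check_graph p s \<and> kpair y (check_name p y) \<in> elts s \<longrightarrow> elts (M y) \<subseteq> elts s)"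
    if "y \<in> elts x" for y
  proof -
    obtain s0 where s0: "s0 \<in> V" "check_graph p s0" "kpair y (check_name p y) \<in> elts s0" using W[OF \<open>y \<in> elts x\<close>] by blast
    then have c: "kpair y (check_name p y) \<in> V" using V_trans by blast
    define m where "m = vset {z \<in> elts s0. \<forall>s\<in>V. check_graph p s \<and> kpair y (check_name p y) \<in> elts s \<longrightarrow> z \<in> elts s}"
    have "tm (\<lambda>e. m)"
      unfolding m_def by (intro tm_sep dfn_all dfn_imp dfn_conj dfn_check_graph[OF p] dfn_mem tm_var)
        (intro tm_const s0 c)+
    then have "m \<in> V" by (rule tm_closed)
    have em: "elts m = \<Inter>(elts ` {s \<in> V. check_graph p s \<and> kpair y (check_name p y) \<in> elts s})"
      unfolding m_def using s0 by auto
    then have "m = M y" unfolding M_def by (metis vset_elts)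
    moreover have "check_graph p m" unfolding check_graph_def[of p m] em
    proof
      fix z assume z: "z \<in> \<Inter>(elts ` {s \<in> V. check_graph p s \<and> kpair y (check_name p y) \<in> elts s})"
      then have "z \<in> elts s0" using s0 by blast
      then obtain w where w: "z = kpair w (check_name p w)" using s0(2) unfolding check_graph_def by blast
      have "kpair v (check_name p v) \<in> elts s"
        if "v \<in> elts w" "check_graph p s" "kpair y (check_name p y) \<in> elts s" "s \<in> V" for v s
      proof -
        have "kpair w (check_name p w) \<in> elts s" using z that unfolding w by blast
        with that show ?thesis using check_graph_closed by blast
      qed
      then show "\<exists>x. z = kpair x (check_name p x) \<and> (\<forall>v\<in>elts x. kpair v (check_name p v)
        \<in> \<Inter>(elts ` {s \<in> V. check_graph p s \<and> kpair y (check_name p y) \<in> elts s}))"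
        using w by blast
    qed
    moreover have "kpair y (check_name p y) \<in> elts m" "\<forall>s\<in>V. check_graph p s \<and> kpair y (check_name p y) \<in> elts s \<longrightarrow> elts m \<subseteq> elts s"
      unfolding em by blast+
    ultimately show ?thesis using \<open>m \<in> V\<close> by simp
  qed
  \<comment> \<open>The property that singles out \<open>M y\<close>, phrased through first
    components so that it does not use the value of \<open>check_name\<close> at
    \<open>y\<close>.\<close>
  define Q where "Q y m \<longleftrightarrow> check_graph p m \<and> (\<exists>z\<in>elts m. pfst z = y) \<and>
    (\<forall>s\<in>V. check_graph p s \<and> (\<exists>z\<in>elts s. pfst z = y) \<longrightarrow> elts m \<subseteq> elts s)" for y m
  have "vset (M ` elts x) \<in> V"
  proof (rule repl_in_V[where R = "\<lambda>e. Q" and e = "\<lambda>_. x"])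
    show "dfn (\<lambda>e. Q (e 0) (e (Suc 0)))"
      unfolding Q_def
      by (intro dfn_conj dfn_check_graph[OF p] dfn_bex dfn_eq dfn_all dfn_imp dfn_subset tm_pfst tm_var)
    fix y assume y: "y \<in> elts x"
    show "M y \<in> V" using M[OF y] by blast
    fix m assume m: "m \<in> V"
    show "Q y m \<longleftrightarrow> m = M y"
    proof
      assume "Q y m"
      then have Q: "check_graph p m" "kpair y (check_name p y) \<in> elts m"
        "\<forall>s\<in>V. check_graph p s \<and> kpair y (check_name p y) \<in> elts s \<longrightarrow> elts m \<subseteq> elts s"
        unfolding Q_def using has_iff by auto
      have "elts m \<subseteq> elts (M y)" "elts (M y) \<subseteq> elts m"
        using M[OF y] m Q by blast+
      then have "elts m = elts (M y)" by blast
      then show "m = M y" by (rule elts_ext)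
    next
      assume "m = M y"
      moreover have "check_graph p s \<and> (\<exists>z\<in>elts s. pfst z = y) \<longleftrightarrow>
          check_graph p s \<and> kpair y (check_name p y) \<in> elts s" for s
        using has_iff by blast
      ultimately show "Q y m" using M[OF y] has_iff[of "M y" y] unfolding Q_def by simp
    qed
  qed (simp_all add: step.prems)
  define S where "S = vset (\<Union>s\<in>elts (vset (M ` elts x)). elts s)"
  have S: "S \<in> V" unfolding S_def using \<open>vset (M ` elts x) \<in> V\<close> by (rule Union_in_V)
  have eS: "elts S = (\<Union>y\<in>elts x. elts (M y))" unfolding S_def elts_vset_Union by simp
  have gS: "check_graph p S"
    unfolding check_graph_def
  proof
    fix z assume "z \<in> elts S"
    then obtain y where y: "y \<in> elts x" "z \<in> elts (M y)" unfolding eS by blast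
    then have "check_graph p (M y)" using M by blast
    with y(2) obtain w where "z = kpair w (check_name p w)"
      "\<forall>v\<in>elts w. kpair v (check_name p v) \<in> elts (M y)" unfolding check_graph_def by blast
    then show "\<exists>x. z = kpair x (check_name p x) \<and> (\<forall>y\<in>elts x. kpair y (check_name p y) \<in> elts S)"
      using y(1) unfolding eS by blast
  qed
  have pS: "kpair y (check_name p y) \<in> elts S" if "y \<in> elts x" for y
    using M that unfolding eS by blast
  \<comment> \<open>The name of \<open>x\<close> is read off from the union of the graphs at its
    elements; only now is it known to lie in \<open>V\<close>.\<close>
  have "vset ((\<lambda>z. kpair (psnd z) p) ` elts (vset {z \<in> elts S. pfst z \<in> elts x})) \<in> V"
    by (rule tm_closed, intro tm_repl tm_sep tm_kpair tm_psnd dfn_mem tm_pfst tm_var)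
       (intro tm_const p S step.prems)+
  moreover have "check_name p x = vset ((\<lambda>z. kpair (psnd z) p) ` elts (vset {z \<in> elts S. pfst z \<in> elts x}))"
  proof (rule elts_ext, subst elts_check_name, subst elts_vset_image, subst elts_vset_Collect, intro equalityI subsetI)
    fix u assume "u \<in> (\<lambda>y. kpair (check_name p y) p) ` elts x"
    then obtain y where "y \<in> elts x" "u = kpair (check_name p y) p" by blast
    then show "u \<in> (\<lambda>z. kpair (psnd z) p) ` {z \<in> elts S. pfst z \<in> elts x}"
      using pS[of y] by (intro image_eqI[of _ _ "kpair y (check_name p y)"]) simp_all
  next
    fix u assume "u \<in> (\<lambda>z. kpair (psnd z) p) ` {z \<in> elts S. pfst z \<in> elts x}"
    then obtain z where z: "z \<in> elts S" "pfst z \<in> elts x" "u = kpair (psnd z) p" by blast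
    then obtain w where "z = kpair w (check_name p w)" using gS unfolding check_graph_def by blast
    with z show "u \<in> (\<lambda>y. kpair (check_name p y) p) ` elts x"
      by simp
  qed
  ultimately have "check_name p x \<in> V" by simp
  then have k: "kpair x (check_name p x) \<in> V" using step.prems by (simp add: kpair_in_V)
  define s where "s = vset (insert (kpair x (check_name p x)) (elts S))"
  have "s \<in> V" unfolding s_def using k S by (rule insert_in_V)
  moreover have es: "elts s = insert (kpair x (check_name p x)) (elts S)"
    unfolding s_def by (rule elts_vset_insert)
  moreover have "check_graph p s"
    unfolding check_graph_def
  proof
    fix z assume "z \<in> elts s"
    then consider "z = kpair x (check_name p x)" | "z \<in> elts S" unfolding es by blast
    then show "\<exists>x. z = kpair x (check_name p x) \<and> (\<forall>y\<in>elts x. kpair y (check_name p y) \<in> elts s)"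
    proof cases
      case 1
      then show ?thesis using pS unfolding es by blast
    next
      case 2
      then show ?thesis using gS unfolding es check_graph_def by blast
    qed
  qed
  ultimately show ?case by blast
qed
lemma tm_check_name:
  assumes p: "p \<in> V" and t: "tm t"
  shows "tm (\<lambda>e. check_name p (t e))"
  unfolding tm_def
proof (intro conjI allI impI)
  fix e assume "env e"
  then obtain s where "s \<in> V" "kpair (t e) (check_name p (t e)) \<in> elts s"
    using ex_check_graph[OF p tm_mem[OF t]] by metis
  then have "kpair (t e) (check_name p (t e)) \<in> V" using V_trans by blast
  then show "check_name p (t e) \<in> V" by (simp add: kpair_in_V)
next
  let ?t = "\<lambda>e. t (\<lambda>n. e (Suc n))"
  have "dfn (\<lambda>e. \<exists>s\<in>V. check_graph p s \<and> kpair (?t e) (e 0) \<in> elts s)"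
    by (intro dfn_ex dfn_conj dfn_check_graph[OF p] dfn_mem tm_kpair tm_var tm_ren[OF t])
  then show "dfn (\<lambda>e. e 0 = check_name p (?t e))"
  proof (rule dfn_cong)
    fix e assume "env e"
    then have "?t e \<in> V" by (intro tm_mem[OF t]) simp
    then obtain s where s: "s \<in> V" "check_graph p s" "kpair (?t e) (check_name p (?t e)) \<in> elts s"
      using ex_check_graph[OF p] by blast
    show "e 0 = check_name p (?t e) \<longleftrightarrow> (\<exists>s\<in>V. check_graph p s \<and> kpair (?t e) (e 0) \<in> elts s)"
    proof
      assume "e 0 = check_name p (?t e)"
      with s show "\<exists>s\<in>V. check_graph p s \<and> kpair (?t e) (e 0) \<in> elts s" by auto
    qed (auto dest: check_graph_value)
  qed
qed

end

declare vnat.simps(1) [simp del]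

section \<open>Structures and their transport\<close>

lemma elts_vtuple:
  "elts (vtuple xs :: 'u::set_universe) = (\<lambda>i. kpair (vnat i) (xs ! i)) ` {..<length xs}"
proof -
  have "{kpair (vnat i) (xs ! i) | i. i < length xs} = (\<lambda>i. kpair (vnat i) (xs ! i)) ` {..<length xs}"
    by blast
  then show ?thesis unfolding vtuple_def by (simp only: elts_vset_finite finite_imageI finite_lessThan)
qed

lemma vtuple_eq_iff [simp]: "vtuple xs = vtuple ys \<longleftrightarrow> xs = (ys :: 'u::set_universe list)"
proof
  have sub: "i < length zs \<and> ws ! i = zs ! i" if "vtuple ws = vtuple zs" "i < length ws"
    for i and ws zs :: "'u list"
  proof -
    have "kpair (vnat i) (ws ! i) \<in> elts (vtuple ws)"
      unfolding elts_vtuple using that(2) by (intro imageI) simp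
    then have "kpair (vnat i) (ws ! i) \<in> elts (vtuple zs)" by (simp only: that(1))
    then show ?thesis unfolding elts_vtuple by (elim imageE) simp
  qed
  assume e: "vtuple xs = vtuple ys"
  show "xs = ys"
  proof (rule nth_equalityI)
    show "length xs = length ys"
    proof (rule antisym; rule ccontr)
      assume "\<not> length xs \<le> length ys"
      with sub[OF e, of "length ys"] show False by simp
    next
      assume "\<not> length ys \<le> length xs"
      with sub[OF e[symmetric], of "length xs"] show False by simp
    qed
    show "xs ! i = ys ! i" if "i < length xs" for i
      using sub[OF e that] by simp
  qed
qed simp

context zfc_model begin

section \<open>Finite maps and transported structures as elements of \<open>V\<close>\<close>

definition dm :: "'u \<Rightarrow> 'u" where "dm h = vset (pfst ` elts h)"

definition rn :: "'u \<Rightarrow> 'u" where "rn h = vset (psnd ` elts h)"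

lemma elts_dm: "elts (dm h) = pfst ` elts h" unfolding dm_def by (rule elts_vset_image)
lemma elts_rn: "elts (rn h) = psnd ` elts h" unfolding rn_def by (rule elts_vset_image)

lemma tm_dm: "tm t \<Longrightarrow> tm (\<lambda>e. dm (t e))"
  unfolding dm_def by (intro tm_repl tm_pfst tm_var)

lemma tm_rn: "tm t \<Longrightarrow> tm (\<lambda>e. rn (t e))"
  unfolding rn_def by (intro tm_repl tm_psnd tm_var)

text \<open>Embeddings are HOL functions, whereas operations of \<open>V\<close> act on sets.
  Restricted to a finite set, such a function becomes a finite set of pairs, and hence an element of
  \<open>V\<close> if its arguments and values are.\<close>

definition graph :: "('u \<Rightarrow> 'u) \<Rightarrow> 'u set \<Rightarrow> 'u" where
  "graph f X = vset ((\<lambda>x. kpair x (f x)) ` X)"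

lemma elts_graph: "finite X \<Longrightarrow> elts (graph f X) = (\<lambda>x. kpair x (f x)) ` X"
  unfolding graph_def by (simp add: elts_vset_finite)

lemma graph_in_V:
  assumes "finite X" "X \<subseteq> V" "f ` X \<subseteq> V" shows "graph f X \<in> V"
  unfolding graph_def
proof (rule finite_in_V)
  show "(\<lambda>x. kpair x (f x)) ` X \<subseteq> V"
    using assms(2,3) by (force simp: kpair_in_V)
qed (simp add: assms)

lemma app_graph: "finite X \<Longrightarrow> x \<in> X \<Longrightarrow> app (graph f X) x = f x"
  by (rule app_eq) (simp_all add: elts_graph image_iff)

lemma dm_graph: "finite X \<Longrightarrow> elts (dm (graph f X)) = X"
  by (simp add: elts_dm elts_graph image_image)

lemma rn_graph: "finite X \<Longrightarrow> elts (rn (graph f X)) = f ` X"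
  by (simp add: elts_rn elts_graph image_image)

definition tmap :: "'u \<Rightarrow> 'u \<Rightarrow> 'u" where
  "tmap h t = vset ((\<lambda>z. kpair (pfst z) (app h (psnd z))) ` elts t)"

lemma tmap_graph:
  assumes "finite X" "set xs \<subseteq> X"
  shows "tmap (graph f X) (vtuple xs) = vtuple (map f xs)"
proof (rule elts_ext)
  have "elts (tmap (graph f X) (vtuple xs)) =
      (\<lambda>i. kpair (vnat i) (app (graph f X) (xs ! i))) ` {..<length xs}"
    unfolding tmap_def elts_vset_image unfolding elts_vtuple image_image by simp
  also have "\<dots> = (\<lambda>i. kpair (vnat i) (map f xs ! i)) ` {..<length (map f xs)}"
  proof (rule image_cong)
    fix i assume "i \<in> {..<length (map f xs)}"
    then have i: "i < length xs" by simp
    then have "xs ! i \<in> X" using assms(2) nth_mem by blast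
    then show "kpair (vnat i) (app (graph f X) (xs ! i)) = kpair (vnat i) (map f xs ! i)"
      using app_graph[OF assms(1)] i by simp
  qed simp
  finally show "elts (tmap (graph f X) (vtuple xs)) = elts (vtuple (map f xs))"
    unfolding elts_vtuple[of "map f xs"] .
qed

text \<open>The image under \<open>h\<close> of the restriction of \<open>A\<close> to the domain of \<open>h\<close>. This one
  construction serves for restrictions, for isomorphic copies and for comparing blocks.\<close>

definition transport :: "'u \<Rightarrow> 'u \<Rightarrow> 'u \<Rightarrow> 'u" where
  "transport L h A = kpair (rn h) (vset ((\<lambda>R. kpair R (vset (tmap h ` elts (vset
     {t \<in> elts (app (psnd A) R). \<forall>z\<in>elts t. psnd z \<in> elts (dm h)})))) ` elts (dm L)))"

lemma tm_transport:
  assumes "L \<in> V" and h: "tm h" and A: "tm A"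
  shows "tm (\<lambda>e. transport L (h e) (A e))"
  unfolding transport_def tmap_def
  by (intro tm_kpair tm_rn tm_repl[where s = "\<lambda>e. dm L"] tm_repl[where s = "\<lambda>e. vset
     {t \<in> elts (app (psnd (A (\<lambda>n. e (Suc n)))) (e 0)). \<forall>z\<in>elts t. psnd z \<in> elts (dm (h (\<lambda>n. e (Suc n))))}"]
     tm_repl[where s = "\<lambda>e. e 0"] tm_sep tm_app tm_psnd tm_pfst dfn_ball dfn_mem tm_dm tm_var
     tm_ren[OF h] tm_ren[OF A] h A tm_const assms)

lemma is_function_app:
  assumes "is_function f" "a \<in> vdom f" shows "app f a = vapp f a" "kpair a (vapp f a) \<in> elts f"
proof -
  obtain b where b: "kpair a b \<in> elts f" using assms unfolding vdom_def by blast
  have u: "c = b" if "kpair a c \<in> elts f" for c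
    using assms(1) b that unfolding is_function_def by blast
  have "vapp f a = b" unfolding vapp_def by (rule the_equality) (rule b, erule u)
  moreover have "app f a = b" using b u by (rule app_eq)
  ultimately show "app f a = vapp f a" "kpair a (vapp f a) \<in> elts f" using b by simp_all
qed

lemma is_function_dm:
  assumes "is_function f" shows "elts (dm f) = vdom f"
proof (unfold elts_dm, intro equalityI subsetI)
  fix x assume "x \<in> pfst ` elts f"
  then obtain z where z: "z \<in> elts f" "x = pfst z" by blast
  then obtain a b where "z = kpair a b" using assms unfolding is_function_def by blast
  with z show "x \<in> vdom f" unfolding vdom_def by auto
next
  fix x assume "x \<in> vdom f"
  then obtain b where "kpair x b \<in> elts f" unfolding vdom_def by blast
  then show "x \<in> pfst ` elts f" by (rule image_eqI[rotated]) simp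
qed

lemma is_functionI_image:
  "is_function (vset ((\<lambda>R. kpair R (g R)) ` elts X))"
  "vdom (vset ((\<lambda>R. kpair R (g R)) ` elts X)) = elts X"
  "R \<in> elts X \<Longrightarrow> vapp (vset ((\<lambda>R. kpair R (g R)) ` elts X)) R = g R"
  unfolding is_function_def vdom_def vapp_def elts_vset_image by auto

lemma structure_tuple:
  assumes "is_structure L A" "R \<in> vdom L" "t \<in> elts (vapp (vsnd A) R)"
  shows "\<exists>xs. t = vtuple xs \<and> length xs = arity L R \<and> set xs \<subseteq> carrier A"
proof -
  obtain D I where A: "A = kpair D I" "\<forall>R\<in>vdom L. elts (vapp I R) \<subseteq>
           {vtuple xs | xs. length xs = arity L R \<and> set xs \<subseteq> elts D}"
    using assms(1) unfolding is_structure_def by blast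
  then have "elts (vapp I R) \<subseteq> {vtuple xs | xs. length xs = arity L R \<and> set xs \<subseteq> elts D}"
    using assms(2) by blast
  moreover have "t \<in> elts (vapp I R)" using assms(3) A(1) by simp
  ultimately show ?thesis using A(1) unfolding carrier_def by auto
qed

text \<open>The encoding has no redundancy: the interpretation is a function with domain exactly
  \<open>vdom L\<close>, and its values contain only tuples of the right length over the carrier.
  Isomorphism types on a fixed block can therefore be compared by plain equality of sets.\<close>

lemma structure_ext:
  fixes L A B :: 'u
  assumes A: "is_structure L A" and B: "is_structure L B" and c: "carrier A = carrier B"
    and h: "\<And>R xs. R \<in> vdom L \<Longrightarrow> length xs = arity L R \<Longrightarrow> set xs \<subseteq> carrier A \<Longrightarrow>
       holds_rel A R xs \<longleftrightarrow> holds_rel B R xs"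
  shows "A = B"
proof -
  obtain D I where A': "A = kpair D I" "is_function I" "vdom I = vdom L"
    using A unfolding is_structure_def by blast
  obtain E J where B': "B = kpair E J" "is_function J" "vdom J = vdom L"
    using B unfolding is_structure_def by blast
  have "D = E" using c A' B' unfolding carrier_def by (intro elts_ext) simp
  have v: "vapp I R = vapp J R" if R: "R \<in> vdom L" for R
  proof (rule elts_ext, intro equalityI subsetI)
    fix t assume t: "t \<in> elts (vapp I R)"
    then obtain xs where xs: "t = vtuple xs" "length xs = arity L R" "set xs \<subseteq> carrier A"
      using structure_tuple[OF A R, of t] A' by auto
    then show "t \<in> elts (vapp J R)"
      using h[OF R xs(2,3)] t A' B' unfolding holds_rel_def by simp
  next
    fix t assume t: "t \<in> elts (vapp J R)"
    then obtain xs where xs: "t = vtuple xs" "length xs = arity L R" "set xs \<subseteq> carrier B"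
      using structure_tuple[OF B R, of t] B' by auto
    then show "t \<in> elts (vapp I R)"
      using h[OF R xs(2)] c t A' B' unfolding holds_rel_def by simp
  qed
  have sub: "elts I \<subseteq> elts J" if hyps: "is_function I" "is_function J" "vdom I = vdom L" "vdom J = vdom L"
    "\<And>R. R \<in> vdom L \<Longrightarrow> vapp I R = vapp J R" for I J :: 'u
  proof
    fix z assume z: "z \<in> elts I"
    then obtain R b where zz: "z = kpair R b" using hyps(1) unfolding is_function_def by blast
    then have R: "R \<in> vdom I" using z unfolding vdom_def by blast
    then have "kpair R (vapp I R) \<in> elts I" using is_function_app(2)[OF hyps(1)] by blast
    then have "b = vapp I R" using z zz hyps(1) unfolding is_function_def by blast
    moreover have "kpair R (vapp J R) \<in> elts J" using is_function_app(2)[of J R] R hyps by simp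
    ultimately show "z \<in> elts J" using zz hyps R by simp
  qed
  have "elts I \<subseteq> elts J" using A' B' v by (intro sub)
  moreover have "elts J \<subseteq> elts I" using A' B' v by (intro sub) simp_all
  ultimately have "I = J" by (intro elts_ext) blast
  with \<open>D = E\<close> A' B' show ?thesis by simp
qed

text \<open>Injectivity matters only for the last claim: without it, an image tuple could also come
  from a different tuple that satisfies the relation.\<close>

lemma transport_structure:
  assumes L: "relational_language L" and A: "is_structure L A"
    and X: "finite X" "X \<subseteq> carrier A"
  shows "is_structure L (transport L (graph f X) A)"
    and "carrier (transport L (graph f X) A) = f ` X"
    and "inj_on f X \<Longrightarrow> R \<in> vdom L \<Longrightarrow> set xs \<subseteq> X \<Longrightarrow>
      holds_rel (transport L (graph f X) A) R (map f xs) \<longleftrightarrow> holds_rel A R xs"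
proof -
  define h where "h = graph f X"
  define g where "g R = vset (tmap h ` elts (vset
     {t \<in> elts (app (psnd A) R). \<forall>z\<in>elts t. psnd z \<in> elts (dm h)}))" for R
  define J where "J = vset ((\<lambda>R. kpair R (g R)) ` elts (dm L))"
  have B: "transport L h A = kpair (rn h) J" unfolding transport_def J_def g_def ..
  obtain D I where A': "A = kpair D I" "is_function I" "vdom I = vdom L"
    using A unfolding is_structure_def by blast
  have dmL: "elts (dm L) = vdom L" using L by (intro is_function_dm) (simp add: relational_language_def)
  have J: "is_function J" "vdom J = vdom L" "\<And>R. R \<in> vdom L \<Longrightarrow> vapp J R = g R"
    unfolding J_def dmL[symmetric] by (simp_all only: is_functionI_image)
  have g: "elts (g R) = {vtuple (map f xs) | xs. vtuple xs \<in> elts (vapp I R) \<and> set xs \<subseteq> X}"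
    if R: "R \<in> vdom L" for R
  proof -
    have appI: "app (psnd A) R = vapp I R" using is_function_app(1)[of I R] A' R by simp
    have e: "elts (g R) = tmap h ` {t \<in> elts (vapp I R). \<forall>z\<in>elts t. psnd z \<in> X}"
      unfolding g_def elts_vset_image by (simp add: appI h_def dm_graph X)
    have tup: "(\<forall>z\<in>elts (vtuple xs). psnd z \<in> X) \<longleftrightarrow> set xs \<subseteq> X" for xs
      unfolding elts_vtuple set_conv_nth by auto
    show ?thesis
      unfolding e
    proof (intro equalityI subsetI)
      fix u assume "u \<in> tmap h ` {t \<in> elts (vapp I R). \<forall>z\<in>elts t. psnd z \<in> X}"
      then obtain t where t: "t \<in> elts (vapp I R)" "\<forall>z\<in>elts t. psnd z \<in> X" "u = tmap h t" by blast
      then obtain xs where xs: "t = vtuple xs" using structure_tuple[OF A R, of t] A' by auto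
      then have "set xs \<subseteq> X" using t(2) tup[of xs] by simp
      then have "u = vtuple (map f xs)" using tmap_graph[OF X(1)] t(3) xs unfolding h_def by simp
      with t(1) xs \<open>set xs \<subseteq> X\<close>
      show "u \<in> {vtuple (map f xs) | xs. vtuple xs \<in> elts (vapp I R) \<and> set xs \<subseteq> X}"
        by (intro CollectI exI[of _ xs] conjI) simp_all
    next
      fix u assume "u \<in> {vtuple (map f xs) | xs. vtuple xs \<in> elts (vapp I R) \<and> set xs \<subseteq> X}"
      then obtain xs where xs: "u = vtuple (map f xs)" "vtuple xs \<in> elts (vapp I R)" "set xs \<subseteq> X" by blast
      then have "u = tmap h (vtuple xs)" using tmap_graph[OF X(1)] unfolding h_def by simp
      moreover have "vtuple xs \<in> {t \<in> elts (vapp I R). \<forall>z\<in>elts t. psnd z \<in> X}"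
        using xs(2,3) tup[of xs] by simp
      ultimately show "u \<in> tmap h ` {t \<in> elts (vapp I R). \<forall>z\<in>elts t. psnd z \<in> X}"
        by (rule image_eqI)
    qed
  qed
  have sub: "elts (vapp J R) \<subseteq> {vtuple xs | xs. length xs = arity L R \<and> set xs \<subseteq> elts (rn h)}"
    if R: "R \<in> vdom L" for R
  proof
    fix u assume "u \<in> elts (vapp J R)"
    then obtain xs where xs: "u = vtuple (map f xs)" "vtuple xs \<in> elts (vapp I R)" "set xs \<subseteq> X"
      unfolding J(3)[OF R] g[OF R] by blast
    moreover obtain ys where "vtuple xs = vtuple ys" "length ys = arity L R"
      using structure_tuple[OF A R, of "vtuple xs"] xs A' by auto
    moreover have "set (map f xs) \<subseteq> elts (rn h)" using xs by (auto simp: h_def rn_graph X)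
    ultimately show "u \<in> {vtuple xs | xs. length xs = arity L R \<and> set xs \<subseteq> elts (rn h)}"
      by (intro CollectI exI[of _ "map f xs"] conjI) simp_all
  qed
  show "is_structure L (transport L (graph f X) A)"
    unfolding h_def[symmetric] B is_structure_def
    by (intro exI[of _ "rn h"] exI[of _ J] conjI ballI refl J(1,2) sub)
  show "carrier (transport L (graph f X) A) = f ` X"
    unfolding h_def[symmetric] B carrier_def by (simp add: h_def rn_graph X)
  assume inj: "inj_on f X" and R: "R \<in> vdom L" and xs: "set xs \<subseteq> X"
  have "holds_rel (transport L (graph f X) A) R (map f xs) \<longleftrightarrow> vtuple (map f xs) \<in> elts (g R)"
    unfolding h_def[symmetric] B holds_rel_def by (simp add: J(3)[OF R])
  also have "\<dots> \<longleftrightarrow> (\<exists>ys. map f xs = map f ys \<and> vtuple ys \<in> elts (vapp I R) \<and> set ys \<subseteq> X)"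
    unfolding g[OF R] by (simp only: mem_Collect_eq vtuple_eq_iff)
  also have "\<dots> \<longleftrightarrow> vtuple xs \<in> elts (vapp I R)"
  proof
    assume "\<exists>ys. map f xs = map f ys \<and> vtuple ys \<in> elts (vapp I R) \<and> set ys \<subseteq> X"
    then obtain ys where ys: "map f xs = map f ys" "vtuple ys \<in> elts (vapp I R)" "set ys \<subseteq> X" by blast
    have "inj_on f (set xs \<union> set ys)" using xs ys(3) by (intro inj_on_subset[OF inj]) simp
    with ys(1) have "xs = ys" by (rule map_inj_on)
    with ys(2) show "vtuple xs \<in> elts (vapp I R)" by simp
  qed (use xs in blast)
  finally show "holds_rel (transport L (graph f X) A) R (map f xs) \<longleftrightarrow> holds_rel A R xs"
    unfolding holds_rel_def A' by simp
qed

definition id_graph :: "'u \<Rightarrow> 'u" where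
  "id_graph x = vset ((\<lambda>y. kpair y y) ` elts x)"

lemma tm_id_graph: "tm t \<Longrightarrow> tm (\<lambda>e. id_graph (t e))"
  unfolding id_graph_def by (intro tm_repl tm_kpair tm_var)

lemma structure_pfst: "is_structure L A \<Longrightarrow> elts (pfst A) = carrier A"
  unfolding is_structure_def carrier_def by auto

lemma id_graph_eq: "id_graph x = graph (\<lambda>y. y) (elts x)"
  unfolding id_graph_def graph_def ..

text \<open>The definition of \<open>substructure\<close> quantifies over HOL lists and uses HOL
  arities. An inclusion of carriers together with one equation between terms is definable.\<close>

lemma substructure_iff:
  assumes L: "relational_language L" and A: "is_structure L A" and B: "is_structure L B"
    and fin: "finite (carrier B)"
  shows "substructure L B A \<longleftrightarrow>
    elts (pfst B) \<subseteq> elts (pfst A) \<and> transport L (id_graph (pfst B)) A = B"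
  unfolding structure_pfst[OF A] structure_pfst[OF B] id_graph_eq
proof (intro iffI conjI)
  assume s: "substructure L B A"
  then show sub: "carrier B \<subseteq> carrier A" unfolding substructure_def by blast
  note T = transport_structure[OF L A fin sub, of "\<lambda>y. y"]
  show "transport L (graph (\<lambda>y. y) (carrier B)) A = B"
  proof (rule structure_ext[OF T(1) B])
    fix R xs assume "R \<in> vdom L" "length xs = arity L R"
      "set xs \<subseteq> carrier (transport L (graph (\<lambda>y. y) (carrier B)) A)"
    with T(2) T(3)[of R xs] s
    show "holds_rel (transport L (graph (\<lambda>y. y) (carrier B)) A) R xs \<longleftrightarrow> holds_rel B R xs"
      unfolding substructure_def by simp
  qed (simp add: T(2))
next
  assume a: "carrier B \<subseteq> carrier A \<and> transport L (graph (\<lambda>y. y) (carrier B)) A = B"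
  then have sub: "carrier B \<subseteq> carrier A" and eq: "transport L (graph (\<lambda>y. y) (carrier B)) A = B" by auto
  note T = transport_structure[OF L A fin sub, of "\<lambda>y. y"]
  show "substructure L B A"
    unfolding substructure_def using A B sub T(3) unfolding eq by simp
qed

end

lemma substructure_trans:
  "substructure L C B \<Longrightarrow> substructure L B A \<Longrightarrow> substructure L C A"
  unfolding substructure_def by (meson order_trans)

lemma substructure_refl: "is_structure L A \<Longrightarrow> substructure L A A"
  unfolding substructure_def by simp

lemma stronger_trans: "stronger L A B \<Longrightarrow> stronger L B C \<Longrightarrow> stronger L A C"
  unfolding stronger_def using substructure_trans by blast

lemma embedding_holds:
  "embedding L A B h \<Longrightarrow> R \<in> vdom L \<Longrightarrow> length xs = arity L R \<Longrightarrow> set xs \<subseteq> carrier A \<Longrightarrow>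
    holds_rel B R (map h xs) \<longleftrightarrow> holds_rel A R xs"
  unfolding embedding_def by blast

section \<open>Copies and disjoint amalgams in a strong Fraisse class\<close>

locale fraisse_class = zfc_model V for V :: "'u::set_universe set" +
  fixes L :: 'u and K :: "'u set"
  assumes L_in_V: "L \<in> V" and L: "relational_language L" and K: "strong_fraisse_class V L K"
begin

lemma K_definable: "definable_class V K"
  and K_finite: "A \<in> K \<Longrightarrow> finite (carrier A)"
  and K_structure: "A \<in> K \<Longrightarrow> is_structure L A"
  and K_iso: "A \<in> K \<Longrightarrow> B \<in> V \<Longrightarrow> is_structure L B \<Longrightarrow> isomorphic L A B \<Longrightarrow> B \<in> K"
  and K_sub: "A \<in> K \<Longrightarrow> B \<in> V \<Longrightarrow> substructure L B A \<Longrightarrow> B \<in> K"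
  using K unfolding strong_fraisse_class_def class_of_finite_structures_def finite_structure_def HP_def
  by blast+

lemma K_in_V: "A \<in> K \<Longrightarrow> A \<in> V"
  using K_definable unfolding definable_class_def by blast

lemma carrier_in_V: "A \<in> K \<Longrightarrow> carrier A \<subseteq> V"
proof -
  assume A: "A \<in> K"
  then obtain D I where "A = kpair D I" using K_structure unfolding is_structure_def by blast
  with K_in_V[OF A] have "D \<in> V" "carrier A = elts D" by (auto simp: kpair_in_V carrier_def)
  then show ?thesis using V_trans by blast
qed

lemma transport_in_V:
  assumes "A \<in> K" "X \<subseteq> carrier A" "f ` X \<subseteq> V"
  shows "transport L (graph f X) A \<in> V"
proof -
  have X: "finite X" "X \<subseteq> V"
    using assms finite_subset[OF _ K_finite] carrier_in_V by blast+
  have "tm (\<lambda>e. transport L (graph f X) A)"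
    by (intro tm_transport tm_const L_in_V graph_in_V X assms K_in_V)
  then show ?thesis by (rule tm_closed)
qed

text \<open>The transport is a restriction followed by a renaming: HP handles the first, closure
  under isomorphism the second.\<close>

lemma transport_in_K:
  assumes A: "A \<in> K" and X: "X \<subseteq> carrier A" and f: "f ` X \<subseteq> V" "inj_on f X"
  shows "transport L (graph f X) A \<in> K"
proof -
  have fin: "finite X" using finite_subset[OF X K_finite[OF A]] .
  define B where "B = transport L (graph (\<lambda>y. y) X) A"
  define C where "C = transport L (graph f X) A"
  note TB = transport_structure[OF L K_structure[OF A] fin X, of "\<lambda>y. y", folded B_def]
  note TC = transport_structure[OF L K_structure[OF A] fin X, of f, folded C_def]
  have "X \<subseteq> V" using X carrier_in_V[OF A] by blast
  then have "B \<in> V" unfolding B_def using A X by (intro transport_in_V) simp_all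
  moreover have "substructure L B A"
    unfolding substructure_def using TB X K_structure[OF A] by simp
  ultimately have "B \<in> K" using K_sub[OF A] by blast
  moreover have "C \<in> V" unfolding C_def using A X f(1) by (rule transport_in_V)
  moreover have "embedding L B C f"
    unfolding embedding_def using TB TC f(2) by simp
  then have "isomorphic L B C"
    unfolding isomorphic_def using TB(2) TC(2) by (intro exI[of _ f]) simp
  ultimately have "C \<in> K" using K_iso TC(1) by blast
  then show ?thesis unfolding C_def .
qed

text \<open>On the empty carrier only nullary relations carry information. Joint embedding makes
  them constant on the class, so that the empty structure embeds into every member.\<close>

lemma nullary:
  assumes "A \<in> K" "B \<in> K" "R \<in> vdom L" "arity L R = 0"
  shows "holds_rel A R [] \<longleftrightarrow> holds_rel B R []"
proof -
  obtain C f g where "embedding L A C f" "embedding L B C g"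
    using K assms(1,2) unfolding strong_fraisse_class_def JEP_def by blast
  from embedding_holds[OF this(1) assms(3), of "[]"] embedding_holds[OF this(2) assms(3), of "[]"]
  show ?thesis using assms(4) by simp
qed

text \<open>The intersection clause of SAP keeps the two images disjoint over the empty structure.
  The amalgam can then be renamed so that \<open>p\<close> becomes an actual substructure and
  \<open>A\<close> sits on the prescribed set.\<close>

lemma disjoint_amalgam:
  assumes p: "p \<in> K" and A: "A \<in> K" and g: "inj_on g (carrier A)" "g ` carrier A \<subseteq> V"
    and disj: "g ` carrier A \<inter> carrier p = {}"
  shows "\<exists>C\<in>K. carrier C = carrier p \<union> g ` carrier A \<and> substructure L p C \<and> embedding L A C g"
proof -
  \<comment> \<open>\<open>E\<close> is the empty structure: the amalgamation is over \<open>E\<close>.\<close>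
  define E where "E = transport L (graph (\<lambda>y. y) {}) p"
  have E: "E \<in> K" unfolding E_def by (rule transport_in_K[OF p]) simp_all
  have cE: "carrier E = {}"
    using transport_structure(2)[OF L K_structure[OF p], of "{}" "\<lambda>y. y"] unfolding E_def by simp
  have emb: "embedding L E B id" if "B \<in> K" for B
    unfolding embedding_def using cE nullary[OF E that] by auto
  obtain M j1 j2 where M: "M \<in> K" "embedding L p M j1" "embedding L A M j2"
    "j1 ` carrier p \<inter> j2 ` carrier A = (j1 \<circ> id) ` carrier E"
    using K p A E emb[OF p] emb[OF A] unfolding strong_fraisse_class_def SAP_def by meson
  have j1: "inj_on j1 (carrier p)" "j1 ` carrier p \<subseteq> carrier M"
    using M(2) unfolding embedding_def by auto
  have j2: "inj_on j2 (carrier A)" "j2 ` carrier A \<subseteq> carrier M"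
    using M(3) unfolding embedding_def by auto
  have dj: "j1 ` carrier p \<inter> j2 ` carrier A = {}" using M(4) cE by simp
  \<comment> \<open>On the image of \<open>p\<close> the embedding is undone; on the image of
    \<open>A\<close> it is undone and followed by \<open>g\<close>. Disjointness of the images makes
    the two clauses compatible.\<close>
  define h where "h m = (if m \<in> j1 ` carrier p then inv_into (carrier p) j1 m
     else g (inv_into (carrier A) j2 m))" for m
  have h1: "h (j1 x) = x" if "x \<in> carrier p" for x
    unfolding h_def using that j1(1) by simp
  have h2: "h (j2 a) = g a" if "a \<in> carrier A" for a
  proof -
    have "j2 a \<notin> j1 ` carrier p" using dj that by blast
    then show ?thesis unfolding h_def using that j2(1) by simp
  qed
  \<comment> \<open>Points of the amalgam outside both images are dropped, so that the carrier is
    exactly the required union.\<close>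
  define X where "X = j1 ` carrier p \<union> j2 ` carrier A"
  have X: "X \<subseteq> carrier M" unfolding X_def using j1 j2 by blast
  have hX: "h ` X = carrier p \<union> g ` carrier A"
    unfolding X_def image_Un image_image using h1 h2 by simp
  have injh: "inj_on h X"
  proof (rule inj_onI)
    fix x y assume "x \<in> X" "y \<in> X" "h x = h y"
    then consider a b where "x = j1 a" "y = j1 b" "a \<in> carrier p" "b \<in> carrier p"
      | a b where "x = j1 a" "y = j2 b" "a \<in> carrier p" "b \<in> carrier A"
      | a b where "x = j2 a" "y = j1 b" "a \<in> carrier A" "b \<in> carrier p"
      | a b where "x = j2 a" "y = j2 b" "a \<in> carrier A" "b \<in> carrier A"
      unfolding X_def by blast
    then show "x = y"
    proof cases
      case 1
      then show ?thesis using h1 \<open>h x = h y\<close> by simp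
    next
      case 2
      then have "a = g b" using h1 h2 \<open>h x = h y\<close> by simp
      with 2 disj show ?thesis by blast
    next
      case 3
      then have "b = g a" using h1 h2 \<open>h x = h y\<close> by simp
      with 3 disj show ?thesis by blast
    next
      case 4
      then have "g a = g b" using h2 \<open>h x = h y\<close> by simp
      with 4 g(1) show ?thesis by (auto dest: inj_onD)
    qed
  qed
  define C where "C = transport L (graph h X) M"
  have hV: "h ` X \<subseteq> V" unfolding hX using carrier_in_V[OF p] g(2) by blast
  have C: "C \<in> K" unfolding C_def using M(1) X hV injh by (rule transport_in_K)
  note T = transport_structure[OF L K_structure[OF M(1)] finite_subset[OF X K_finite[OF M(1)]] X, of h, folded C_def]
  have cC: "carrier C = carrier p \<union> g ` carrier A" using T(2) hX by simp
  have "holds_rel p R xs \<longleftrightarrow> holds_rel C R xs"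
    if R: "R \<in> vdom L" and xs: "length xs = arity L R" "set xs \<subseteq> carrier p" for R xs
  proof -
    have eq: "map h (map j1 xs) = xs" using xs h1 by (simp add: map_idI subset_iff)
    have sub: "set (map j1 xs) \<subseteq> X" using xs unfolding X_def by auto
    have "holds_rel C R xs \<longleftrightarrow> holds_rel M R (map j1 xs)"
      using T(3)[OF injh R sub] unfolding eq .
    then show ?thesis using embedding_holds[OF M(2) R xs] by simp
  qed
  then have "substructure L p C"
    unfolding substructure_def using K_structure[OF p] K_structure[OF C] cC by blast
  moreover have "holds_rel A R xs \<longleftrightarrow> holds_rel C R (map g xs)"
    if R: "R \<in> vdom L" and xs: "length xs = arity L R" "set xs \<subseteq> carrier A" for R xs
  proof -
    have eq: "map h (map j2 xs) = map g xs" using xs h2 by auto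
    have sub: "set (map j2 xs) \<subseteq> X" using xs unfolding X_def by auto
    have "holds_rel C R (map g xs) \<longleftrightarrow> holds_rel M R (map j2 xs)"
      using T(3)[OF injh R sub] unfolding eq .
    then show ?thesis using embedding_holds[OF M(3) R xs] by simp
  qed
  then have "embedding L A C g"
    unfolding embedding_def using g(1) cC by blast
  ultimately show ?thesis using C cC by blast
qed

end

section \<open>Enumerating the conditions\<close>

context zfc_model begin

section \<open>Listing a set with infinite repetition\<close>

definition vprod :: "'u \<Rightarrow> 'u \<Rightarrow> 'u" where
  "vprod a b = vset (\<Union>y\<in>elts (vset ((\<lambda>x. vset (kpair x ` elts b)) ` elts a)). elts y)"

lemma elts_vprod: "elts (vprod a b) = {kpair x y | x y. x \<in> elts a \<and> y \<in> elts b}"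
  unfolding vprod_def elts_vset_Union unfolding elts_vset_image by auto

lemma tm_vprod:
  assumes a: "tm a" and b: "tm b" shows "tm (\<lambda>e. vprod (a e) (b e))"
  unfolding vprod_def
  by (intro tm_Union tm_repl[where F = "\<lambda>e x. vset (kpair x ` elts (b e))"] a
      tm_repl[where F = "\<lambda>e. kpair (e 0)"] tm_kpair tm_var tm_ren[OF b])

lemma finite_Pow_V:
  assumes "x \<in> V" "finite (elts x)" shows "finite (elts (Pow_V x))"
proof (rule inj_on_finite[of elts])
  show "inj_on elts (elts (Pow_V x))" by (auto intro: inj_onI elts_ext)
  show "elts ` elts (Pow_V x) \<subseteq> Pow (elts x)" using Pow_V[OF assms(1)] by auto
qed (simp add: assms)

text \<open>The elements of a set that is an increasing union of finite sets are listed by a recursion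
  whose state consists of an index and the elements of the corresponding finite set that have not
  been listed yet; a choice function selects the next one.\<close>

lemma enumeration:
  assumes P: "P \<in> V" and q0: "q0 \<in> elts P" and Q: "tm (\<lambda>e. Q (e 0))"
    and fin: "\<And>n. finite (elts (Q (vnat n)))" and sub: "\<And>n. elts (Q (vnat n)) \<subseteq> elts P"
    and mono: "\<And>m n. m \<le> n \<Longrightarrow> elts (Q (vnat m)) \<subseteq> elts (Q (vnat n))"
    and cover: "\<And>q. q \<in> elts P \<Longrightarrow> \<exists>n. q \<in> elts (Q (vnat n))"
  shows "\<exists>g. tm (\<lambda>e. g (e 0)) \<and> (\<forall>k. g (vnat k) \<in> elts P) \<and>
    (\<forall>q\<in>elts P. \<forall>m. \<exists>k\<ge>m. g (vnat k) = q)"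
proof -
  have "tm (\<lambda>e. vset {S \<in> elts (Pow_V P). \<not> S = vset {}})"
    by (intro tm_sep tm_Pow dfn_not dfn_eq tm_var) (intro tm_const P empty_in_V)+
  then have a: "vset {S \<in> elts (Pow_V P). \<not> S = vset {}} \<in> V" by (rule tm_closed)
  have Sub: "elts (vset {S \<in> elts (Pow_V P). \<not> S = vset {}}) =
      {S \<in> V. elts S \<subseteq> elts P \<and> S \<noteq> vset {}}"
    by (subst elts_vset_Collect) (simp add: Pow_V[OF P] conj_assoc)
  have "\<exists>c\<in>V. \<forall>S\<in>elts (vset {S \<in> elts (Pow_V P). \<not> S = vset {}}). app c S \<in> elts P \<and> app c S \<in> elts S"
  proof (rule choice_in_V[OF a P, of "\<lambda>S y. y \<in> elts S"])
    show "dfn (\<lambda>e. e 0 \<in> elts (e (Suc 0)))" by (rule dfn_mem_var)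
    fix S assume "S \<in> elts (vset {S \<in> elts (Pow_V P). \<not> S = vset {}})"
    then have S: "elts S \<subseteq> elts P" "S \<noteq> vset {}" unfolding Sub by simp_all
    then have "elts S \<noteq> {}" by (metis elts_ext elts_vset_empty)
    then show "\<exists>y\<in>elts P. y \<in> elts S" using S by blast
  qed
  then obtain c where c: "c \<in> V"
    and c_choice: "\<And>S. S \<in> V \<Longrightarrow> elts S \<subseteq> elts P \<Longrightarrow> S \<noteq> vset {} \<Longrightarrow> app c S \<in> elts S"
    unfolding Sub by blast
  have Qt: "tm (\<lambda>e. Q (t e))" if "tm t" for t
    by (rule tm_subst[where F = "\<lambda>e. Q", OF that Q])
  \<comment> \<open>If nothing is left to be listed, the index is raised and the whole next finite
    set is loaded; otherwise the chosen element is struck off.\<close>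
  define F where "F z = (if psnd z = vset {} then kpair (vsuc (pfst z)) (Q (vsuc (pfst z)))
    else kpair (pfst z) (vset {q \<in> elts (psnd z). \<not> q = app c (psnd z)}))" for z
  define st where "st x = iter F (kpair (vnat 0) (Q (vnat 0))) x" for x
  \<comment> \<open>At a stage with nothing left to list, \<open>q0\<close> fills the gap.\<close>
  define g where "g x = (if psnd (st x) = vset {} then q0 else app c (psnd (st x)))" for x
  have q0V: "q0 \<in> V" using V_trans[OF P q0] .
  have tmF: "tm (\<lambda>e. F (e 0))"
    unfolding F_def
    by (intro tm_if dfn_eq tm_psnd tm_kpair tm_vsuc Qt tm_pfst tm_sep dfn_not tm_app tm_var
        tm_const[OF empty_in_V] tm_const[OF c])
  have tmst: "tm (\<lambda>e. st (t e))" if "tm t" for t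
    unfolding st_def
    by (intro tm_iter that tmF tm_kpair Qt tm_const[OF vnat_in_V])
  have tmg: "tm (\<lambda>e. g (e 0))"
    unfolding g_def
    by (intro tm_if dfn_eq tm_psnd tmst tm_app tm_var tm_const[OF empty_in_V] tm_const[OF c] tm_const[OF q0V])
  have st0: "st (vnat 0) = kpair (vnat 0) (Q (vnat 0))" unfolding st_def by simp
  have stS: "st (vnat (Suc k)) = F (st (vnat k))" for k unfolding st_def by simp
  \<comment> \<open>The bound \<open>n \<le> k\<close> is what later turns a large index into a late
    stage.\<close>
  have inv: "\<exists>n S. st (vnat k) = kpair (vnat n) S \<and> n \<le> k \<and> S \<in> V \<and> elts S \<subseteq> elts (Q (vnat n))" for k
  proof (induction k)
    case 0
    have "Q (vnat 0) \<in> V" using tm_closed[OF Qt[OF tm_const[OF vnat_in_V]]] .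
    then show ?case using st0 by auto
  next
    case (Suc k)
    then obtain n S where s: "st (vnat k) = kpair (vnat n) S" "n \<le> k" "S \<in> V" "elts S \<subseteq> elts (Q (vnat n))"
      by blast
    show ?case
    proof (cases "S = vset {}")
      case True
      have "Q (vnat (Suc n)) \<in> V" using tm_closed[OF Qt[OF tm_const[OF vnat_in_V]]] .
      moreover have "st (vnat (Suc k)) = kpair (vnat (Suc n)) (Q (vnat (Suc n)))"
        unfolding stS s(1) F_def using True by simp
      ultimately show ?thesis using s(2) by blast
    next
      case False
      define S' where "S' = vset {q \<in> elts S. \<not> q = app c S}"
      have "tm (\<lambda>e. S')"
        unfolding S'_def by (intro tm_sep dfn_not dfn_eq tm_app tm_var tm_const[OF c] tm_const[OF s(3)])
      then have "S' \<in> V" by (rule tm_closed)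
      moreover have "elts S' \<subseteq> elts (Q (vnat n))" using s(4) unfolding S'_def by auto
      moreover have "st (vnat (Suc k)) = kpair (vnat n) S'"
        unfolding stS s(1) F_def S'_def using False by simp
      ultimately show ?thesis using s(2) by (intro exI[of _ n] exI[of _ S']) simp
    qed
  qed
  have g_st: "g (vnat k) = (if S = vset {} then q0 else app c S)"
    if "st (vnat k) = kpair (vnat n) S" for k n S
    unfolding g_def using that by simp
  have gP: "g (vnat k) \<in> elts P" for k
  proof -
    obtain n S where s: "st (vnat k) = kpair (vnat n) S" "S \<in> V" "elts S \<subseteq> elts (Q (vnat n))"
      using inv by blast
    have "elts S \<subseteq> elts P" using s(3) sub by blast
    then show ?thesis using c_choice[OF s(2)] q0 unfolding g_st[OF s(1)] by auto
  qed
  \<comment> \<open>By induction on the number of remaining elements, a round lists all of them and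
    ends with the empty set at the same index.\<close>
  have run: "(\<exists>k'\<ge>k. st (vnat k') = kpair (vnat n) (vset {})) \<and> (\<forall>q\<in>elts S. \<exists>k'\<ge>k. g (vnat k') = q)"
    if "st (vnat k) = kpair (vnat n) S" for k n S
  proof -
    have "finite (elts S)"
    proof -
      obtain n' S' where "st (vnat k) = kpair (vnat n') S'" "elts S' \<subseteq> elts (Q (vnat n'))"
        using inv by blast
      with that have "elts S \<subseteq> elts (Q (vnat n'))" by simp
      then show ?thesis using fin finite_subset by blast
    qed
    then show ?thesis using that
    proof (induction "card (elts S)" arbitrary: k S rule: less_induct)
      case less
      show ?case
      proof (cases "S = vset {}")
        case True
        with less.prems show ?thesis by auto
      next
        case False
        define S' where "S' = vset {q \<in> elts S. \<not> q = app c S}"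
        have eS': "elts S' = elts S - {app c S}" unfolding S'_def by auto
        obtain n' S'' where "st (vnat k) = kpair (vnat n') S''" "S'' \<in> V" "elts S'' \<subseteq> elts (Q (vnat n'))"
          using inv by blast
        with less.prems(2) have S: "S \<in> V" "elts S \<subseteq> elts P" using sub by auto
        have cS: "app c S \<in> elts S" using c_choice[OF S False] .
        have "card (elts S') < card (elts S)"
          unfolding eS' using less.prems(1) cS by (intro psubset_card_mono) auto
        moreover have "finite (elts S')" unfolding eS' using less.prems(1) by simp
        moreover have "st (vnat (Suc k)) = kpair (vnat n) S'"
          unfolding stS less.prems(2) F_def S'_def using False by simp
        ultimately have IH: "(\<exists>k'\<ge>Suc k. st (vnat k') = kpair (vnat n) (vset {})) \<and>
            (\<forall>q\<in>elts S'. \<exists>k'\<ge>Suc k. g (vnat k') = q)"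
          by (rule less.hyps)
        have "\<exists>k'\<ge>k. g (vnat k') = q" if "q \<in> elts S" for q
        proof (cases "q = app c S")
          case True
          then have "g (vnat k) = q" using g_st[OF less.prems(2)] False by simp
          then show ?thesis by blast
        next
          case q: False
          with that have "q \<in> elts S'" unfolding eS' by simp
          with IH obtain k' where "k' \<ge> Suc k" "g (vnat k') = q" by blast
          then show ?thesis using Suc_leD by blast
        qed
        moreover have "\<exists>k'\<ge>k. st (vnat k') = kpair (vnat n) (vset {})"
          using IH Suc_leD by blast
        ultimately show ?thesis by blast
      qed
    qed
  qed
  have reach: "\<exists>k. st (vnat k) = kpair (vnat n) (Q (vnat n))" for n
  proof (induction n)
    case 0
    show ?case using st0 by blast
  next
    case (Suc n)
    then obtain k where "st (vnat k) = kpair (vnat n) (Q (vnat n))" by blast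
    from run[OF this] obtain k' where "st (vnat k') = kpair (vnat n) (vset {})" by blast
    then have "st (vnat (Suc k')) = kpair (vnat (Suc n)) (Q (vnat (Suc n)))"
      unfolding stS F_def by simp
    then show ?case by blast
  qed
  have "\<exists>k\<ge>m. g (vnat k) = q" if q: "q \<in> elts P" for q m
  proof -
    obtain i where i: "q \<in> elts (Q (vnat i))" using cover[OF q] by blast
    \<comment> \<open>Index at least \<open>i\<close> guarantees that \<open>q\<close> is in the
      loaded set, by monotonicity; index at least \<open>m\<close> guarantees that the round starts
      no earlier than stage \<open>m\<close>.\<close>
    define n where "n = max i m"
    have "q \<in> elts (Q (vnat n))" using i mono[of i n] unfolding n_def by auto
    moreover obtain k where k: "st (vnat k) = kpair (vnat n) (Q (vnat n))" using reach by blast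
    ultimately obtain k' where k': "k' \<ge> k" "g (vnat k') = q" using run[OF k] by blast
    obtain n' S where "st (vnat k) = kpair (vnat n') S" "n' \<le> k" using inv by blast
    with k have "n \<le> k" by simp
    then have "m \<le> k'" using k'(1) unfolding n_def by simp
    with k' show ?thesis by blast
  qed
  with tmg gP show ?thesis by blast
qed

end

section \<open>Countability of the forcing notion inside \<open>V\<close>\<close>

context fraisse_class begin

text \<open>Every isomorphic copy is literally a transport, along the inverse isomorphism. A
  condition is thus coded by a representative and a finite set of pairs.\<close>

lemma iso_eq_transport:
  assumes A: "A \<in> K" and B: "B \<in> K" and "isomorphic L A B"
  shows "\<exists>g. g ` carrier B = carrier A \<and> A = transport L (graph g (carrier B)) B"
proof -
  obtain h where h: "embedding L A B h" "h ` carrier A = carrier B"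
    using assms(3) unfolding isomorphic_def by blast
  have inj: "inj_on h (carrier A)" using h(1) unfolding embedding_def by blast
  define g where "g = inv_into (carrier A) h"
  have gh: "g (h x) = x" if "x \<in> carrier A" for x using that inj unfolding g_def by simp
  have gB: "g ` carrier B = carrier A" unfolding h(2)[symmetric] image_image using gh by simp
  have ginj: "inj_on g (carrier B)" unfolding g_def using h(2) by (intro inj_on_inv_into) simp
  note T = transport_structure[OF L K_structure[OF B] K_finite[OF B] order_refl, of g]
  have "A = transport L (graph g (carrier B)) B"
  proof (rule structure_ext[OF K_structure[OF A] T(1)])
    show "carrier A = carrier (transport L (graph g (carrier B)) B)" using T(2) gB by simp
    fix R xs assume R: "R \<in> vdom L" and xs: "length xs = arity L R" "set xs \<subseteq> carrier A"
    have eq: "map g (map h xs) = xs" using xs(2) gh by (simp add: map_idI subset_iff)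
    have sub: "set (map h xs) \<subseteq> carrier B" using xs(2) h(2) by auto
    show "holds_rel A R xs \<longleftrightarrow> holds_rel (transport L (graph g (carrier B)) B) R xs"
      using T(3)[OF ginj R sub] embedding_holds[OF h(1) R xs] unfolding eq by simp
  qed
  with gB show ?thesis by blast
qed

abbreviation Cond :: "'u set" where "Cond \<equiv> conditions omega K"

lemma Cond_iff: "q \<in> Cond \<longleftrightarrow> q \<in> K \<and> carrier q \<subseteq> range vnat"
  unfolding conditions_def elts_omega by simp

text \<open>The definable form of the forcing order. It agrees with \<open>stronger\<close> on
  members of \<open>K\<close>.\<close>

definition extends :: "'u \<Rightarrow> 'u \<Rightarrow> bool" where
  "extends A B \<longleftrightarrow> elts (pfst B) \<subseteq> elts (pfst A) \<and> transport L (id_graph (pfst B)) A = B"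

lemma dfn_extends: "tm s \<Longrightarrow> tm t \<Longrightarrow> dfn (\<lambda>e. extends (s e) (t e))"
  unfolding extends_def
  by (intro dfn_conj dfn_subset dfn_eq tm_transport tm_id_graph tm_pfst L_in_V)

lemma extends_iff: "A \<in> K \<Longrightarrow> B \<in> K \<Longrightarrow> extends A B \<longleftrightarrow> stronger L A B"
  unfolding extends_def stronger_def
  by (rule substructure_iff[symmetric]) (simp_all add: L K_structure K_finite)

text \<open>The \<open>n\<close>-th finite set consists of the copies on subsets of \<open>{..<n}\<close> of the first \<open>n\<close>
  representatives of the isomorphism types.\<close>

lemma Cond_enumeration:
  assumes "countably_many_iso_types V L K"
  shows "\<exists>P\<in>V. elts P = Cond"
    and "Cond \<noteq> {} \<Longrightarrow> \<exists>g. tm (\<lambda>e. g (e 0)) \<and> (\<forall>k. g (vnat k) \<in> Cond) \<and>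
      (\<forall>q\<in>Cond. \<forall>m. \<exists>k\<ge>m. g (vnat k) = q)"
proof -
  obtain f where f: "f \<in> V" "is_function f" "vdom f \<subseteq> elts omega" "\<And>n. n \<in> vdom f \<Longrightarrow> vapp f n \<in> K"
    "\<And>A. A \<in> K \<Longrightarrow> \<exists>n\<in>vdom f. isomorphic L A (vapp f n)"
    using assms unfolding countably_many_iso_types_def by blast
  have fK: "app f k \<in> K" if "k \<in> elts (dm f)" for k
    using that f(4) is_function_app(1)[OF f(2)] unfolding is_function_dm[OF f(2)] by simp
  define H where "H k b = Pow_V (vprod (pfst (app f k)) b)" for k b
  have tmH: "tm (\<lambda>e. H (s e) (t e))" if "tm s" "tm t" for s t
    unfolding H_def by (intro tm_Pow tm_vprod tm_pfst tm_app that tm_const[OF f(1)])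
  have copy: "\<exists>g. g \<in> elts (H k b) \<and> q = transport L g (app f k)"
    if q: "q \<in> K" and b: "b \<in> V" "carrier q \<subseteq> elts b"
      and k: "k \<in> elts (dm f)" "isomorphic L q (app f k)" for q b k
  proof -
    obtain g where g: "g ` carrier (app f k) = carrier q"
      "q = transport L (graph g (carrier (app f k))) (app f k)"
      using iso_eq_transport[OF q fK[OF k(1)] k(2)] by blast
    have fin: "finite (carrier (app f k))" using K_finite fK k(1) by blast
    have "graph g (carrier (app f k)) \<in> V"
      using fin carrier_in_V[OF fK[OF k(1)]] g(1) carrier_in_V[OF q] by (intro graph_in_V) simp_all
    moreover have "elts (graph g (carrier (app f k))) \<subseteq> elts (vprod (pfst (app f k)) b)"
      unfolding elts_graph[OF fin] elts_vprod structure_pfst[OF K_structure[OF fK[OF k(1)]]]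
      using g(1) b(2) by blast
    moreover have "vprod (pfst (app f k)) b \<in> V"
      by (rule tm_closed, intro tm_vprod tm_pfst tm_const b(1) K_in_V fK k(1))
    ultimately have "graph g (carrier (app f k)) \<in> elts (H k b)"
      unfolding H_def using Pow_V by simp
    with g(2) show ?thesis by blast
  qed
  have type: "\<exists>k\<in>elts (dm f). isomorphic L q (app f k)" if "q \<in> K" for q
    using f(5)[OF that] is_function_app(1)[OF f(2)] is_function_dm[OF f(2)] by auto
  \<comment> \<open>\<open>K\<close> is only a class, so a set in \<open>V\<close> containing all
    conditions is needed before separation can cut out exactly the conditions.\<close>
  define W where "W = vset (\<Union>y\<in>elts (vset ((\<lambda>k. vset ((\<lambda>h. transport L h (app f k)) ` elts (H k omega))) ` elts (dm f))). elts y)"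
  have "tm (\<lambda>e. W)"
    unfolding W_def
    by (intro tm_Union tm_repl[where F = "\<lambda>e k. vset ((\<lambda>h. transport L h (app f k)) ` elts (H k omega))"]
        tm_repl[where F = "\<lambda>e h. transport L h (app f (e 0))"] tm_transport L_in_V tm_app tmH tm_dm tm_var
        tm_const[OF f(1)] tm_const[OF omega_in_V])
  then have W: "W \<in> V" by (rule tm_closed)
  have eW: "elts W = {transport L h (app f k) | h k. k \<in> elts (dm f) \<and> h \<in> elts (H k omega)}"
    unfolding W_def elts_vset_Union unfolding elts_vset_image by auto
  define P where "P = vset {q \<in> elts W. q \<in> K \<and> elts (pfst q) \<subseteq> elts omega}"
  have "tm (\<lambda>e. P)"
    unfolding P_def
    by (intro tm_sep dfn_conj dfn_subset dfn_class[OF K_definable] tm_pfst tm_var tm_const[OF W] tm_const[OF omega_in_V])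
  then have P: "P \<in> V" by (rule tm_closed)
  have eP: "elts P = Cond"
  proof (intro equalityI subsetI)
    fix q assume "q \<in> elts P"
    then have "q \<in> K" "elts (pfst q) \<subseteq> elts omega" unfolding P_def by auto
    then show "q \<in> Cond" using structure_pfst[OF K_structure] unfolding Cond_iff elts_omega by simp
  next
    fix q assume q: "q \<in> Cond"
    then have qK: "q \<in> K" "carrier q \<subseteq> elts omega" unfolding Cond_iff elts_omega by auto
    obtain k where k: "k \<in> elts (dm f)" "isomorphic L q (app f k)" using type[OF qK(1)] by blast
    obtain g where "g \<in> elts (H k omega)" "q = transport L g (app f k)"
      using copy[OF qK(1) omega_in_V qK(2) k] by blast
    with k(1) have "q \<in> elts W" unfolding eW by blast
    with q show "q \<in> elts P"
      unfolding P_def using structure_pfst[OF K_structure] unfolding Cond_iff elts_omega by simp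
  qed
  then show "\<exists>P\<in>V. elts P = Cond" using P by blast
  define Q where "Q n = vset {q \<in> elts P. \<exists>k\<in>elts (dm f). k \<in> elts n \<and>
    (\<exists>h\<in>elts (H k n). q = transport L h (app f k))}" for n
  assume "Cond \<noteq> {}"
  then obtain q0 where q0: "q0 \<in> elts P" using eP by blast
  have "\<exists>g. tm (\<lambda>e. g (e 0)) \<and> (\<forall>k. g (vnat k) \<in> elts P) \<and>
    (\<forall>q\<in>elts P. \<forall>m. \<exists>k\<ge>m. g (vnat k) = q)"
  proof (rule enumeration[OF P q0, of Q])
    show "tm (\<lambda>e. Q (e 0))"
      unfolding Q_def
      by (intro tm_sep dfn_bex dfn_conj dfn_mem dfn_eq tm_transport L_in_V tm_app tmH tm_dm tm_var
        tm_const[OF f(1)] tm_const[OF P])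
    show sub: "elts (Q (vnat n)) \<subseteq> elts P" for n unfolding Q_def by auto
    have HV: "vprod (pfst (app f k)) (vnat n) \<in> V" if "k \<in> elts (dm f)" for k n
      by (rule tm_closed, intro tm_vprod tm_pfst tm_const vnat_in_V K_in_V fK that)
    show "finite (elts (Q (vnat n)))" for n
    proof (rule finite_subset)
      show "elts (Q (vnat n)) \<subseteq> (\<Union>k\<in>elts (dm f) \<inter> elts (vnat n). (\<lambda>h. transport L h (app f k)) ` elts (H k (vnat n)))"
        unfolding Q_def by auto
      have "finite (elts (H k (vnat n)))" if k: "k \<in> elts (dm f)" for k
      proof -
        have "elts (vprod (pfst (app f k)) (vnat n)) =
            (\<lambda>(x, y). kpair x y) ` (carrier (app f k) \<times> elts (vnat n))"
          unfolding elts_vprod structure_pfst[OF K_structure[OF fK[OF k]]] by auto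
        then have "finite (elts (vprod (pfst (app f k)) (vnat n)))"
          using K_finite[OF fK[OF k]] by (simp add: elts_vnat)
        then show ?thesis unfolding H_def by (rule finite_Pow_V[OF HV[OF k]])
      qed
      then show "finite (\<Union>k\<in>elts (dm f) \<inter> elts (vnat n). (\<lambda>h. transport L h (app f k)) ` elts (H k (vnat n)))"
        by (intro finite_UN_I finite_imageI finite_Int) (simp_all add: elts_vnat)
    qed
    show "elts (Q (vnat m)) \<subseteq> elts (Q (vnat n))" if "m \<le> n" for m n
    proof
      have mn: "elts (vnat m :: 'u) \<subseteq> elts (vnat n)" using that unfolding elts_vnat by auto
      fix q assume "q \<in> elts (Q (vnat m))"
      then obtain k h where kh: "q \<in> elts P" "k \<in> elts (dm f)" "k \<in> elts (vnat m)" "h \<in> elts (H k (vnat m))"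
        "q = transport L h (app f k)" unfolding Q_def by auto
      have "elts (vprod (pfst (app f k)) (vnat m)) \<subseteq> elts (vprod (pfst (app f k)) (vnat n))"
        unfolding elts_vprod using mn by blast
      then have "h \<in> elts (H k (vnat n))"
        using kh(4) Pow_V[OF HV[OF kh(2)]] unfolding H_def by auto
      with kh mn show "q \<in> elts (Q (vnat n))" unfolding Q_def by auto
    qed
    show "\<exists>n. q \<in> elts (Q (vnat n))" if q: "q \<in> elts P" for q
    proof -
      have qC: "q \<in> K" "carrier q \<subseteq> range vnat" using q unfolding eP Cond_iff by auto
      then obtain I where I: "finite I" "carrier q = vnat ` I"
        using finite_subset_image[OF K_finite[OF qC(1)], of vnat UNIV] by auto
      then obtain b where b: "I \<subseteq> {..<b}" using finite_nat_set_iff_bounded[of I] by auto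
      obtain k where k: "k \<in> elts (dm f)" "isomorphic L q (app f k)" using type[OF qC(1)] by blast
      obtain i where i: "k = vnat i" using k(1) f(3) elts_omega is_function_dm[OF f(2)] by blast
      \<comment> \<open>Large enough for the carrier of \<open>q\<close> to lie below
        \<open>n\<close> and for the index \<open>i\<close> of its isomorphism type to be less than
        \<open>n\<close>.\<close>
      define n where "n = max b (Suc i)"
      have cn: "carrier q \<subseteq> elts (vnat n)" unfolding I(2) elts_vnat n_def using b by auto
      obtain g where g: "g \<in> elts (H k (vnat n))" "q = transport L g (app f k)"
        using copy[OF qC(1) vnat_in_V cn k] by blast
      have "k \<in> elts (vnat n)" unfolding i n_def by simp
      then have "q \<in> elts (Q (vnat n))" unfolding Q_def using q k(1) g by auto
      then show ?thesis ..
    qed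
  qed
  then show "\<exists>g. tm (\<lambda>e. g (e 0)) \<and> (\<forall>k. g (vnat k) \<in> Cond) \<and>
      (\<forall>q\<in>Cond. \<forall>m. \<exists>k\<ge>m. g (vnat k) = q)"
    unfolding eP .
qed

end

section \<open>Blocks\<close>

definition vnat_inv :: "'u::set_universe \<Rightarrow> nat" where "vnat_inv = inv vnat"

lemma vnat_inv_vnat [simp]: "vnat_inv (vnat n) = n"
  unfolding vnat_inv_def by (rule inv_f_f[OF inj_vnat])

definition block :: "nat \<Rightarrow> nat \<Rightarrow> 'u::set_universe set" where
  "block n k = (\<lambda>i. vnat (n * k + i)) ` {..<n}"

definition shift :: "nat \<Rightarrow> nat \<Rightarrow> 'u::set_universe \<Rightarrow> 'u" where
  "shift n k x = vnat (vnat_inv x - n * k)"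

lemma finite_block: "finite (block n k)" unfolding block_def by simp

lemma shift_block: "shift n k ` block n k = vnat ` {..<n}"
  unfolding shift_def block_def image_image by simp

lemma inj_shift: "inj_on (shift n k) (block n k)"
  unfolding shift_def block_def by (auto intro!: inj_onI)

lemma block_subset: "j < m \<Longrightarrow> block n j \<subseteq> vnat ` {..<n * m}"
proof -
  assume "j < m"
  then have "n * Suc j \<le> n * m" by (intro mult_le_mono2) simp
  then show ?thesis unfolding block_def by (intro subsetI, elim imageE) simp
qed

lemma literal_sat_transfer:
  assumes "literal_of L \<psi>" "inj_on h X" "s ` free_vars \<psi> \<subseteq> X"
    and "\<And>R xs. R \<in> vdom L \<Longrightarrow> set xs \<subseteq> X \<Longrightarrow> holds_rel B R (map h xs) \<longleftrightarrow> holds_rel A R xs"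
  shows "literal_sat B (\<lambda>v. h (s v)) \<psi> \<longleftrightarrow> literal_sat A s \<psi>"
  using assms(1,3)
proof (induction \<psi>)
  case (RelAtom R vs)
  then have "holds_rel B R (map h (map s vs)) \<longleftrightarrow> holds_rel A R (map s vs)"
    by (intro assms(4)) auto
  then show ?case by (simp add: comp_def)
next
  case (EqAtom v w)
  then show ?case using inj_on_eq_iff[OF assms(2)] by simp
qed simp

lemma finite_free_vars: "finite (free_vars \<psi>)"
  by (induction \<psi>) auto

context zfc_model begin

text \<open>Iterating the operation that adds \<open>n\<close> to all first components makes the
  shift of the \<open>k\<close>-th block a definable function of \<open>k\<close>. No addition or
  multiplication has to be developed in \<open>V\<close>, because \<open>n\<close> is fixed and
  adding it is an \<open>n\<close>-fold successor.\<close>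

definition block_map :: "nat \<Rightarrow> 'u \<Rightarrow> 'u" where
  "block_map n x = iter (\<lambda>g. vset ((\<lambda>z. kpair ((vsuc ^^ n) (pfst z)) (psnd z)) ` elts g))
     (graph (shift n 0) (block n 0)) x"

lemma tm_block_map:
  assumes t: "tm t" shows "tm (\<lambda>e. block_map n (t e))"
proof -
  have s: "tm (\<lambda>e. (vsuc ^^ m) (s e))" if "tm s" for s m
    by (induction m) (use that in \<open>auto intro: tm_vsuc\<close>)
  have "graph (shift n 0) (block n 0) \<in> V"
    by (intro graph_in_V finite_block) (auto simp: block_def shift_def vnat_in_V)
  then show ?thesis
    unfolding block_map_def by (intro tm_iter t tm_const tm_repl tm_kpair s tm_pfst tm_psnd tm_var)
qed

lemma block_map_vnat: "block_map n (vnat k) = graph (shift n k) (block n k)"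
proof (induction k)
  case 0
  show ?case unfolding block_map_def by simp
next
  case (Suc k)
  have e: "elts (graph (shift n k) (block n k)) = (\<lambda>i. kpair (vnat (n * k + i)) (vnat i)) ` {..<n}" for k
    unfolding elts_graph[OF finite_block] unfolding block_def shift_def image_image by simp
  have s: "(vsuc ^^ m) (vnat j) = vnat (j + m)" for m j by (induction m) simp_all
  have "elts (block_map n (vnat (Suc k))) = (\<lambda>z. kpair ((vsuc ^^ n) (pfst z)) (psnd z)) ` elts (block_map n (vnat k))"
    unfolding block_map_def iter_vnat funpow.simps comp_def elts_vset_image ..
  also have "\<dots> = elts (graph (shift n (Suc k)) (block n (Suc k)))"
    unfolding Suc.IH e image_image pfst_kpair psnd_kpair s by (simp add: algebra_simps)
  finally show ?case by (rule elts_ext)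
qed

lemma dm_block_map: "elts (dm (block_map n (vnat k))) = block n k"
  unfolding block_map_vnat by (rule dm_graph[OF finite_block])

end

section \<open>Two structures for one block, and extending conditions by blocks\<close>

context fraisse_class begin

text \<open>Non-triviality gives one tuple at which the literal fails and another at which it holds.
  Moving the \<open>i\<close>-th entry of either tuple to \<open>vnat i\<close> yields two
  structures on the same carrier that disagree about the literal under the same assignment.\<close>

lemma nontrivial_structures:
  assumes "\<not> trivial_class L K"
  shows "\<exists>n A A'. n > 0 \<and> A \<in> K \<and> A' \<in> K \<and> carrier A = vnat ` {..<n} \<and> carrier A' = vnat ` {..<n} \<and> A \<noteq> A'"
proof -
  obtain \<psi> where \<psi>: "literal_of L \<psi>" "\<not> holds_of_distinct_tuples K \<psi>"
    "\<not> holds_of_distinct_tuples K (NegLit \<psi>)"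
    using assms unfolding trivial_class_def by blast
  define n where "n = literal_arity \<psi>"
  define r where "r v = card {w \<in> free_vars \<psi>. w < v}" for v
  have r: "r v < n" if "v \<in> free_vars \<psi>" for v
    unfolding r_def n_def literal_arity_def
    using that by (intro psubset_card_mono finite_free_vars) auto
  have neg: "literal_arity (NegLit \<psi>) = n" unfolding n_def literal_arity_def by simp
  obtain A0 xs where A0: "A0 \<in> K" "length xs = n" "distinct xs" "set xs \<subseteq> carrier A0"
    "\<not> literal_holds_of A0 \<psi> xs"
    using \<psi>(2) unfolding holds_of_distinct_tuples_def n_def by blast
  obtain A1 ys where A1: "A1 \<in> K" "length ys = n" "distinct ys" "set ys \<subseteq> carrier A1"
    "\<not> literal_holds_of A1 (NegLit \<psi>) ys"
    using \<psi>(3) unfolding holds_of_distinct_tuples_def neg by blast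
  have copy: "\<exists>B\<in>K. carrier B = vnat ` {..<n} \<and>
      (literal_sat B (\<lambda>v. vnat (r v)) \<psi> \<longleftrightarrow> literal_holds_of A \<psi> zs)"
    if A: "A \<in> K" and zs: "length zs = n" "distinct zs" "set zs \<subseteq> carrier A" for A zs
  proof -
    have inj: "inj_on ((!) zs) {..<n}" using zs by (intro inj_on_nth) auto
    define h :: "'u \<Rightarrow> 'u" where "h x = vnat (inv_into {..<n} ((!) zs) x)" for x
    have h: "h (zs ! i) = vnat i" if "i < n" for i
      unfolding h_def using that inv_into_f_f[OF inj, of i] by simp
    have zsn: "set zs = (!) zs ` {..<n}" using zs(1) by (auto simp: set_conv_nth)
    have hX: "h ` set zs = vnat ` {..<n}"
      unfolding zsn image_image using h by (intro image_cong) auto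
    have hinj: "inj_on h (set zs)"
    proof (rule inj_onI)
      fix x y assume "x \<in> set zs" "y \<in> set zs" and hxy: "h x = h y"
      then obtain i j where "x = zs ! i" "i < n" "y = zs ! j" "j < n" unfolding zsn by blast
      then show "x = y" using h hxy by simp
    qed
    define B where "B = transport L (graph h (set zs)) A"
    note T = transport_structure[OF L K_structure[OF A] _ zs(3), of h, folded B_def]
    have "B \<in> K"
      unfolding B_def using A zs(3) _ hinj
      by (rule transport_in_K) (use hX vnat_in_V in auto)
    moreover have "carrier B = vnat ` {..<n}" using T(2) hX by simp
    moreover have "literal_sat B (\<lambda>v. vnat (r v)) \<psi> \<longleftrightarrow> literal_holds_of A \<psi> zs"
    proof -
      have cong: "literal_sat B s \<phi> \<longleftrightarrow> literal_sat B s' \<phi>"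
        if "\<And>v. v \<in> free_vars \<phi> \<Longrightarrow> s v = s' v" for s s' \<phi>
        using that
      proof (induction \<phi>)
        case (RelAtom R vs)
        then have "map s vs = map s' vs" by simp
        then show ?case by (simp only: literal_sat.simps)
      qed simp_all
      have "literal_sat B (\<lambda>v. vnat (r v)) \<psi> \<longleftrightarrow> literal_sat B (\<lambda>v. h (zs ! r v)) \<psi>"
        using h r by (intro cong) simp
      also have "\<dots> \<longleftrightarrow> literal_sat A (\<lambda>v. zs ! r v) \<psi>"
      proof (rule literal_sat_transfer[OF \<psi>(1) hinj])
        show "(\<lambda>v. zs ! r v) ` free_vars \<psi> \<subseteq> set zs" using r zs(1) by auto
      qed (use T(3) hinj in simp)
      finally show ?thesis unfolding literal_holds_of_def r_def .
    qed
    ultimately show ?thesis by blast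
  qed
  obtain A where A: "A \<in> K" "carrier A = vnat ` {..<n}"
    "literal_sat A (\<lambda>v. vnat (r v)) \<psi> \<longleftrightarrow> literal_holds_of A0 \<psi> xs"
    using copy[OF A0(1-4)] by blast
  obtain A' where A': "A' \<in> K" "carrier A' = vnat ` {..<n}"
    "literal_sat A' (\<lambda>v. vnat (r v)) \<psi> \<longleftrightarrow> literal_holds_of A1 \<psi> ys"
    using copy[OF A1(1-4)] by blast
  have "literal_holds_of A1 \<psi> ys" using A1(5) unfolding literal_holds_of_def by simp
  then have ne: "A \<noteq> A'" using A(3) A'(3) A0(5) by blast
  \<comment> \<open>With \<open>n = 0\<close> both carriers would be empty, and the nullary
    relations, being constant on the class, could not distinguish the structures.\<close>
  have "n > 0"
  proof (rule ccontr)
    assume "\<not> n > 0"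
    then have c: "carrier A = {}" "carrier A' = {}" using A(2) A'(2) by auto
    have "A = A'"
    proof (rule structure_ext[OF K_structure[OF A(1)] K_structure[OF A'(1)]])
      fix R xs assume "R \<in> vdom L" "length xs = arity L R" "set xs \<subseteq> carrier A"
      then show "holds_rel A R xs \<longleftrightarrow> holds_rel A' R xs"
        using nullary[OF A(1) A'(1), of R] c by simp
    qed (simp add: c)
    with ne show False ..
  qed
  with A A' ne show ?thesis by blast
qed

text \<open>The bit read from a block is settled once the condition contains the block: further
  strengthening leaves the structure on it unchanged.\<close>

lemma transport_block_substructure:
  assumes p: "p \<in> K" and r: "r \<in> K" and pr: "substructure L p r" and b: "block n k \<subseteq> carrier p"
  shows "transport L (block_map n (vnat k)) r = transport L (block_map n (vnat k)) p"
proof -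
  have br: "block n k \<subseteq> carrier r" using b pr unfolding substructure_def by blast
  note Tp = transport_structure[OF L K_structure[OF p] finite_block b, of "shift n k", folded block_map_vnat]
  note Tr = transport_structure[OF L K_structure[OF r] finite_block br, of "shift n k", folded block_map_vnat]
  show ?thesis
  proof (rule structure_ext[OF Tr(1) Tp(1)])
    show "carrier (transport L (block_map n (vnat k)) r) = carrier (transport L (block_map n (vnat k)) p)"
      unfolding Tp(2) Tr(2) ..
    fix R xs assume R: "R \<in> vdom L" and xs: "length xs = arity L R"
      "set xs \<subseteq> carrier (transport L (block_map n (vnat k)) r)"
    have "set xs \<subseteq> shift n k ` block n k" using xs(2) unfolding Tr(2) .
    then have "xs \<in> map (shift n k) ` lists (block n k)"
      unfolding lists_image[symmetric] by (simp add: lists_eq_set)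
    then obtain ys where ys: "xs = map (shift n k) ys" "set ys \<subseteq> block n k"
      by (auto simp: lists_eq_set)
    have "holds_rel p R ys \<longleftrightarrow> holds_rel r R ys"
      using pr R ys xs(1) b unfolding substructure_def by simp
    then show "holds_rel (transport L (block_map n (vnat k)) r) R xs \<longleftrightarrow> holds_rel (transport L (block_map n (vnat k)) p) R xs"
      unfolding ys(1) using Tp(3)[OF inj_shift R ys(2)] Tr(3)[OF inj_shift R ys(2)] by simp
  qed
qed

text \<open>The freedom to write any bit next: \<open>B\<close> is placed on the new block by
  disjoint amalgamation, and shifting the block back recovers \<open>B\<close> itself.\<close>

lemma extend_block:
  assumes p: "p \<in> K" "carrier p = vnat ` {..<n * k}" and B: "B \<in> K" "carrier B = vnat ` {..<n}"
  shows "\<exists>p'\<in>K. substructure L p p' \<and> carrier p' = vnat ` {..<n * Suc k} \<and>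
    transport L (block_map n (vnat k)) p' = B"
proof -
  define g :: "'u \<Rightarrow> 'u" where "g x = vnat (n * k + vnat_inv x)" for x
  have gB: "g ` carrier B = block n k" unfolding g_def B(2) block_def image_image by simp
  have inj: "inj_on g (carrier B)" unfolding B(2) g_def by (auto intro!: inj_onI)
  have "block n k \<subseteq> V" unfolding block_def using vnat_in_V by blast
  moreover have "block n k \<inter> carrier p = {}" unfolding p(2) block_def by auto
  ultimately obtain C where C: "C \<in> K" "carrier C = carrier p \<union> block n k" "substructure L p C"
    "embedding L B C g"
    using disjoint_amalgam[OF p(1) B(1) inj] unfolding gB by blast
  have "carrier C = vnat ` {..<n * Suc k}"
  proof -
    have "{..<n * Suc k} = {..<n * k} \<union> (\<lambda>i. n * k + i) ` {..<n}"
    proof (intro equalityI subsetI)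
      fix i assume i: "i \<in> {..<n * Suc k}"
      show "i \<in> {..<n * k} \<union> (\<lambda>i. n * k + i) ` {..<n}"
      proof (cases "i < n * k")
        case False
        with i have "i = n * k + (i - n * k)" "i - n * k < n" by auto
        then show ?thesis by blast
      qed simp
    qed auto
    then show ?thesis unfolding C(2) p(2) block_def by (simp only: image_Un image_image)
  qed
  moreover have "transport L (block_map n (vnat k)) C = B"
  proof -
    have bC: "block n k \<subseteq> carrier C" using C(2) by blast
    note T = transport_structure[OF L K_structure[OF C(1)] finite_block bC, of "shift n k", folded block_map_vnat]
    show ?thesis
    proof (rule structure_ext[OF T(1) K_structure[OF B(1)]])
      show c: "carrier (transport L (block_map n (vnat k)) C) = carrier B" unfolding T(2) shift_block B(2) ..
      fix R xs assume R: "R \<in> vdom L" and xs: "length xs = arity L R"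
        "set xs \<subseteq> carrier (transport L (block_map n (vnat k)) C)"
      have xsB: "set xs \<subseteq> carrier B" using xs(2) c by blast
      have "shift n k (g x) = x" if "x \<in> carrier B" for x
        using that unfolding B(2) shift_def g_def by auto
      then have eq: "map (shift n k) (map g xs) = xs" using xsB by (simp add: map_idI subset_iff)
      have sub: "set (map g xs) \<subseteq> block n k" using xsB gB by auto
      show "holds_rel (transport L (block_map n (vnat k)) C) R xs \<longleftrightarrow> holds_rel B R xs"
        using T(3)[OF inj_shift R sub] embedding_holds[OF C(4) R xs(1) xsB] unfolding eq by simp
    qed
  qed
  ultimately show ?thesis using C by blast
qed

text \<open>Points are added one at a time, each as a copy of a one-point substructure of
  \<open>A\<close> amalgamated disjointly.\<close>

lemma extend_carrier:
  assumes p: "p \<in> K" and A: "A \<in> K" "carrier A \<noteq> {}" and Y: "finite Y" "Y \<subseteq> V"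
  shows "\<exists>p'\<in>K. substructure L p p' \<and> carrier p' = carrier p \<union> Y"
  using Y
proof (induction rule: finite_induct)
  case empty
  then show ?case using p substructure_refl[OF K_structure[OF p]] by auto
next
  case (insert y Y)
  then obtain p' where p': "p' \<in> K" "substructure L p p'" "carrier p' = carrier p \<union> Y" by auto
  show ?case
  proof (cases "y \<in> carrier p'")
    case True
    with p' show ?thesis by auto
  next
    case False
    obtain a where a: "a \<in> carrier A" using A(2) by blast
    define E where "E = transport L (graph (\<lambda>x. x) {a}) A"
    have "E \<in> K"
      unfolding E_def using a carrier_in_V[OF A(1)] by (intro transport_in_K A(1)) auto
    have cE: "carrier E = {a}"
      using transport_structure(2)[OF L K_structure[OF A(1)], of "{a}" "\<lambda>x. x"] a unfolding E_def by simp
    obtain C where C: "C \<in> K" "carrier C = carrier p' \<union> (\<lambda>x. y) ` carrier E" "substructure L p' C"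
      using disjoint_amalgam[OF p'(1) \<open>E \<in> K\<close>, of "\<lambda>x. y"] False insert.prems unfolding cE by auto
    have "carrier C = carrier p \<union> insert y Y" using C(2) p'(3) cE by auto
    then show ?thesis using C substructure_trans[OF p'(2) C(3)] by blast
  qed
qed

lemma extend_initial:
  assumes p: "p \<in> Cond" and A: "A \<in> K" "carrier A = vnat ` {..<n}" and n: "n > 0"
  shows "\<exists>k. \<exists>p'\<in>K. substructure L p p' \<and> carrier p' = vnat ` {..<n * k}"
proof -
  have pK: "p \<in> K" "carrier p \<subseteq> range vnat" using p unfolding Cond_iff by auto
  then obtain I where I: "finite I" "carrier p = vnat ` I"
    using finite_subset_image[OF K_finite[OF pK(1)], of vnat UNIV] by auto
  then obtain b where b: "I \<subseteq> {..<b}" using finite_nat_set_iff_bounded[of I] by auto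
  \<comment> \<open>Blocks are non-empty, so the first \<open>b\<close> of them cover all numbers
    below \<open>b\<close>.\<close>
  have "b \<le> n * b" using n by (cases n) simp_all
  then have "I \<subseteq> {..<n * b}" using b by (meson lessThan_subset_iff order_trans)
  then have sub: "carrier p \<subseteq> vnat ` {..<n * b}" unfolding I(2) by (rule image_mono)
  have "0 \<in> {..<n}" using n by simp
  then have "carrier A \<noteq> {}" unfolding A(2) by blast
  from extend_carrier[OF pK(1) A(1) this, of "vnat ` {..<n * b}"]
  obtain p' where "p' \<in> K" "substructure L p p'" "carrier p' = carrier p \<union> vnat ` {..<n * b}"
    using vnat_in_V by auto
  then show ?thesis using sub by (intro exI[of _ b] bexI[of _ p']) auto
qed

end

section \<open>The projection of a generic filter\<close>

locale generic_projection =
  F0: fraisse_class V L K0 + F1: fraisse_class V L K1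
  for V :: "'u::set_universe set" and L K0 K1 +
  fixes n :: nat and A A' :: 'u and g :: "'u \<Rightarrow> 'u" and G :: 'u and P0 P1 :: 'u
  assumes n: "n > 0" and A: "A \<in> K0" "carrier A = vnat ` {..<n}"
    and A': "A' \<in> K0" "carrier A' = vnat ` {..<n}" and AA': "A \<noteq> A'"
    and tm_g: "F0.tm (\<lambda>e. g (e 0))" and g_Cond: "\<And>k. g (vnat k) \<in> F1.Cond"
    and g_hits: "\<And>q m. q \<in> F1.Cond \<Longrightarrow> \<exists>k\<ge>m. g (vnat k) = q"
    and generic: "generic_over V F0.Cond (stronger L) G"
    and P0: "P0 \<in> V" "elts P0 = F0.Cond" and P1: "P1 \<in> V" "elts P1 = F1.Cond"
begin

text \<open>The state carries the stage next to the current member of the chain, since the iterated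
  operation has no other access to its index. \<open>extends\<close> stands in for the order to keep
  the step definable.\<close>

definition step :: "'u \<Rightarrow> 'u \<Rightarrow> 'u" where
  "step p z = kpair (vsuc (F0.pfst z))
    (if F0.transport L (F0.block_map n (F0.pfst z)) p = A \<and> F1.extends (g (F0.pfst z)) (F0.psnd z)
     then g (F0.pfst z) else F0.psnd z)"

lemma step_kpair:
  "step p (kpair x q) = kpair (vsuc x) (if F0.transport L (F0.block_map n x) p = A \<and> F1.extends (g x) q then g x else q)"
  unfolding step_def by simp

definition proj :: "'u \<Rightarrow> 'u \<Rightarrow> 'u" where
  "proj p x = F0.psnd (iter (step p) (kpair (vnat 0) (g (vnat 0))) x)"

lemma tm_g': "F0.tm t \<Longrightarrow> F0.tm (\<lambda>e. g (t e))"
  by (rule F0.tm_subst[where F = "\<lambda>e. g", OF _ tm_g])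

lemma A_in_V: "A \<in> V" using F0.K_in_V[OF A(1)] .

text \<open>Definability jointly in the condition and the stage is what puts pulled-back dense sets
  and the name of the new filter into \<open>V\<close>.\<close>

lemma tm_proj:
  assumes p: "F0.tm p" and x: "F0.tm x" shows "F0.tm (\<lambda>e. proj (p e) (x e))"
  unfolding proj_def step_def
  by (intro F0.tm_psnd F0.tm_iter[where F = "\<lambda>e z. kpair (vsuc (F0.pfst z))
    (if F0.transport L (F0.block_map n (F0.pfst z)) (p e) = A \<and> F1.extends (g (F0.pfst z)) (F0.psnd z)
     then g (F0.pfst z) else F0.psnd z)"] F0.tm_kpair F0.tm_vsuc F0.tm_pfst F0.tm_if F0.dfn_conj
     F0.dfn_eq F0.tm_transport F0.L_in_V F0.tm_block_map F1.dfn_extends tm_g' F0.tm_var F0.tm_ren[OF p] x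
     F0.tm_const[OF A_in_V] F0.tm_const[OF F0.vnat_in_V])

lemma state: "iter (step p) (kpair (vnat 0) (g (vnat 0))) (vnat k) = kpair (vnat k) (proj p (vnat k))"
proof -
  have "\<exists>q. iter (step p) (kpair (vnat 0) (g (vnat 0))) (vnat k) = kpair (vnat k) q"
  proof (induction k)
    case (Suc k)
    then obtain q where "(step p ^^ k) (kpair (vnat 0) (g (vnat 0))) = kpair (vnat k) q" by auto
    then show ?case by (simp add: step_kpair)
  qed simp
  then show ?thesis unfolding proj_def by auto
qed

lemma proj_0: "proj p (vnat 0) = g (vnat 0)"
  unfolding proj_def by simp

lemma proj_Suc: "proj p (vnat (Suc k)) =
   (if F0.transport L (F0.block_map n (vnat k)) p = A \<and> F1.extends (g (vnat k)) (proj p (vnat k))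
    then g (vnat k) else proj p (vnat k))"
proof -
  have "proj p (vnat (Suc k)) = F0.psnd (step p (iter (step p) (kpair (vnat 0) (g (vnat 0))) (vnat k)))"
    unfolding proj_def by simp
  then show ?thesis unfolding state step_kpair by simp
qed

lemma proj_Cond: "proj p (vnat k) \<in> F1.Cond"
  by (induction k) (simp_all add: proj_0 proj_Suc g_Cond)

lemma Cond_extends: "q \<in> F1.Cond \<Longrightarrow> q' \<in> F1.Cond \<Longrightarrow> F1.extends q q' \<longleftrightarrow> stronger L q q'"
  by (rule F1.extends_iff) (simp_all add: F1.Cond_iff)

lemma Cond_refl: "q \<in> F1.Cond \<Longrightarrow> stronger L q q"
  unfolding stronger_def F1.Cond_iff using substructure_refl F1.K_structure by blast

lemma proj_antimono: "m \<le> k \<Longrightarrow> stronger L (proj p (vnat k)) (proj p (vnat m))"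
proof (induction k rule: dec_induct)
  case base
  show ?case by (rule Cond_refl[OF proj_Cond])
next
  case (step k)
  have "stronger L (proj p (vnat (Suc k))) (proj p (vnat k))"
    using Cond_extends[OF g_Cond proj_Cond] Cond_refl[OF proj_Cond] by (simp add: proj_Suc)
  then show ?case using step.IH by (rule stronger_trans)
qed

definition full :: "'u \<Rightarrow> nat \<Rightarrow> bool" where
  "full p m \<longleftrightarrow> (\<forall>j<m. block n j \<subseteq> carrier p)"

text \<open>The first \<open>m\<close> steps consult only the first \<open>m\<close> blocks, and
  their bits can no longer change.\<close>

lemma proj_stronger:
  assumes p: "p \<in> F0.Cond" and r: "r \<in> F0.Cond" and rp: "stronger L r p" and "full p m"
  shows "proj r (vnat m) = proj p (vnat m)"
  using assms(4)
proof (induction m)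
  case (Suc m)
  have "F0.transport L (F0.block_map n (vnat m)) r = F0.transport L (F0.block_map n (vnat m)) p"
    using p r rp Suc.prems unfolding F0.Cond_iff stronger_def full_def
    by (intro F0.transport_block_substructure) simp_all
  moreover have "proj r (vnat m) = proj p (vnat m)"
    using Suc unfolding full_def by simp
  ultimately show ?case by (simp add: proj_Suc)
qed (simp add: proj_0)

lemma full_stronger: "stronger L r p \<Longrightarrow> full p m \<Longrightarrow> full r m"
proof -
  assume "stronger L r p" and p: "full p m"
  then have "carrier p \<subseteq> carrier r" by (simp add: stronger_def substructure_def)
  with p show "full r m" unfolding full_def by blast
qed

lemma full_initial: "carrier p = vnat ` {..<n * m} \<Longrightarrow> full p m"
  unfolding full_def by (simp add: block_subset)

text \<open>Writing copies of \<open>A'\<close> on the next blocks leaves the projection unchanged, so that any stage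
  at which \<open>g\<close> lists a given stronger condition can be reached.\<close>

lemma proj_dense:
  assumes p: "p \<in> F0.Cond" and D: "D \<subseteq> F1.Cond" "\<And>q. q \<in> F1.Cond \<Longrightarrow> \<exists>d\<in>D. stronger L d q"
  shows "\<exists>r\<in>F0.Cond. stronger L r p \<and> (\<exists>m. full r m \<and> (\<exists>q\<in>D. stronger L (proj r (vnat m)) q))"
proof -
  \<comment> \<open>The condition is first completed to a whole number of blocks: then the next bit
    to be written is the one for stage \<open>m\<close>, and all earlier bits are decided.\<close>
  obtain m p1 where p1: "p1 \<in> K0" "substructure L p p1" "carrier p1 = vnat ` {..<n * m}"
    using F0.extend_initial[OF p A n] by blast
  have p1C: "p1 \<in> F0.Cond" using p1 unfolding F0.Cond_iff by auto
  obtain d where d: "d \<in> D" "stronger L d (proj p1 (vnat m))" using D(2)[OF proj_Cond] by blast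
  have dC: "d \<in> F1.Cond" using d(1) D(1) by blast
  \<comment> \<open>An occurrence of \<open>d\<close> before stage \<open>m\<close> would be
    useless, since the blocks for those stages are already filled.\<close>
  obtain k where k: "k \<ge> m" "g (vnat k) = d" using g_hits[OF dC] by blast
  have "\<exists>r\<in>K0. substructure L p1 r \<and> carrier r = vnat ` {..<n * k} \<and> proj r (vnat k) = proj p1 (vnat m)"
    using k(1)
  proof (induction k rule: dec_induct)
    case base
    show ?case using p1 substructure_refl[OF F0.K_structure[OF p1(1)]] by blast
  next
    case (step k)
    then obtain r where r: "r \<in> K0" "substructure L p1 r" "carrier r = vnat ` {..<n * k}"
      "proj r (vnat k) = proj p1 (vnat m)" by blast
    obtain s where s: "s \<in> K0" "substructure L r s" "carrier s = vnat ` {..<n * Suc k}"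
      "F0.transport L (F0.block_map n (vnat k)) s = A'"
      using F0.extend_block[OF r(1,3) A'] by blast
    have "proj s (vnat k) = proj r (vnat k)"
    proof (rule proj_stronger)
      show "r \<in> F0.Cond" "s \<in> F0.Cond" using r s unfolding F0.Cond_iff by auto
    qed (use r s full_initial in \<open>simp_all add: stronger_def\<close>)
    then have "proj s (vnat (Suc k)) = proj p1 (vnat m)"
      using s(4) AA' r(4) by (simp add: proj_Suc)
    then show ?case using s substructure_trans[OF r(2) s(2)] by blast
  qed
  then obtain r where r: "r \<in> K0" "substructure L p1 r" "carrier r = vnat ` {..<n * k}"
      "proj r (vnat k) = proj p1 (vnat m)" by blast
  \<comment> \<open>A copy of \<open>A\<close> on block \<open>k\<close> triggers the move to
    \<open>g (vnat k) = d\<close>, which is allowed because the chain is still at the member below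
    which \<open>d\<close> was chosen.\<close>
  obtain s where s: "s \<in> K0" "substructure L r s" "carrier s = vnat ` {..<n * Suc k}"
      "F0.transport L (F0.block_map n (vnat k)) s = A"
    using F0.extend_block[OF r(1,3) A] by blast
  have sC: "s \<in> F0.Cond" using s unfolding F0.Cond_iff by auto
  have "proj s (vnat k) = proj r (vnat k)"
  proof (rule proj_stronger)
    show "r \<in> F0.Cond" using r unfolding F0.Cond_iff by auto
  qed (use sC r s full_initial in \<open>simp_all add: stronger_def\<close>)
  then have "proj s (vnat k) = proj p1 (vnat m)" using r(4) by simp
  moreover have "F1.extends (g (vnat k)) (proj p1 (vnat m))"
    unfolding k(2) using Cond_extends[OF dC proj_Cond] d(2) by blast
  ultimately have "proj s (vnat (Suc k)) = d" using s(4) k(2) by (simp add: proj_Suc)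
  then have "stronger L (proj s (vnat (Suc k))) d" using Cond_refl[OF dC] by simp
  moreover have "stronger L s p"
    unfolding stronger_def using substructure_trans[OF p1(2) substructure_trans[OF r(2) s(2)]] .
  ultimately show ?thesis using sC full_initial[OF s(3)] d(1) by blast
qed

section \<open>The induced filter, its genericity and its name\<close>

lemma filter: "is_filter_on F0.Cond (stronger L) (elts G)"
  and G_dense: "D \<in> V \<Longrightarrow> dense_in F0.Cond (stronger L) (elts D) \<Longrightarrow> elts G \<inter> elts D \<noteq> {}"
  using generic unfolding generic_over_def by blast+

lemma G_Cond: "p \<in> elts G \<Longrightarrow> p \<in> F0.Cond"
  and G_directed: "p \<in> elts G \<Longrightarrow> p' \<in> elts G \<Longrightarrow> \<exists>r\<in>elts G. stronger L r p \<and> stronger L r p'"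
  using filter unfolding is_filter_on_def by blast+

definition G1 :: 'u where
  "G1 = vset {q \<in> elts P1. \<exists>p\<in>elts G. \<exists>m. full p m \<and> stronger L (proj p (vnat m)) q}"

lemma elts_G1: "elts G1 = {q \<in> F1.Cond. \<exists>p\<in>elts G. \<exists>m. full p m \<and> stronger L (proj p (vnat m)) q}"
  unfolding G1_def by (subst elts_vset_Collect) (simp only: P1(2))

lemma full_0: "full p 0"
  unfolding full_def by simp

lemma G1_filter: "is_filter_on F1.Cond (stronger L) (elts G1)"
  unfolding is_filter_on_def
proof (intro conjI ballI impI)
  show "elts G1 \<subseteq> F1.Cond" unfolding elts_G1 by blast
  obtain p where p: "p \<in> elts G" using filter unfolding is_filter_on_def by blast
  have "proj p (vnat 0) \<in> elts G1"
    unfolding elts_G1 using p full_0 Cond_refl[OF proj_Cond] proj_Cond by blast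
  then show "elts G1 \<noteq> {}" by blast
next
  fix q q' assume "q \<in> elts G1" "q' \<in> F1.Cond" "stronger L q q'"
  then show "q' \<in> elts G1" unfolding elts_G1 using stronger_trans by blast
next
  fix q q' assume "q \<in> elts G1" "q' \<in> elts G1"
  then obtain p m p' m' where p: "p \<in> elts G" "full p m" "stronger L (proj p (vnat m)) q"
    and p': "p' \<in> elts G" "full p' m'" "stronger L (proj p' (vnat m')) q'"
    unfolding elts_G1 by blast
  obtain r where r: "r \<in> elts G" "stronger L r p" "stronger L r p'"
    using G_directed[OF p(1) p'(1)] by blast
  \<comment> \<open>The common strengthening \<open>r\<close> contains the first \<open>m\<close>
    and the first \<open>m'\<close> blocks, hence the first \<open>k\<close>. Its value at
    \<open>k\<close> lies below its values at \<open>m\<close> and \<open>m'\<close>, which are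
    those of \<open>p\<close> and \<open>p'\<close>.\<close>
  define k where "k = max m m'"
  have "full r k"
    using full_stronger[OF r(2) p(2)] full_stronger[OF r(3) p'(2)] unfolding k_def full_def
    by (metis max_def)
  moreover have "stronger L (proj r (vnat k)) q"
    using proj_antimono[of m k r] proj_stronger[OF G_Cond[OF p(1)] G_Cond[OF r(1)] r(2) p(2)]
      stronger_trans p(3) unfolding k_def by simp
  moreover have "stronger L (proj r (vnat k)) q'"
    using proj_antimono[of m' k r] proj_stronger[OF G_Cond[OF p'(1)] G_Cond[OF r(1)] r(3) p'(2)]
      stronger_trans p'(3) unfolding k_def by simp
  moreover have "proj r (vnat k) \<in> elts G1"
    unfolding elts_G1 using r(1) \<open>full r k\<close> Cond_refl[OF proj_Cond] proj_Cond by blast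
  ultimately show "\<exists>r\<in>elts G1. stronger L r q \<and> stronger L r q'" by blast
qed

text \<open>A definable rendering of \<open>full\<close> and \<open>stronger\<close>: among von
  Neumann naturals the elements of \<open>x\<close> are the smaller numbers, and the domain of
  \<open>block_map n y\<close> is the \<open>y\<close>-th block.\<close>

lemma dfn_full_proj:
  assumes p: "F0.tm p" and q: "F0.tm q"
  shows "F0.dfn (\<lambda>e. \<exists>x\<in>elts omega. (\<forall>y\<in>elts x. elts (F0.dm (F0.block_map n y)) \<subseteq> elts (F0.pfst (p e))) \<and>
    F1.extends (proj (p e) x) (q e))"
  by (intro F0.dfn_bex F0.dfn_conj F0.dfn_ball F0.dfn_subset F0.tm_dm F0.tm_block_map F0.tm_pfst F0.tm_var
      F0.tm_ren[OF p] F0.tm_ren[OF q] F1.dfn_extends tm_proj F0.tm_const[OF F0.omega_in_V])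

lemma full_proj_iff:
  assumes "p \<in> F0.Cond" "q \<in> F1.Cond"
  shows "(\<exists>x\<in>elts omega. (\<forall>y\<in>elts x. elts (F0.dm (F0.block_map n y)) \<subseteq> elts (F0.pfst p)) \<and> F1.extends (proj p x) q)
    \<longleftrightarrow> (\<exists>m. full p m \<and> stronger L (proj p (vnat m)) q)"
proof -
  have "elts (F0.pfst p) = carrier p"
    using assms(1) F0.structure_pfst[OF F0.K_structure] unfolding F0.Cond_iff by blast
  then have "(\<forall>y\<in>elts (vnat m). elts (F0.dm (F0.block_map n y)) \<subseteq> elts (F0.pfst p)) \<longleftrightarrow> full p m" for m
    unfolding full_def by (auto simp: elts_vnat F0.dm_block_map)
  then show ?thesis
    unfolding F0.elts_omega by (simp add: Cond_extends[OF proj_Cond assms(2)])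
qed

lemma G1_generic: "generic_over V F1.Cond (stronger L) G1"
  unfolding generic_over_def
proof (intro conjI ballI impI)
  show "is_filter_on F1.Cond (stronger L) (elts G1)" by (rule G1_filter)
  fix D assume D: "D \<in> V" "dense_in F1.Cond (stronger L) (elts D)"
  then have DC: "elts D \<subseteq> F1.Cond" "\<And>q. q \<in> F1.Cond \<Longrightarrow> \<exists>d\<in>elts D. stronger L d q"
    unfolding dense_in_def by blast+
  \<comment> \<open>The pull-back of \<open>D\<close>: the conditions whose projection at some
    decided stage already lies below a member of \<open>D\<close>. It is dense by
    \<open>proj_dense\<close>, and upward closure of \<open>G1\<close> turns a meeting with
    \<open>G\<close> into a meeting with \<open>D\<close>.\<close>
  define E where "E = vset {p \<in> elts P0. \<exists>q\<in>elts D. \<exists>x\<in>elts omega.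
    (\<forall>y\<in>elts x. elts (F0.dm (F0.block_map n y)) \<subseteq> elts (F0.pfst p)) \<and> F1.extends (proj p x) q}"
  have "F0.tm (\<lambda>e. E)"
    unfolding E_def by (intro F0.tm_sep F0.dfn_bex[where t = "\<lambda>e. D"] dfn_full_proj F0.tm_var
      F0.tm_const[OF P0(1)] F0.tm_const[OF D(1)])
  then have EV: "E \<in> V" by (rule F0.tm_closed)
  have eE: "elts E = {p \<in> F0.Cond. \<exists>q\<in>elts D. \<exists>m. full p m \<and> stronger L (proj p (vnat m)) q}"
    unfolding E_def
    by (subst elts_vset_Collect, unfold P0(2), rule Collect_cong, rule conj_cong[OF refl],
        rule bex_cong[OF refl], rule full_proj_iff) (use DC(1) in blast)+
  have "dense_in F0.Cond (stronger L) (elts E)"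
    unfolding dense_in_def
  proof (intro conjI ballI)
    show "elts E \<subseteq> F0.Cond" unfolding eE by blast
    fix p assume "p \<in> F0.Cond"
    from proj_dense[OF this DC] show "\<exists>d\<in>elts E. stronger L d p" unfolding eE by blast
  qed
  from G_dense[OF EV this] obtain p q m where "p \<in> elts G" "q \<in> elts D" "full p m"
    "stronger L (proj p (vnat m)) q" unfolding eE by blast
  then have "q \<in> elts G1" unfolding elts_G1 using DC(1) by blast
  with \<open>q \<in> elts D\<close> show "elts G1 \<inter> elts D \<noteq> {}" by blast
qed

lemma G1_in_extension: "G1 \<in> generic_extension V F0.Cond G"
proof -
  obtain p0 where p0: "p0 \<in> elts G" using filter unfolding is_filter_on_def by blast
  have p0V: "p0 \<in> V" using F0.V_trans[OF P0(1)] G_Cond[OF p0] P0(2) by blast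
  define T where "T = vset {z \<in> elts (F0.vprod P1 P0). \<exists>x\<in>elts omega.
    (\<forall>y\<in>elts x. elts (F0.dm (F0.block_map n y)) \<subseteq> elts (F0.pfst (F0.psnd z))) \<and>
    F1.extends (proj (F0.psnd z) x) (F0.pfst z)}"
  \<comment> \<open>The name pairs the canonical name of \<open>q\<close> with every condition whose
    projection at some decided stage is stronger than \<open>q\<close>. Evaluating by
    \<open>G\<close> keeps exactly the members of \<open>G1\<close>, since \<open>p0\<close> is in
    \<open>G\<close>.\<close>
  define \<tau> where "\<tau> = vset ((\<lambda>z. kpair (check_name p0 (F0.pfst z)) (F0.psnd z)) ` elts T)"
  have "F0.tm (\<lambda>e. \<tau>)"
    unfolding \<tau>_def T_def
    by (intro F0.tm_repl F0.tm_sep dfn_full_proj F0.tm_vprod F0.tm_kpair F0.tm_check_name p0V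
        F0.tm_pfst F0.tm_psnd F0.tm_var F0.tm_const[OF P0(1)] F0.tm_const[OF P1(1)])
  then have \<tau>V: "\<tau> \<in> V" by (rule F0.tm_closed)
  have eT: "elts T = {kpair q p | q p. q \<in> F1.Cond \<and> p \<in> F0.Cond \<and>
      (\<exists>m. full p m \<and> stronger L (proj p (vnat m)) q)}"
  proof (intro equalityI subsetI)
    fix z assume z: "z \<in> elts T"
    then obtain q p where qp: "z = kpair q p" "q \<in> F1.Cond" "p \<in> F0.Cond"
      unfolding T_def elts_vset_Collect unfolding F0.elts_vprod P0(2) P1(2) by blast
    with z full_proj_iff[OF qp(3,2)]
    show "z \<in> {kpair q p | q p. q \<in> F1.Cond \<and> p \<in> F0.Cond \<and>
      (\<exists>m. full p m \<and> stronger L (proj p (vnat m)) q)}"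
      unfolding T_def elts_vset_Collect by simp
  next
    fix z assume "z \<in> {kpair q p | q p. q \<in> F1.Cond \<and> p \<in> F0.Cond \<and>
      (\<exists>m. full p m \<and> stronger L (proj p (vnat m)) q)}"
    then obtain q p where qp: "z = kpair q p" "q \<in> F1.Cond" "p \<in> F0.Cond"
      "\<exists>m. full p m \<and> stronger L (proj p (vnat m)) q" by blast
    then show "z \<in> elts T"
      unfolding T_def elts_vset_Collect unfolding F0.elts_vprod P0(2) P1(2)
      using full_proj_iff[OF qp(3,2)] by simp
  qed
  have e\<tau>: "elts \<tau> = {kpair (check_name p0 q) p | q p. kpair q p \<in> elts T}"
    unfolding \<tau>_def by (subst elts_vset_image, unfold eT) force
  have "is_name F0.Cond \<tau>"
  proof (rule is_name.intros, intro ballI)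
    fix z assume "z \<in> elts \<tau>"
    then obtain q p where "z = kpair (check_name p0 q) p" "p \<in> F0.Cond" unfolding e\<tau> eT by auto
    then show "\<exists>\<sigma> p. z = kpair \<sigma> p \<and> is_name F0.Cond \<sigma> \<and> p \<in> F0.Cond"
      using is_name_check_name[OF G_Cond[OF p0]] by blast
  qed
  moreover have "name_val G \<tau> = G1"
  proof -
    have "{\<sigma>. \<exists>p\<in>elts G. kpair \<sigma> p \<in> elts \<tau>} = check_name p0 ` elts G1"
      unfolding e\<tau> eT elts_G1 using G_Cond by auto
    then have "name_val G \<tau> = vset ((\<lambda>q. q) ` elts G1)"
      by (subst name_val.simps) (simp add: image_image name_val_check_name[OF p0])
    then show ?thesis by simp
  qed
  ultimately show ?thesis
    unfolding generic_extension_def using \<tau>V by (intro CollectI exI[of _ \<tau>]) simp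
qed

end

theorem proposition4p6:
  fixes V :: "'u::set_universe set" and L :: 'u and K0 K1 :: "'u set" and G0 :: 'u
  assumes "transitive_model_ZFC V"
    and "L \<in> V" and "relational_language L"
    and "strong_fraisse_class V L K0" and "\<not> trivial_class L K0"
    and "countably_many_iso_types V L K0"
    and "strong_fraisse_class V L K1" and "\<not> trivial_class L K1"
    and "countably_many_iso_types V L K1"
    and "generic_over V (conditions omega K0) (stronger L) G0"
  shows "\<exists>G1 \<in> generic_extension V (conditions omega K0) G0.
           generic_over V (conditions omega K1) (stronger L) G1"
proof -
  interpret F0: fraisse_class V L K0
    by unfold_locales (rule assms)+
  interpret F1: fraisse_class V L K1
    by unfold_locales (rule assms)+
  obtain n A A' where A: "n > 0" "A \<in> K0" "A' \<in> K0" "carrier A = vnat ` {..<n}"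
    "carrier A' = vnat ` {..<n}" "A \<noteq> A'"
    using F0.nontrivial_structures[OF assms(5)] by blast
  \<comment> \<open>A non-trivial class has a member on an initial segment of \<open>omega\<close>,
    so there are conditions for \<open>K1\<close> to enumerate and a start for the chain.\<close>
  obtain m B where "B \<in> K1" "carrier B = vnat ` {..<m}"
    using F1.nontrivial_structures[OF assms(8)] by blast
  then have "B \<in> F1.Cond" unfolding F1.Cond_iff by auto
  then have ne: "F1.Cond \<noteq> {}" by blast
  obtain P0 where P0: "P0 \<in> V" "elts P0 = F0.Cond" using F0.Cond_enumeration(1)[OF assms(6)] by blast
  obtain P1 where P1: "P1 \<in> V" "elts P1 = F1.Cond" using F1.Cond_enumeration(1)[OF assms(9)] by blast
  obtain g where g: "F0.tm (\<lambda>e. g (e 0))" "\<forall>k. g (vnat k) \<in> F1.Cond"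
    "\<forall>q\<in>F1.Cond. \<forall>m. \<exists>k\<ge>m. g (vnat k) = q"
    using F1.Cond_enumeration(2)[OF assms(9) ne] by blast
  interpret generic_projection V L K0 K1 n A A' g G0 P0 P1
    using A g assms(10) P0 P1 by unfold_locales blast+
  show ?thesis using G1_in_extension G1_generic by blast
qed

end
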